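(* Let $L\subset\overline{\mathbb{Q}}$ be an infinite extension field of $\mathbb{Q}$. Then there exists a weight $w$ such that $\mathrm{Nor}(L\setminus\mu,h^w)$ is a positive (finite) real number.
   Context: Fix an algebraic closure $\overline{\mathbb{Q}}$ of $\mathbb{Q}$. $\mu$ is the set of roots of unity in $\overline{\mathbb{Q}}$. Let $h\colon\overline{\mathbb{Q}}\to\mathbb{R}_{\ge 0}$ be the absolute logarithmic Weil height: for $a$ in a number field $K$, $h(a)=\sum_{v}\frac{[K_v:\mathbb{Q}_v]}{[K:\mathbb{Q}]}\log\max\{1,|a|_v\}$, the sum over all places $v$ of $K$, with $|\cdot|_v$ extending the usual absolute value on $\mathbb{Q}$. For $a\in\overline{\mathbb{Q}}$, $\deg(a)=[\mathbb{Q}(a):\mathbb{Q}]$. A weight is a function $w\colon\mathbb{Z}_{>0}\to\mathbb{R}_{>0}$ that is eventually non-increasing or eventually non-decreasing. The $w$-weighted Weil height is $h^w(a)=w(\deg(a))h(a)$. For a set $S$ and a function $\mathfrak{h}\colon S\to\mathbb{R}_{\ge0}$, $\mathrm{Nor}(S,\mathfrak{h})=\inf\{C\in\mathbb{R}_{>0}\mid \#\{s\in S\mid\mathfrak{h}(s)<C\}=\infty\}$, with $\inf\emptyset=\infty$. *)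

theory Defs
  imports
    "HOL-Analysis.Analysis"
    "HOL-Algebra.Algebraic_Closure_Type"
    "HOL-Algebra.Generated_Fields"
    "HOL-Algebra.QuotRing"
    "HOL-Computational_Algebra.Computational_Algebra"
begin

subsection \<open>Algebraic numbers, number fields and degrees\<close>

text \<open>The fixed algebraic closure of the rationals is the field of algebraic complex numbers.\<close>

abbreviation \<CC> :: "complex ring" where
  "\<CC> \<equiv> ring_of_type_algebra"

definition Qbar :: "complex set" where
  "Qbar = {z. algebraic z}"

definition roots_of_unity :: "complex set" where
  "roots_of_unity = {z. \<exists>n>0. z ^ n = 1}"

definition adjoin :: "complex \<Rightarrow> complex set" where
  "adjoin a = generate_field \<CC> {a}"

definition alg_degree :: "complex \<Rightarrow> nat" where
  "alg_degree a = ring.dim \<CC> \<rat> (adjoin a)"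


subsection \<open>Places of a number field\<close>

definition absolute_value_on :: "complex set \<Rightarrow> (complex \<Rightarrow> real) \<Rightarrow> bool" where
  "absolute_value_on K v \<longleftrightarrow>
     (\<forall>x\<in>K. 0 \<le> v x) \<and>
     (\<forall>x\<in>K. v x = 0 \<longleftrightarrow> x = 0) \<and>
     (\<forall>x\<in>K. \<forall>y\<in>K. v (x * y) = v x * v y) \<and>
     (\<forall>x\<in>K. \<forall>y\<in>K. v (x + y) \<le> v x + v y)"

definition padic_abs :: "nat \<Rightarrow> rat \<Rightarrow> real" where
  "padic_abs p q =
     (if q = 0 then 0
      else real p powi (int (multiplicity (int p) (snd (quotient_of q)))
                        - int (multiplicity (int p) (fst (quotient_of q)))))"

text \<open>
  A place is an equivalence class of nontrivial absolute values on \<open>K\<close>. By Ostrowski's theorem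
  each class has exactly one member that restricts on the rationals to the usual absolute value or
  to the usual \<open>p\<close>-adic one, and the place is represented by that member. Values outside
  \<open>K\<close> are pinned down by extensionality, so that distinct elements are distinct places.
\<close>

definition places :: "complex set \<Rightarrow> (complex \<Rightarrow> real) set" where
  "places K =
     {v \<in> extensional K. absolute_value_on K v \<and>
        ((\<forall>q::rat. v (of_rat q) = of_rat \<bar>q\<bar>) \<or>
         (\<exists>p::nat. Factorial_Ring.prime p \<and> (\<forall>q::rat. v (of_rat q) = padic_abs p q)))}"


subsection \<open>Completions and local degrees\<close>

definition cauchy_seqs :: "complex set \<Rightarrow> (complex \<Rightarrow> real) \<Rightarrow> (nat \<Rightarrow> complex) set" where
  "cauchy_seqs K v =
     {x. range x \<subseteq> K \<and> (\<forall>e>0. \<exists>N. \<forall>m\<ge>N. \<forall>n\<ge>N. v (x m - x n) < e)}"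

definition null_seqs :: "complex set \<Rightarrow> (complex \<Rightarrow> real) \<Rightarrow> (nat \<Rightarrow> complex) set" where
  "null_seqs K v = {x. range x \<subseteq> K \<and> (\<lambda>n. v (x n)) \<longlonglongrightarrow> 0}"

definition cauchy_ring :: "complex set \<Rightarrow> (complex \<Rightarrow> real) \<Rightarrow> (nat \<Rightarrow> complex) ring" where
  "cauchy_ring K v =
     \<lparr>carrier = cauchy_seqs K v,
      mult = (\<lambda>x y n. x n * y n), one = (\<lambda>_. 1),
      zero = (\<lambda>_. 0), add = (\<lambda>x y n. x n + y n)\<rparr>"

definition completion :: "complex set \<Rightarrow> (complex \<Rightarrow> real) \<Rightarrow> (nat \<Rightarrow> complex) set ring" where
  "completion K v = cauchy_ring K v Quot null_seqs K v"

text \<open>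
  The completion of the rationals at the place below \<open>v\<close>, embedded in \<open>completion K v\<close>
  as the set of classes of rational Cauchy sequences.
\<close>

definition rat_completion ::
    "complex set \<Rightarrow> (complex \<Rightarrow> real) \<Rightarrow> (nat \<Rightarrow> complex) set set" where
  "rat_completion K v = (\<lambda>x. null_seqs K v +>\<^bsub>cauchy_ring K v\<^esub> x) ` cauchy_seqs \<rat> v"

definition local_degree :: "complex set \<Rightarrow> (complex \<Rightarrow> real) \<Rightarrow> nat" where
  "local_degree K v =
     ring.dim (completion K v) (rat_completion K v) (carrier (completion K v))"


subsection \<open>The Weil height\<close>

definition height_over :: "complex set \<Rightarrow> complex \<Rightarrow> real" where
  "height_over K a =
     (\<Sum>\<^sub>\<infinity>v\<in>places K. real (local_degree K v) / real (ring.dim \<CC> \<rat> K) * ln (max 1 (v a)))"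

text \<open>
  The value of \<open>height_over K a\<close> is the same for every number field \<open>K\<close> containing \<open>a\<close>;
  the field generated by \<open>a\<close> is the canonical choice.
\<close>

definition weil_height :: "complex \<Rightarrow> real" where
  "weil_height a = height_over (adjoin a) a"


subsection \<open>Weights and Northcott numbers\<close>

text \<open>Only values of \<open>w\<close> at positive integers are relevant.\<close>

definition weight :: "(nat \<Rightarrow> real) \<Rightarrow> bool" where
  "weight w \<longleftrightarrow>
     (\<forall>n>0. 0 < w n) \<and> (\<exists>N. antimono_on {N..} w \<or> mono_on {N..} w)"

definition weighted_height :: "(nat \<Rightarrow> real) \<Rightarrow> complex \<Rightarrow> real" where
  "weighted_height w a = w (alg_degree a) * weil_height a"

definition Nor :: "'a set \<Rightarrow> ('a \<Rightarrow> real) \<Rightarrow> ereal" where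
  "Nor S h = Inf (ereal ` {C. 0 < C \<and> infinite {s \<in> S. h s < C}})"

end

theory Submission
  imports Defs
begin

text \<open>
  For each degree \<open>d\<close> occurring in \<open>L\<close> let \<open>m d\<close> be the least positive height of an element of degree \<open>d\<close> in \<open>L\<close> that is not a root
  of unity. By Northcott's theorem each degree contributes only finitely many elements of bounded height. So the minimum exists, and
  the Northcott number for a weight \<open>w\<close> is governed by the behaviour of \<open>w d * m d\<close> for \<open>d\<close> tending to infinity. If \<open>m\<close> comes
  arbitrarily close to \<open>0\<close>, take for \<open>1 / w\<close> the running minimum of \<open>m\<close>; if \<open>m\<close> tends to infinity, take the minimum over the tail;
  otherwise take \<open>w = 1\<close>. These weights are eventually monotone, and \<open>w d * m d\<close> is bounded below by a positive constant and bounded above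
  for infinitely many \<open>d\<close>. This is \<open>ex_weight_positive_Nor\<close>. It needs three facts about heights and degrees.

  The degrees in \<open>L\<close> are unbounded (\<open>unbounded_degrees\<close>): otherwise the primitive element theorem shows that \<open>L\<close> is generated by an
  element of maximal degree, hence finite over \<open>\<rat>\<close>.

  The heights satisfy the theorems of Northcott (\<open>northcott\<close>) and Kronecker (\<open>kronecker\<close>). Both rest on two properties of the
  places of \<open>\<rat>(a)\<close>. First, the height bounds every single \<open>v a\<close> (\<open>place_le_height\<close>). For this, only finitely many places may
  have \<open>v a > 1\<close>: they lie over finitely many places of \<open>\<rat>\<close>, each having at most \<open>deg a\<close> extensions (\<open>finite_extensions\<close>). And
  the local degrees must be positive: every completion is finite-dimensional over the closure of \<open>\<rat>\<close> (\<open>local_degree_pos\<close>). Secondly,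
  there are enough places. Each conjugate of \<open>a\<close> gives an archimedean one (\<open>conjugate_place\<close>). And if \<open>p\<close> divides the constant
  coefficient of the primitive minimal polynomial of \<open>a\<close>, then \<open>v a < 1\<close> for some place over \<open>p\<close> (\<open>ex_place_root_small\<close>), which is
  obtained as a minimal seminorm below a quotient of a Gauss norm. Applied to \<open>1 / a\<close>, this says that \<open>a\<close> is an algebraic integer if
  \<open>v a \<le> 1\<close> at all \<open>p\<close>-adic places.
\<close>

hide_const (open) Polynomials.degree Polynomials.lead_coeff up_ring.coeff up_ring.monom
  Divisibility.irreducible Divisibility.prime module.smult Coset.order Fraction_Field.Fract

section \<open>Subfields of the complex numbers and rational polynomials\<close>

lemma CC_simps [simp]:
  "carrier \<CC> = UNIV" "mult \<CC> = (*)" "one \<CC> = 1" "zero \<CC> = 0" "add \<CC> = (+)"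
  by (auto simp: ring_of_type_algebra_def)

lemma field_CC: "Ring.field \<CC>"
  by (rule field_from_type_algebra)

interpretation CC: cring \<CC>
  by (rule cring_from_type_algebra)

lemma CC_a_inv [simp]: "a_inv \<CC> x = - x"
  using CC.minus_equality[of "-x" x] by simp

lemma CC_m_inv: "x \<noteq> 0 \<Longrightarrow> m_inv \<CC> x = inverse x"
  using CC.comm_inv_char[of x "inverse x"] by simp

lemma subfield_CC_I:
  assumes "0 \<in> K" "1 \<in> K" "\<And>x y. x \<in> K \<Longrightarrow> y \<in> K \<Longrightarrow> x + y \<in> K" "\<And>x. x \<in> K \<Longrightarrow> - x \<in> K"
    "\<And>x y. x \<in> K \<Longrightarrow> y \<in> K \<Longrightarrow> x * y \<in> K" "\<And>x. x \<in> K \<Longrightarrow> inverse x \<in> K"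
  shows "subfield K \<CC>"
proof (rule field.subfieldI'[OF field_CC])
  show "subring K \<CC>" using assms by (intro CC.subringI) auto
  show "inv\<^bsub>\<CC>\<^esub> k \<in> K" if "k \<in> K - {\<zero>\<^bsub>\<CC>\<^esub>}" for k
    using that assms(6) by (simp add: CC_m_inv)
qed

lemma subfield_CC_D:
  assumes "subfield K \<CC>"
  shows "0 \<in> K" "1 \<in> K" "x \<in> K \<Longrightarrow> y \<in> K \<Longrightarrow> x + y \<in> K" "x \<in> K \<Longrightarrow> - x \<in> K"
    "x \<in> K \<Longrightarrow> y \<in> K \<Longrightarrow> x * y \<in> K" "x \<in> K \<Longrightarrow> inverse x \<in> K"
    "x \<in> K \<Longrightarrow> y \<in> K \<Longrightarrow> x - y \<in> K" "x \<in> K \<Longrightarrow> y \<in> K \<Longrightarrow> x / y \<in> K" "x \<in> K \<Longrightarrow> x ^ n \<in> K"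
    "of_rat q \<in> K" "of_int i \<in> K"
proof -
  have sr: "subring K \<CC>" using assms subfieldE(1) by blast
  show z: "0 \<in> K" and o: "1 \<in> K" using subringE(2,3)[OF sr] by auto
  show a: "x + y \<in> K" if "x \<in> K" "y \<in> K" for x y using subringE(7)[OF sr that] by simp
  show n: "- x \<in> K" if "x \<in> K" for x using subringE(5)[OF sr that] by simp
  show m: "x * y \<in> K" if "x \<in> K" "y \<in> K" for x y using subringE(6)[OF sr that] by simp
  show i: "inverse x \<in> K" if "x \<in> K" for x
    using CC.subfield_m_inv(1)[OF assms, of x] that z CC_m_inv[of x] by (cases "x = 0") auto
  show "x - y \<in> K" if "x \<in> K" "y \<in> K" using a[OF that(1) n[OF that(2)]] by simp
  show "x / y \<in> K" if "x \<in> K" "y \<in> K" using m[OF that(1) i[OF that(2)]] by (simp add: field_simps)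
  show "x ^ n \<in> K" if "x \<in> K" using that by (induction n) (auto simp: o m)
  have nat: "of_nat k \<in> K" for k by (induction k) (auto simp: z o a)
  show int: "of_int i \<in> K" for i
    by (cases i rule: int_cases2) (auto intro: nat n)
  obtain p r where "q = Fract p r" "r > 0" by (cases q) auto
  then have "of_rat q = of_int p * inverse (of_int r :: complex)"
    by (simp add: of_rat_rat field_simps)
  then show "of_rat q \<in> K" using m[OF int[of p] i[OF int[of r]]] by simp
qed

lemma subfield_Rats: "subfield \<rat> \<CC>"
  by (rule subfield_CC_I) auto

lemma subfield_adjoin: "subfield (adjoin a) \<CC>"
  unfolding adjoin_def by (rule field.generate_field_is_subfield[OF field_CC]) simp

lemma adjoin_self: "a \<in> adjoin a"
  unfolding adjoin_def by (rule generate_field.incl) simp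

lemma adjoin_min: "subfield K \<CC> \<Longrightarrow> a \<in> K \<Longrightarrow> adjoin a \<subseteq> K"
  unfolding adjoin_def by (rule field.generate_field_min_subfield1[OF field_CC]) auto

definition rpoly :: "rat poly \<Rightarrow> complex \<Rightarrow> complex" where
  "rpoly f a = poly (map_poly of_rat f) a"

lemma rpoly_0 [simp]: "rpoly 0 a = 0" and rpoly_1 [simp]: "rpoly 1 a = 1"
  by (simp_all add: rpoly_def)

lemma rpoly_pCons [simp]: "rpoly (pCons q f) a = of_rat q + a * rpoly f a"
  by (cases "f = 0 \<and> q = 0") (auto simp: rpoly_def map_poly_pCons)

lemma rpoly_add [simp]: "rpoly (f + g) a = rpoly f a + rpoly g a"
  by (induction f g rule: poly_induct2) (auto simp: of_rat_add algebra_simps)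

lemma rpoly_minus [simp]: "rpoly (- f) a = - rpoly f a"
  by (induction f) (auto simp: of_rat_minus algebra_simps)

lemma rpoly_diff [simp]: "rpoly (f - g) a = rpoly f a - rpoly g a"
  using rpoly_add[of f "-g"] by simp

lemma rpoly_smult [simp]: "rpoly (smult q f) a = of_rat q * rpoly f a"
  by (induction f) (auto simp: of_rat_mult algebra_simps)

lemma rpoly_mult [simp]: "rpoly (f * g) a = rpoly f a * rpoly g a"
  by (induction f) (auto simp: algebra_simps)

lemma rpoly_sum [simp]: "rpoly (\<Sum>i\<in>A. f i) a = (\<Sum>i\<in>A. rpoly (f i) a)"
  by (induction A rule: infinite_finite_induct) auto

lemma rpoly_monom [simp]: "rpoly (monom q n) a = of_rat q * a ^ n"
  by (induction n) (auto simp: monom_0 monom_Suc)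

lemma rpoly_altdef: "rpoly f a = (\<Sum>i\<le>degree f. of_rat (coeff f i) * a ^ i)"
  by (simp add: rpoly_def poly_altdef coeff_map_poly degree_map_poly)

lemma rpoly_in_subfield: "subfield K \<CC> \<Longrightarrow> a \<in> K \<Longrightarrow> rpoly f a \<in> K"
  by (induction f) (auto intro: subfield_CC_D)

abbreviation rat_poly :: "int poly \<Rightarrow> rat poly" where
  "rat_poly \<equiv> map_poly of_int"

lemma rat_poly_clear:
  fixes f :: "rat poly"
  assumes "f \<noteq> 0"
  obtains Q :: "int poly" and c :: rat where "c \<noteq> 0" "rat_poly Q = smult c f" "content Q = 1"
proof -
  have "\<exists>(Q::int poly) (c::rat). c \<noteq> 0 \<and> rat_poly Q = smult c f"
  proof (induction f)
    case 0
    show ?case by (rule exI[of _ 0], rule exI[of _ 1]) simp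
  next
    case (pCons q f)
    then obtain Q c where Q: "c \<noteq> 0" "rat_poly Q = smult c f" by blast
    obtain x y where xy: "c * q = Fract x y" "y > 0" by (cases "c * q") auto
    have "rat_poly (pCons x (smult y Q)) = smult (of_int y * c) (pCons q f)"
    proof (rule poly_eqI)
      fix n
      have e: "of_int (coeff Q i) = c * coeff f i" for i
        using arg_cong[OF Q(2), of "\<lambda>p. coeff p i"] by (simp add: coeff_map_poly)
      have "of_int y * (c * q) = of_int x" using xy by (simp add: Fract_of_int_quotient)
      then show "coeff (rat_poly (pCons x (smult y Q))) n
          = coeff (smult (of_int y * c) (pCons q f)) n"
        by (cases n) (simp_all add: coeff_map_poly e mult.assoc)
    qed
    with xy Q(1) show ?case by (intro exI[of _ "pCons x (smult y Q)"] exI[of _ "of_int y * c"]) auto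
  qed
  then obtain Q c where Q: "c \<noteq> 0" "rat_poly Q = smult c f" by blast
  have Q0: "Q \<noteq> 0" using Q assms by auto
  then have c0: "content Q \<noteq> 0" by simp
  have "rat_poly (primitive_part Q) = smult (c / of_int (content Q)) f"
  proof (rule poly_eqI)
    fix n
    have "of_int (coeff Q n) = c * coeff f n"
      using arg_cong[OF Q(2), of "\<lambda>p. coeff p n"] by (simp add: coeff_map_poly)
    moreover have "coeff Q n = content Q * coeff (primitive_part Q) n"
      by (metis coeff_smult content_times_primitive_part)
    ultimately show "coeff (rat_poly (primitive_part Q)) n = coeff (smult (c / of_int (content Q)) f) n"
      using c0 by (simp add: coeff_map_poly field_simps)
  qed
  moreover have "content (primitive_part Q) = 1" using Q0 by simp
  ultimately show ?thesis using that[of "c / of_int (content Q)"] Q(1) c0 by auto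
qed

lemma degree_eq_card_roots:
  fixes R :: "complex poly"
  assumes "rsquarefree R"
  shows "degree R = card {z. poly R z = 0}"
proof -
  have R0: "R \<noteq> 0" using assms by (simp add: rsquarefree_def)
  have "degree R = degree (\<Prod>z | poly R z = 0. [:- z, 1:])"
    using complex_poly_decompose_rsquarefree[OF assms] R0
    by (metis degree_smult_eq leading_coeff_0_iff)
  also have "\<dots> = (\<Sum>z | poly R z = 0. degree [:- z, 1:])"
    by (rule degree_prod_eq_sum_degree) auto
  finally show ?thesis by simp
qed


section \<open>Minimal polynomials\<close>

text \<open>The minimal polynomial is normalised to be a primitive integer polynomial, since the primes dividing its extreme
  coefficients decide at which places \<open>a\<close> is large or small.\<close>
locale minimal_poly =
  fixes a :: complex and Q :: "int poly"
  assumes content_1: "content Q = 1"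
    and root: "rpoly (rat_poly Q) a = 0"
    and dvd: "rpoly f a = 0 \<Longrightarrow> rat_poly Q dvd f"

lemma minimal_poly_exists:
  assumes "algebraic a"
  obtains Q where "minimal_poly a Q"
proof -
  have ex: "\<exists>f. f \<noteq> 0 \<and> rpoly f a = 0"
  proof -
    obtain p :: "complex poly" where p: "\<And>i. coeff p i \<in> \<rat>" "p \<noteq> 0" "poly p a = 0"
      using assms unfolding algebraic_altdef by blast
    then obtain q where "p = map_poly of_rat q" by (elim ratpolyE)
    then show ?thesis using p by (auto simp: rpoly_def intro!: exI[of _ q])
  qed
  define n where "n = (LEAST n. \<exists>f. f \<noteq> 0 \<and> rpoly f a = 0 \<and> degree f = n)"
  have "\<exists>f. f \<noteq> 0 \<and> rpoly f a = 0 \<and> degree f = n"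
    unfolding n_def by (rule LeastI_ex) (use ex in auto)
  then obtain f where f: "f \<noteq> 0" "rpoly f a = 0" "degree f = n" by blast
  have min: "g = 0" if "rpoly g a = 0" "degree g < n" for g
  proof (rule ccontr)
    assume "g \<noteq> 0"
    then have "n \<le> degree g" unfolding n_def by (intro Least_le) (use that in auto)
    with that show False by simp
  qed
  obtain Q c where Q: "c \<noteq> 0" "rat_poly Q = smult c f" "content Q = 1"
    using rat_poly_clear[OF f(1)] .
  show ?thesis
  proof (rule that, unfold_locales)
    show "rpoly (rat_poly Q) a = 0" by (simp add: Q f)
    fix g assume g: "rpoly g a = 0"
    have "g mod f = g - (g div f) * f" by (simp add: minus_div_mult_eq_mod)
    then have "rpoly (g mod f) a = 0" using g f(2) by simp
    moreover have "g mod f = 0 \<or> degree (g mod f) < n" using degree_mod_less[OF f(1)] f(3) by auto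
    ultimately have "g mod f = 0" using min by blast
    then show "rat_poly Q dvd g" using Q(1,2) by (simp add: smult_dvd_iff mod_eq_0_iff_dvd)
  qed fact
qed

context minimal_poly
begin

abbreviation "P \<equiv> rat_poly Q"
abbreviation "n \<equiv> degree Q"

lemma Q_nz: "Q \<noteq> 0"
proof
  assume "Q = 0"
  then have "content Q = 0" by simp
  with content_1 show False by simp
qed
lemma P_nz: "P \<noteq> 0" using Q_nz by (simp add: map_poly_eq_0_iff)
lemma degree_P [simp]: "degree P = n" by (simp add: degree_map_poly)
lemma coeff_P: "coeff P i = of_int (coeff Q i)" by (simp add: coeff_map_poly)

lemma root_iff: "rpoly f a = 0 \<longleftrightarrow> P dvd f"
  using dvd root by (auto elim!: dvdE)

lemma degree_pos: "n > 0"
proof (rule ccontr)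
  assume "\<not> n > 0"
  then obtain c where "P = [:c:]" using degree_P by (metis degree_eq_zeroE gr0I)
  with root P_nz show False by auto
qed

lemma conjugate_root: "rpoly f a = 0 \<Longrightarrow> rpoly P z = 0 \<Longrightarrow> rpoly f z = 0"
  by (auto simp: root_iff elim!: dvdE)

lemma inverse_rpoly:
  assumes "rpoly f a \<noteq> 0"
  obtains g where "rpoly g a * rpoly f a = 1"
proof -
  define d where "d = gcd P f"
  obtain u v where uv: "u * P + v * f = d"
    using bezout_coefficients_fst_snd[of P f] d_def by blast
  have "d dvd P" "d dvd f" by (auto simp: d_def)
  then obtain e where e: "P = d * e" by (elim dvdE)
  have d0: "rpoly d a \<noteq> 0"
  proof
    assume "rpoly d a = 0"
    then have "P dvd f" using \<open>d dvd f\<close> root_iff dvd_trans by blast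
    then show False using assms root_iff by blast
  qed
  have "rpoly e a = 0" using root d0 unfolding e by simp
  then have "P dvd e" by (simp add: root_iff)
  then have "degree P \<le> degree e" using P_nz e by (intro dvd_imp_degree_le) auto
  moreover have "degree P = degree d + degree e" using e P_nz by (metis degree_mult_eq mult_eq_0_iff)
  ultimately obtain c where c: "d = [:c:]" by (metis add_le_same_cancel2 degree_eq_zeroE le_zero_eq)
  have "rpoly v a * rpoly f a = rpoly d a" using uv root by (metis add_0 mult_zero_right rpoly_add rpoly_mult)
  then have "rpoly v a * rpoly f a = of_rat c" and "c \<noteq> 0" using c d0 by auto
  then have "rpoly (smult (inverse c) v) a * rpoly f a = 1"
    by (simp add: of_rat_inverse mult.assoc)
  then show ?thesis using that by blast
qed

lemma adjoin_eq: "adjoin a = range (\<lambda>f. rpoly f a)"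
proof
  have "subfield (range (\<lambda>f. rpoly f a)) \<CC>"
  proof (rule subfield_CC_I)
    show "0 \<in> range (\<lambda>f. rpoly f a)" "1 \<in> range (\<lambda>f. rpoly f a)"
      by (metis rangeI rpoly_0) (metis rangeI rpoly_1)
    fix x y assume "x \<in> range (\<lambda>f. rpoly f a)" "y \<in> range (\<lambda>f. rpoly f a)"
    then obtain f g where fg: "x = rpoly f a" "y = rpoly g a" by blast
    show "x + y \<in> range (\<lambda>f. rpoly f a)" by (metis fg rangeI rpoly_add)
    show "x * y \<in> range (\<lambda>f. rpoly f a)" by (metis fg rangeI rpoly_mult)
    show "- x \<in> range (\<lambda>f. rpoly f a)" by (metis fg rangeI rpoly_minus)
    show "inverse x \<in> range (\<lambda>f. rpoly f a)"
    proof (cases "x = 0")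
      case True
      then show ?thesis by (metis inverse_zero rangeI rpoly_0)
    next
      case False
      with fg inverse_rpoly obtain h where "rpoly h a * x = 1" by metis
      then have "inverse x = rpoly h a" by (metis inverse_unique mult.commute)
      then show ?thesis by blast
    qed
  qed
  moreover have "a \<in> range (\<lambda>f. rpoly f a)"
    by (rule image_eqI[of _ _ "[:0,1:]"]) auto
  ultimately show "adjoin a \<subseteq> range (\<lambda>f. rpoly f a)" by (rule adjoin_min)
  show "range (\<lambda>f. rpoly f a) \<subseteq> adjoin a"
    using rpoly_in_subfield[OF subfield_adjoin adjoin_self] by blast
qed

lemma rpoly_mod: "rpoly (f mod P) a = rpoly f a"
proof -
  have "f mod P = f - (f div P) * P" by (simp add: minus_div_mult_eq_mod)
  then show ?thesis using root by simp
qed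

lemma low_degree_zero: "rpoly f a = 0 \<Longrightarrow> degree f < n \<Longrightarrow> f = 0"
  using dvd dvd_imp_degree_le[of P f] by fastforce

lemma adjoin_elem:
  assumes "x \<in> adjoin a"
  obtains f where "degree f < n" "x = rpoly f a"
proof -
  obtain f where f: "x = rpoly f a" using assms adjoin_eq by blast
  have "degree (f mod P) < n" using degree_mod_less[of P f] P_nz degree_pos by auto
  then show ?thesis using that f rpoly_mod by metis
qed

text \<open>Separability: the derivative has too small a degree to vanish at \<open>a\<close>, hence it is a unit modulo \<open>P\<close>.\<close>
lemma rpoly_pderiv_nz: 
  assumes "rpoly P z = 0" shows "rpoly (pderiv P) z \<noteq> 0"
proof -
  have "degree (pderiv P) < n" "pderiv P \<noteq> 0"
    using degree_pos by (auto simp: degree_pderiv pderiv_eq_0_iff)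
  then have "rpoly (pderiv P) a \<noteq> 0" using low_degree_zero by blast
  then obtain g where "rpoly g a * rpoly (pderiv P) a = 1" by (rule inverse_rpoly)
  then have "rpoly (g * pderiv P - 1) a = 0" by simp
  then have "rpoly (g * pderiv P - 1) z = 0" using assms by (rule conjugate_root)
  then show ?thesis by auto
qed

lemma rpoly_pderiv: "rpoly (pderiv f) z = poly (pderiv (map_poly of_rat f)) z"
proof (induction f)
  case (pCons q f)
  have "map_poly of_rat (pCons q f) = pCons (of_rat q) (map_poly of_rat f :: complex poly)"
    using pCons(1) by (auto simp: map_poly_pCons)
  then show ?case using pCons(2) by (simp add: pderiv_pCons) (simp add: rpoly_def)
qed simp

lemma rsquarefree_P: "rsquarefree (map_poly of_rat P :: complex poly)"
  using rpoly_pderiv_nz unfolding rsquarefree_roots rpoly_pderiv by (auto simp: rpoly_def)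

lemma card_roots: "card {z. rpoly P z = 0} = n"
  using degree_eq_card_roots[OF rsquarefree_P] by (simp add: rpoly_def degree_map_poly)

end

lemma combine_CC: "length Ks = length Us \<Longrightarrow> CC.combine Ks Us = (\<Sum>i<length Us. Ks ! i * Us ! i)"
proof (induction Ks Us rule: list_induct2)
  case (Cons k Ks u Us)
  have "(\<Sum>i<length (u # Us). (k # Ks) ! i * (u # Us) ! i) = k * u + (\<Sum>i<length Us. Ks ! i * Us ! i)"
    by (simp del: sum.lessThan_Suc add: sum.lessThan_Suc_shift)
  then show ?case using Cons by simp
qed simp

lemma Rats_list:
  fixes Ks :: "complex list"
  assumes "set Ks \<subseteq> \<rat>"
  shows "\<exists>c. Ks = map (of_rat \<circ> c) [0..<length Ks]"
proof -
  have "\<forall>i<length Ks. \<exists>c. Ks ! i = of_rat c" using assms by (meson Rats_cases nth_mem subsetD)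
  then obtain c where "\<forall>i<length Ks. Ks ! i = of_rat (c i)" by metis
  then show ?thesis by (intro exI[of _ c] nth_equalityI) auto
qed

lemma independent_RatsI:
  assumes "\<And>c i. (\<Sum>i<length Us. of_rat (c i) * Us ! i) = 0 \<Longrightarrow> i < length Us \<Longrightarrow> c i = 0"
  shows "CC.independent \<rat> Us"
proof -
  have Us: "set Us \<subseteq> carrier \<CC>" by simp
  show ?thesis
  proof (rule CC.trivial_combine_imp_independent[OF subfield_Rats Us])
    fix Ks :: "complex list"
    assume Ks: "set Ks \<subseteq> \<rat>" "CC.combine Ks Us = \<zero>\<^bsub>\<CC>\<^esub>"
    define n where "n = length Us"
    define Ks' where "Ks' = take n Ks @ replicate (n - length Ks) 0"
    have l: "length Ks' = length Us" by (simp add: Ks'_def n_def)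
    have "set Ks' \<subseteq> \<rat>" using Ks(1) by (auto simp: Ks'_def dest: in_set_takeD)
    then obtain c where c: "Ks' = map (of_rat \<circ> c) [0..<n]" using Rats_list[of Ks'] l n_def by auto
    have "CC.combine Ks' Us = CC.combine Ks Us"
      unfolding Ks'_def using CC.combine_append_replicate[OF Us, of "take n Ks"] CC.combine_take[of Us Ks]
      by (simp add: n_def)
    then have "CC.combine Ks' Us = 0" using Ks(2) by simp
    then have "(\<Sum>i<length Us. of_rat (c i) * Us ! i) = 0" using combine_CC[OF l] by (simp add: c n_def)
    then have c0: "c i = 0" if "i < n" for i using assms that n_def by blast
    have "set Ks' \<subseteq> {0}" unfolding c using c0 by auto
    then show "set (take (length Us) Ks) \<subseteq> {\<zero>\<^bsub>\<CC>\<^esub>}" by (auto simp: Ks'_def n_def)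
  qed
qed

context minimal_poly begin

lemma dimension_adjoin: "CC.dimension n \<rat> (adjoin a)"
proof -
  define Us where "Us = map (\<lambda>i. a ^ i) [0..<n]"
  have comb: "CC.combine Ks Us = (\<Sum>i<n. Ks ! i * a ^ i)" if "length Ks = n" for Ks
    using that by (subst combine_CC) (auto simp: Us_def)
  have sum_poly: "(\<Sum>i<n. of_rat (c i) * a ^ i) = rpoly (\<Sum>i<n. monom (c i) i) a" for c
    by simp
  have poly_sum: "rpoly f a = (\<Sum>i<n. of_rat (coeff f i) * a ^ i)" if "degree f < n" for f
    unfolding rpoly_altdef by (rule sum.mono_neutral_left) (use that in \<open>auto simp: coeff_eq_0\<close>)
  have Us: "set Us \<subseteq> carrier \<CC>" by simp
  have sp: "CC.Span \<rat> Us = adjoin a"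
  proof (intro equalityI subsetI)
    fix x assume "x \<in> CC.Span \<rat> Us"
    then obtain Ks where "length Ks = n" "set Ks \<subseteq> \<rat>" "x = CC.combine Ks Us"
      unfolding CC.Span_eq_combine_set_length_version[OF subfield_Rats Us] by (auto simp: Us_def)
    moreover from this Rats_list[of Ks] obtain c where "Ks = map (of_rat \<circ> c) [0..<n]" by auto
    ultimately have "x = (\<Sum>i<n. of_rat (c i) * a ^ i)" using comb[of Ks] by simp
    then show "x \<in> adjoin a" unfolding adjoin_eq sum_poly by (rule range_eqI)
  next
    fix x assume "x \<in> adjoin a"
    then obtain f where f: "degree f < n" "x = rpoly f a" by (rule adjoin_elem)
    have "x = CC.combine (map (\<lambda>i. of_rat (coeff f i)) [0..<n]) Us"
      by (subst comb) (auto simp: f poly_sum)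
    then show "x \<in> CC.Span \<rat> Us"
      unfolding CC.Span_eq_combine_set_length_version[OF subfield_Rats Us]
      by (auto simp: Us_def intro!: exI[of _ "map (\<lambda>i. of_rat (coeff f i)) [0..<n]"])
  qed
  have "CC.independent \<rat> Us"
  proof (rule independent_RatsI)
    fix c i assume "(\<Sum>i<length Us. of_rat (c i) * Us ! i) = 0" and i: "i < length Us"
    then have "(\<Sum>i<n. of_rat (c i) * a ^ i) = 0" by (simp add: Us_def)
    then have "rpoly (\<Sum>i<n. monom (c i) i) a = 0" unfolding sum_poly .
    moreover have "degree (\<Sum>i<n. monom (c i) i) < n"
      by (rule degree_sum_less) (use degree_pos in \<open>auto intro: le_less_trans[OF degree_monom_le]\<close>)
    ultimately have "(\<Sum>i<n. monom (c i) i) = 0" by (rule low_degree_zero)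
    then have "coeff (\<Sum>i<n. monom (c i) i) i = 0" by simp
    then have "(if i < n then c i else 0) = 0" by (simp add: coeff_sum)
    then show "c i = 0" using i by (simp add: Us_def)
  qed
  from CC.dimension_independent[OF this] show ?thesis unfolding sp by (simp add: Us_def)
qed

lemma alg_degree_eq: "alg_degree a = n"
  unfolding alg_degree_def using CC.dimI[OF subfield_Rats dimension_adjoin] by (simp add: over_def)

end

section \<open>Primitive elements\<close>

lemma dvd_rsquarefree:
  fixes p :: "complex poly"
  assumes "p dvd g" "rsquarefree g"
  shows "rsquarefree p"
  using assms by (auto simp: rsquarefree_roots pderiv_mult elim!: dvdE)

definition polys_over :: "complex set \<Rightarrow> complex poly set" where
  "polys_over F = {p. \<forall>i. coeff p i \<in> F}"

lemma polys_over_pcompose_linear: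
  assumes F: "subfield F \<CC>" and "f \<in> polys_over F" "u \<in> F" "v \<in> F"
  shows "f \<circ>\<^sub>p [:u, v:] \<in> polys_over F"
  using assms(2)
proof (induction f)
  case 0
  then show ?case by simp
next
  case (pCons c f)
  have "coeff (pCons c f) 0 \<in> F" "\<And>i. coeff (pCons c f) (Suc i) \<in> F"
    using pCons(3) unfolding polys_over_def by blast+
  then have c: "c \<in> F" "f \<in> polys_over F" by (auto simp: polys_over_def)
  have IH: "f \<circ>\<^sub>p [:u, v:] \<in> polys_over F" using pCons(2) c by blast
  have "coeff (f \<circ>\<^sub>p [:u, v:]) 0 \<in> F" using IH by (simp only: polys_over_def mem_Collect_eq)
  then have "poly f u \<in> F" by simp
  then have "coeff (pCons c f \<circ>\<^sub>p [:u, v:]) i \<in> F" for i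
    using IH c(1) assms(3,4) subfield_CC_D[OF F] unfolding polys_over_def
    by (cases i) (simp_all add: pcompose_pCons)
  then show ?case by (simp add: polys_over_def)
qed

text \<open>Division with remainder stays inside \<open>F\<close>, so a polynomial of least degree generates the ideal.\<close>
lemma minimal_degree_dvd:
  assumes F: "subfield F \<CC>" and p: "p \<in> polys_over F" "poly p b = 0" "p \<noteq> 0"
    and min: "\<And>q. q \<in> polys_over F \<Longrightarrow> poly q b = 0 \<Longrightarrow> q \<noteq> 0 \<Longrightarrow> degree p \<le> degree q"
    and r: "r \<in> polys_over F" "poly r b = 0"
  shows "p dvd r"
  using r
proof (induction "degree r" arbitrary: r rule: less_induct)
  case less
  show ?case
  proof (cases "r = 0")
    case False
    then have deg: "degree p \<le> degree r" using min less.prems by blast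
    define m where "m = monom (lead_coeff r / lead_coeff p) (degree r - degree p)"
    define r' where "r' = r - m * p"
    have nz: "lead_coeff r / lead_coeff p \<noteq> 0" using False p(3) by simp
    have dm: "degree (m * p) = degree r"
      using nz p(3) deg by (simp add: m_def degree_mult_eq degree_monom_eq)
    have "lead_coeff (m * p) = lead_coeff r"
      using p(3) unfolding lead_coeff_mult m_def lead_coeff_monom by simp
    then have "coeff r' (degree r) = 0" using dm by (simp add: r'_def)
    moreover have "degree r' \<le> degree r" unfolding r'_def using dm by (intro degree_diff_le) auto
    ultimately have "r' = 0 \<or> degree r' < degree r"
      by (metis leading_coeff_0_iff le_neq_implies_less)
    moreover have "r' \<in> polys_over F"
      using less.prems(1) p(1) subfield_CC_D[OF F]
      by (auto simp: polys_over_def r'_def m_def coeff_monom_mult)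
    moreover have "poly r' b = 0" using less.prems(2) p(2) by (simp add: r'_def)
    ultimately have "p dvd r'" using less.hyps[of r'] by auto
    moreover have "r = r' + m * p" by (simp add: r'_def)
    ultimately show ?thesis by (metis dvd_add dvd_triv_right)
  qed auto
qed

text \<open>With \<open>c = a + t b\<close>, the polynomials \<open>g(x)\<close> and \<open>f(c - t x)\<close> have coefficients in \<open>\<rat>(c)\<close> and, for all but
  finitely many \<open>t\<close>, only the root \<open>b\<close> in common. As \<open>g\<close> is separable, the polynomial of least degree over \<open>\<rat>(c)\<close>
  with root \<open>b\<close>, which divides both, is linear, so \<open>b \<in> \<rat>(c)\<close>.\<close>
lemma primitive_element:
  assumes "algebraic a" "algebraic b"
  obtains t :: nat where "a \<in> adjoin (a + of_nat t * b)" "b \<in> adjoin (a + of_nat t * b)"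
proof -
  obtain A B where "minimal_poly a A" and "minimal_poly b B"
    using minimal_poly_exists assms by metis
  then interpret A: minimal_poly a A + B: minimal_poly b B by auto
  define f where "f = (map_poly of_rat A.P :: complex poly)"
  define g where "g = (map_poly of_rat B.P :: complex poly)"
  have f0: "f \<noteq> 0" "g \<noteq> 0" using A.P_nz B.P_nz by (auto simp: f_def g_def map_poly_eq_0_iff)
  \<comment> \<open>The quotients at which \<open>c - t v = u\<close> for a root \<open>u\<close> of \<open>f\<close> and a root \<open>v\<close> of \<open>g\<close> other than \<open>b\<close>; for \<open>v = b\<close> division by zero
    only adds the harmless value \<open>0\<close>.\<close>
  define bad where "bad = (\<lambda>(u,v). (u - a) / (b - v)) ` ({z. poly f z = 0} \<times> {z. poly g z = 0})"
  have "finite bad" unfolding bad_def using f0 by (auto intro: poly_roots_finite)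
  then have "\<not> range of_nat \<subseteq> bad"
    using finite_subset range_inj_infinite[OF inj_of_nat[where 'a = complex]] by blast
  then obtain t :: nat where t: "of_nat t \<notin> bad" by blast
  define c where "c = a + of_nat t * b"
  define F where "F = adjoin c"
  have F: "subfield F \<CC>" unfolding F_def by (rule subfield_adjoin)
  have cF: "c \<in> F" unfolding F_def by (rule adjoin_self)
  have tF: "of_nat t \<in> F" using subfield_CC_D(11)[OF F, of "int t"] by simp
  define h where "h = f \<circ>\<^sub>p [:c, - of_nat t:]"
  have fF: "f \<in> polys_over F" "g \<in> polys_over F"
    unfolding f_def g_def polys_over_def using subfield_CC_D(11)[OF F] by (auto simp: coeff_map_poly)
  have hF: "h \<in> polys_over F" unfolding h_def
    by (rule polys_over_pcompose_linear[OF F fF(1) cF]) (use tF subfield_CC_D(4)[OF F] in auto)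
  have gb: "poly g b = 0" using B.root by (simp add: g_def rpoly_def)
  have hb: "poly h b = 0" using A.root by (simp add: h_def f_def c_def poly_pcompose rpoly_def algebra_simps)
  have "\<exists>p. p \<in> polys_over F \<and> poly p b = 0 \<and> p \<noteq> 0 \<and>
          (\<forall>q. q \<in> polys_over F \<longrightarrow> poly q b = 0 \<longrightarrow> q \<noteq> 0 \<longrightarrow> degree p \<le> degree q)"
    using ex_has_least_nat[of "\<lambda>p. p \<in> polys_over F \<and> poly p b = 0 \<and> p \<noteq> 0" g degree] fF gb f0 by blast
  then obtain p where p: "p \<in> polys_over F" "poly p b = 0" "p \<noteq> 0"
    "\<And>q. q \<in> polys_over F \<Longrightarrow> poly q b = 0 \<Longrightarrow> q \<noteq> 0 \<Longrightarrow> degree p \<le> degree q" by blast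
  have pg: "p dvd g" and ph: "p dvd h"
    using minimal_degree_dvd[OF F p fF(2) gb] minimal_degree_dvd[OF F p hF hb] by auto
  have "rsquarefree p" using dvd_rsquarefree[OF pg] B.rsquarefree_P by (simp add: g_def)
  then have "degree p = card {z. poly p z = 0}" by (rule degree_eq_card_roots)
  moreover have "{z. poly p z = 0} = {b}"
  proof -
    have "z = b" if "poly p z = 0" for z
    proof (rule ccontr)
      assume "z \<noteq> b"
      have gz: "poly g z = 0" using pg that by auto
      have "poly h z = 0" using ph that by auto
      then have fz: "poly f (c - of_nat t * z) = 0" by (simp add: h_def poly_pcompose algebra_simps)
      have "of_nat t = (c - of_nat t * z - a) / (b - z)" using \<open>z \<noteq> b\<close> by (simp add: c_def field_simps)
      then have "of_nat t \<in> bad" unfolding bad_def using gz fz by force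
      then show False using t by simp
    qed
    then show ?thesis using p(2) by blast
  qed
  ultimately have "degree p = 1" by simp
  then have "p = [:coeff p 0, coeff p 1:]"
    by (intro poly_eqI) (auto simp: coeff_pCons coeff_eq_0 split: nat.split)
  then obtain u v where uv: "p = [:u, v:]" by blast
  with \<open>degree p = 1\<close> have "v \<noteq> 0" by auto
  have "coeff p 0 \<in> F" "coeff p 1 \<in> F" using p(1) by (auto simp: polys_over_def)
  then have "u \<in> F" "v \<in> F" using uv by auto
  moreover have "b = - u / v" using p(2) uv \<open>v \<noteq> 0\<close> by (simp add: field_simps add_eq_0_iff)
  ultimately have bF: "b \<in> F" using subfield_CC_D(4,8)[OF F] by auto
  have "a = c - of_nat t * b" by (simp add: c_def)
  then have "a \<in> F" using subfield_CC_D(7)[OF F cF subfield_CC_D(5)[OF F tF bF]] by simp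
  then show ?thesis using that bF unfolding F_def c_def by blast
qed

lemma adjoin_eqI:
  assumes "algebraic a" "algebraic c" "a \<in> adjoin c" "alg_degree c \<le> alg_degree a"
  shows "adjoin a = adjoin c"
proof -
  obtain A C where A: "minimal_poly a A" and C: "minimal_poly c C"
    using minimal_poly_exists assms by metis
  have sub: "adjoin a \<subseteq> adjoin c" by (rule adjoin_min[OF subfield_adjoin assms(3)])
  have dims: "CC.dimension (alg_degree a) \<rat> (adjoin a)" "CC.dimension (alg_degree c) \<rat> (adjoin c)"
    using minimal_poly.dimension_adjoin minimal_poly.alg_degree_eq A C by metis+
  obtain Us where Us: "set Us \<subseteq> carrier \<CC>" "CC.independent \<rat> Us" "length Us = alg_degree a"
      "CC.Span \<rat> Us = adjoin a"
    using CC.exists_base[OF subfield_Rats dims(1)] by blast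
  have "set Us \<subseteq> adjoin c" using CC.Span_base_incl[OF subfield_Rats Us(1)] Us(4) sub by auto
  then have "length Us \<le> alg_degree c" and "length Us = alg_degree c \<longleftrightarrow> CC.Span \<rat> Us = adjoin c"
    using CC.independent_length_le_dimension[OF subfield_Rats dims(2) Us(2)]
      CC.independent_length_eq_dimension[OF subfield_Rats dims(2) Us(2)] by auto
  then show ?thesis using Us assms(4) by simp
qed

text \<open>If \<open>a\<close> had the largest degree in \<open>L\<close>, a primitive element of \<open>\<rat>(a, b)\<close> would generate the same field as \<open>a\<close>,
  for every \<open>b\<close> in \<open>L\<close>; hence \<open>L = \<rat>(a)\<close>.\<close>
lemma unbounded_degrees:
  assumes L: "subfield L \<CC>" "L \<subseteq> Qbar" and inf: "\<not> CC.finite_dimension \<rat> L"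
  shows "\<exists>a\<in>L. N < alg_degree a"
proof (rule ccontr)
  assume "\<not> ?thesis"
  then have bd: "\<forall>a. a \<in> L \<longrightarrow> alg_degree a < Suc N" by (simp add: not_less less_Suc_eq_le)
  have alg: "algebraic x" if "x \<in> L" for x using L(2) that by (auto simp: Qbar_def)
  have "\<exists>a. a \<in> L \<and> (\<forall>b. b \<in> L \<longrightarrow> alg_degree b \<le> alg_degree a)"
    using ex_has_greatest_nat[of "\<lambda>a. a \<in> L" 0 alg_degree "Suc N"] bd subfield_CC_D(1)[OF L(1)] less_imp_le by blast
  then obtain a where a: "a \<in> L" "\<And>b. b \<in> L \<Longrightarrow> alg_degree b \<le> alg_degree a" by blast
  have "L \<subseteq> adjoin a"
  proof
    fix b assume b: "b \<in> L"
    obtain t :: nat where t: "a \<in> adjoin (a + of_nat t * b)" "b \<in> adjoin (a + of_nat t * b)"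
      using primitive_element[OF alg[OF a(1)] alg[OF b]] .
    have "of_nat t \<in> L" using subfield_CC_D(11)[OF L(1), of "int t"] by simp
    then have c: "a + of_nat t * b \<in> L" using subfield_CC_D(3,5)[OF L(1)] a b by blast
    show "b \<in> adjoin a" using adjoin_eqI[OF alg[OF a(1)] alg[OF c] t(1) a(2)[OF c]] t(2) by simp
  qed
  moreover have "adjoin a \<subseteq> L" using adjoin_min[OF L(1) a(1)] .
  ultimately have "L = adjoin a" by blast
  moreover obtain A where "minimal_poly a A" using minimal_poly_exists alg a(1) by blast
  then have "CC.finite_dimension \<rat> (adjoin a)"
    using CC.finite_dimensionI minimal_poly.dimension_adjoin by blast
  ultimately show False using inf by simp
qed

section \<open>The p-adic absolute value\<close>

locale padic = fixes p :: nat assumes prime_p: "prime p"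
begin

abbreviation "\<pi> \<equiv> padic_abs p"

lemma p_gt_1: "p > 1" using prime_p prime_gt_1_nat by blast
lemma prime_int: "prime (int p)" using prime_p by simp

lemma mult_mult: "x \<noteq> 0 \<Longrightarrow> y \<noteq> 0 \<Longrightarrow>
  multiplicity (int p) (x * y) = multiplicity (int p) x + multiplicity (int p) y"
  using prime_int by (simp add: prime_elem_multiplicity_mult_distrib)

lemma padic_quot:
  assumes "x \<noteq> 0" "y \<noteq> 0"
  shows "\<pi> (of_int x / of_int y) = real p powi (int (multiplicity (int p) y) - int (multiplicity (int p) x))"
proof -
  define q where "q = (of_int x / of_int y :: rat)"
  obtain r s where rs: "quotient_of q = (r, s)" by (cases "quotient_of q")
  have s0: "s > 0" using quotient_of_denom_pos[OF rs] .
  have q: "q = of_int r / of_int s" using quotient_of_div[OF rs] .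
  have q0: "q \<noteq> 0" using assms by (simp add: q_def)
  then have r0: "r \<noteq> 0" using q by auto
  have "(of_int (x * s) :: rat) = of_int (r * y)"
    using q s0 assms by (simp add: q_def field_simps)
  then have "x * s = r * y" by (simp only: of_int_eq_iff)
  then have "multiplicity (int p) x + multiplicity (int p) s = multiplicity (int p) r + multiplicity (int p) y"
    using mult_mult assms s0 r0 by (metis less_irrefl)
  then have "int (multiplicity (int p) s) - int (multiplicity (int p) r)
      = int (multiplicity (int p) y) - int (multiplicity (int p) x)" by linarith
  then show ?thesis using q0 rs unfolding q_def[symmetric] padic_abs_def by simp
qed

lemma padic_0 [simp]: "\<pi> 0 = 0" by (simp add: padic_abs_def)

lemma rat_cases_nz:
  assumes "q \<noteq> (0::rat)" obtains x y where "x \<noteq> 0" "y > 0" "q = of_int x / of_int y"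
proof -
  obtain r s where rs: "quotient_of q = (r, s)" by (cases "quotient_of q")
  show ?thesis using that[of r s] quotient_of_denom_pos[OF rs] quotient_of_div[OF rs] assms by auto
qed

lemma padic_int: "x \<noteq> 0 \<Longrightarrow> \<pi> (of_int x) = 1 / real p ^ multiplicity (int p) x"
  using padic_quot[of x 1] by (simp add: power_int_minus field_simps)

lemma padic_1 [simp]: "\<pi> 1 = 1" using padic_int[of 1] by simp

lemma padic_nz: "q \<noteq> 0 \<Longrightarrow> \<exists>k::int. \<pi> q = real p powi k"
  by (auto simp: padic_abs_def)

lemma padic_pos: "q \<noteq> 0 \<Longrightarrow> \<pi> q > 0"
  using padic_nz[of q] p_gt_1 by auto

lemma padic_eq_0_iff [simp]: "\<pi> q = 0 \<longleftrightarrow> q = 0"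
  by (metis padic_pos padic_0 less_irrefl)

lemma padic_nonneg [simp]: "\<pi> q \<ge> 0"
  using padic_pos[of q] by (cases "q = 0") auto

lemma padic_mult: "\<pi> (q * r) = \<pi> q * \<pi> r"
proof (cases "q = 0 \<or> r = 0")
  case False
  then obtain x y u v where "x \<noteq> 0" "y > 0" "q = of_int x / of_int y" "u \<noteq> 0" "v > 0" "r = of_int u / of_int v"
    using rat_cases_nz by metis
  then show ?thesis
    using padic_quot[of x y] padic_quot[of u v] padic_quot[of "x * u" "y * v"] p_gt_1
    by (simp add: mult_mult power_int_add[symmetric] algebra_simps)
qed auto

lemma padic_inverse: "\<pi> (inverse q) = inverse (\<pi> q)"
proof (cases "q = 0")
  case False
  then have "\<pi> (inverse q) * \<pi> q = 1" by (simp flip: padic_mult)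
  then show ?thesis by (metis inverse_unique mult.commute)
qed auto

lemma padic_minus [simp]: "\<pi> (- q) = \<pi> q"
proof -
  have "\<pi> (-1) = 1" using padic_int[of "-1"] by simp
  then show ?thesis using padic_mult[of "-1" q] by simp
qed

lemma padic_int_le_1: "\<pi> (of_int x) \<le> 1"
  using padic_int[of x] p_gt_1 by (cases "x = 0") (auto simp: divide_le_eq)

lemma padic_le_power_dvd:
  assumes "(int p) ^ k dvd x" shows "\<pi> (of_int x) \<le> 1 / real p ^ k"
proof (cases "x = 0")
  case False
  then have "k \<le> multiplicity (int p) x"
    using assms p_gt_1 by (subst (asm) power_dvd_iff_le_multiplicity) auto
  then show ?thesis using p_gt_1 False by (simp add: padic_int frac_le power_increasing)
qed auto

lemma padic_int_1_iff: "\<pi> (of_int x) = 1 \<longleftrightarrow> \<not> int p dvd x"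
proof (cases "x = 0")
  case False
  then show ?thesis
  proof (cases "int p dvd x")
    case True
    then have "\<pi> (of_int x) \<le> 1 / real p" using padic_le_power_dvd[of 1 x] by simp
    moreover have "1 / real p < 1" using p_gt_1 by simp
    ultimately show ?thesis using True by simp
  next
    case False
    then show ?thesis using \<open>x \<noteq> 0\<close> by (simp add: padic_int not_dvd_imp_multiplicity_0)
  qed
qed auto

lemma padic_p: "\<pi> (of_nat p) = 1 / real p"
  using padic_int[of "int p"] p_gt_1 by (simp add: multiplicity_self)

lemma padic_add: "\<pi> (q + r) \<le> max (\<pi> q) (\<pi> r)"
proof -
  have int: "\<pi> (of_int (x + y)) \<le> \<pi> (of_int x)"
    if "multiplicity (int p) x \<le> multiplicity (int p) y" "x \<noteq> 0" "y \<noteq> 0" for x y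
  proof -
    have "int p ^ multiplicity (int p) x dvd x + y"
      using that by (intro dvd_add multiplicity_dvd') auto
    then show ?thesis using padic_le_power_dvd that(2) by (simp add: padic_int flip: of_int_add)
  qed
  show ?thesis
  proof (cases "q = 0 \<or> r = 0")
    case False
    then obtain x y u v where *: "x \<noteq> 0" "y > 0" "q = of_int x / of_int y" "u \<noteq> 0" "v > 0" "r = of_int u / of_int v"
      using rat_cases_nz by metis
    define c where "c = inverse (of_int (y * v) :: rat)"
    have e: "q = c * of_int (x * v)" "r = c * of_int (u * y)" "q + r = c * of_int (x * v + u * y)"
      using * by (auto simp: c_def field_simps)
    have "\<pi> (of_int (x * v + u * y)) \<le> max (\<pi> (of_int (x * v))) (\<pi> (of_int (u * y)))"
    proof (cases "multiplicity (int p) (x * v) \<le> multiplicity (int p) (u * y)")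
      case True
      then show ?thesis using int[of "x * v" "u * y"] * by auto
    next
      case False
      then show ?thesis using int[of "u * y" "x * v"] * by (auto simp: add.commute)
    qed
    then have "\<pi> c * \<pi> (of_int (x * v + u * y)) \<le> \<pi> c * max (\<pi> (of_int (x * v))) (\<pi> (of_int (u * y)))"
      by (rule mult_left_mono) simp
    also have "\<dots> = max (\<pi> c * \<pi> (of_int (x * v))) (\<pi> c * \<pi> (of_int (u * y)))"
      by (rule max_mult_distrib_left[of "\<pi> c", simplified])
    finally have "\<pi> (c * of_int (x * v + u * y)) \<le> max (\<pi> (c * of_int (x * v))) (\<pi> (c * of_int (u * y)))"
      by (simp only: padic_mult)
    then show ?thesis by (simp only: e(1,2) e(3)[unfolded e(1,2)])
  qed auto
qed

lemma padic_sum_le: "(\<And>i. i \<in> A \<Longrightarrow> \<pi> (f i) \<le> B) \<Longrightarrow> 0 \<le> B \<Longrightarrow> \<pi> (\<Sum>i\<in>A. f i) \<le> B"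
proof (induction A rule: infinite_finite_induct)
  case (insert x F)
  then show ?case using padic_add[of "f x" "sum f F"] by (force intro: order_trans)
qed auto

end

section \<open>Absolute values on subfields\<close>

locale abs_val =
  fixes K :: "complex set" and v :: "complex \<Rightarrow> real"
  assumes K: "subfield K \<CC>" and av: "absolute_value_on K v"
begin

lemmas K_closed = subfield_CC_D[OF K]

lemma v_nonneg: "x \<in> K \<Longrightarrow> 0 \<le> v x"
  and v_eq_0: "x \<in> K \<Longrightarrow> v x = 0 \<longleftrightarrow> x = 0"
  and v_mult: "x \<in> K \<Longrightarrow> y \<in> K \<Longrightarrow> v (x * y) = v x * v y"
  and v_add: "x \<in> K \<Longrightarrow> y \<in> K \<Longrightarrow> v (x + y) \<le> v x + v y"
  using av by (auto simp: absolute_value_on_def)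

lemma v_0 [simp]: "v 0 = 0" using v_eq_0 K_closed(1) by blast

lemma v_1 [simp]: "v 1 = 1"
  using v_mult[of 1 1] v_eq_0[of 1] K_closed(2) by simp

lemma v_pos: "x \<in> K \<Longrightarrow> x \<noteq> 0 \<Longrightarrow> 0 < v x"
  using v_nonneg v_eq_0 by force

lemma v_m1 [simp]: "v (- 1) = 1"
proof -
  have "v (-1) * v (-1) = 1" using v_mult[of "-1" "-1"] K_closed(2,4) by simp
  then show ?thesis using v_nonneg[of "-1"] K_closed(2,4) by (simp add: square_eq_1_iff)
qed

lemma v_minus: "x \<in> K \<Longrightarrow> v (- x) = v x"
  using v_mult[of "-1" x] K_closed(2,4) by simp

lemma v_diff: "x \<in> K \<Longrightarrow> y \<in> K \<Longrightarrow> v (x - y) \<le> v x + v y"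
  using v_add[of x "-y"] v_minus K_closed(4) by simp

lemma v_diff_ge: "x \<in> K \<Longrightarrow> y \<in> K \<Longrightarrow> v x - v y \<le> v (x - y)"
  using v_add[of "x - y" y] K_closed(7) by simp

lemma v_power: "x \<in> K \<Longrightarrow> v (x ^ n) = v x ^ n"
  by (induction n) (auto simp: v_mult K_closed)

lemma v_inverse: "x \<in> K \<Longrightarrow> v (inverse x) = inverse (v x)"
proof (cases "x = 0")
  case False
  assume x: "x \<in> K"
  then have "v x * v (inverse x) = 1" using v_mult[of x "inverse x"] False K_closed(6) by simp
  then show ?thesis by (metis inverse_unique)
qed auto

lemma v_divide: "x \<in> K \<Longrightarrow> y \<in> K \<Longrightarrow> v (x / y) = v x / v y"
  by (simp add: divide_inverse v_mult v_inverse K_closed)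

lemma K_sum: "(\<And>i. i \<in> A \<Longrightarrow> f i \<in> K) \<Longrightarrow> (\<Sum>i\<in>A. f i) \<in> K"
  by (induction A rule: infinite_finite_induct) (auto simp: K_closed)

lemma v_sum: "(\<And>i. i \<in> A \<Longrightarrow> f i \<in> K) \<Longrightarrow> v (\<Sum>i\<in>A. f i) \<le> (\<Sum>i\<in>A. v (f i))"
proof (induction A rule: infinite_finite_induct)
  case (insert x A)
  then have "v (f x + sum f A) \<le> v (f x) + v (sum f A)" by (intro v_add K_sum) auto
  then show ?case using insert by force
qed auto

end

lemma ex_linear_less_power:
  assumes "(r::real) > 1" shows "\<exists>n. real n + 1 < r ^ n"
proof -
  define x where "x = inverse r"
  have x: "norm x < 1" "x > 0" using assms by (auto simp: x_def field_simps)
  have "(\<lambda>n. real n * x ^ n + x ^ n) \<longlonglongrightarrow> 0 + 0"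
    by (intro tendsto_add powser_times_n_limit_0[OF x(1)] LIMSEQ_power_zero[OF x(1)])
  then have "eventually (\<lambda>n. real n * x ^ n + x ^ n < 1) sequentially"
    by (intro order_tendstoD) auto
  then obtain n where "real n * x ^ n + x ^ n < 1" by (auto simp: eventually_sequentially)
  moreover have "(real n + 1) / r ^ n = real n * x ^ n + x ^ n"
    by (simp add: x_def divide_inverse power_inverse algebra_simps)
  ultimately have "(real n + 1) / r ^ n < 1" by simp
  then show ?thesis using assms by (intro exI[of _ n]) (simp add: divide_less_eq)
qed

locale padic_val = abs_val K v + padic p for K v p +
  assumes ext: "v (of_rat q) = padic_abs p q"
begin

lemma v_int: "v (of_int k) \<le> 1"
  using ext[of "of_int k"] padic_int_le_1[of k] by simp

text \<open>Integers have value at most \<open>1\<close>, so the binomial theorem gives \<open>v (x + y) ^ n \<le> (n + 1) * M ^ n\<close> with \<open>M\<close> the larger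
  of the two values, and the linear factor loses against exponential growth.\<close>
lemma ultrametric:
  assumes x: "x \<in> K" and y: "y \<in> K"
  shows "v (x + y) \<le> max (v x) (v y)"
proof (rule ccontr)
  define M where "M = max (v x) (v y)"
  assume "\<not> ?thesis"
  then have gt: "M < v (x + y)" by (simp add: M_def not_le)
  have M0: "0 \<le> M" using v_nonneg[OF x] by (simp add: M_def le_max_iff_disj)
  have M: "M > 0"
  proof (rule ccontr)
    assume "\<not> M > 0"
    then have "v x = 0" "v y = 0" using v_nonneg[OF x] v_nonneg[OF y] by (auto simp: M_def not_less)
    then show False using gt M0 v_eq_0 x y by auto
  qed
  have bound: "v (x + y) ^ n \<le> (real n + 1) * M ^ n" for n
  proof -
    have "v ((x + y) ^ n) = v (\<Sum>k\<le>n. of_nat (n choose k) * x ^ k * y ^ (n - k))"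
      by (simp add: binomial_ring)
    also have "\<dots> \<le> (\<Sum>k\<le>n. v (of_nat (n choose k) * x ^ k * y ^ (n - k)))"
      using x y K_closed(5,9) K_closed(11)[of "int _"] by (intro v_sum) simp
    also have "\<dots> \<le> (\<Sum>k\<le>n. M ^ n)"
    proof (rule sum_mono)
      fix k assume "k \<in> {..n}"
      have "v (of_nat (n choose k) * x ^ k * y ^ (n - k)) = v (of_int (int (n choose k))) * (v x ^ k * v y ^ (n - k))"
        using x y K_closed(5,9) K_closed(11)[of "int _"] by (simp add: v_mult v_power)
      also have "\<dots> \<le> 1 * (M ^ k * M ^ (n - k))"
        using x y by (intro mult_mono v_int power_mono mult_nonneg_nonneg) (auto simp: M_def v_nonneg le_max_iff_disj)
      finally show "v (of_nat (n choose k) * x ^ k * y ^ (n - k)) \<le> M ^ n"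
        using \<open>k \<in> {..n}\<close> by (simp flip: power_add)
    qed
    finally show ?thesis using x y K_closed(3) by (simp add: v_power algebra_simps)
  qed
  obtain n where n: "real n + 1 < (v (x + y) / M) ^ n"
    using ex_linear_less_power[of "v (x + y) / M"] gt M by auto
  then have "(real n + 1) * M ^ n < v (x + y) ^ n"
    using M by (simp add: power_divide field_simps)
  then show False using bound[of n] by simp
qed

lemma ultrametric_sum:
  assumes "\<And>i. i \<in> A \<Longrightarrow> f i \<in> K" "\<And>i. i \<in> A \<Longrightarrow> v (f i) \<le> B" "0 \<le> B"
  shows "v (\<Sum>i\<in>A. f i) \<le> B"
  using assms
proof (induction A rule: infinite_finite_induct)
  case (insert x A)
  then have "v (f x + sum f A) \<le> max (v (f x)) (v (sum f A))" by (intro ultrametric K_sum) auto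
  then show ?case using insert by force
qed auto

text \<open>A single largest term could not be cancelled by the others, by the ultrametric inequality.\<close>
lemma zero_sum_two_maximal:
  assumes A: "finite A" "\<And>i. i \<in> A \<Longrightarrow> f i \<in> K" and sum: "(\<Sum>i\<in>A. f i) = 0"
    and k: "k \<in> A" "f k \<noteq> 0"
  shows "\<exists>i\<in>A. \<exists>j\<in>A. i \<noteq> j \<and> v (f i) = v (f j) \<and> f i \<noteq> 0 \<and> v (f k) \<le> v (f i)"
proof -
  obtain i where i: "i \<in> A" "\<And>j. j \<in> A \<Longrightarrow> v (f j) \<le> v (f i)"
    using Max_in[of "(\<lambda>i. v (f i)) ` A"] Max_ge[of "(\<lambda>i. v (f i)) ` A"] A(1) k(1) by fastforce
  have pos: "0 < v (f i)" using i(2)[OF k(1)] v_pos[OF A(2)[OF k(1)] k(2)] by simp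
  have "\<exists>j\<in>A - {i}. v (f i) \<le> v (f j)"
  proof (rule ccontr)
    assume "\<not> ?thesis"
    then have lt: "v (f j) < v (f i)" if "j \<in> A - {i}" for j using that by (meson not_le)
    define B where "B = Max (insert 0 ((\<lambda>j. v (f j)) ` (A - {i})))"
    have B: "0 \<le> B" "\<And>j. j \<in> A - {i} \<Longrightarrow> v (f j) \<le> B" "B < v (f i)"
      using A(1) lt pos by (auto simp: B_def)
    have "f i = - (\<Sum>j\<in>A - {i}. f j)"
      using sum sum.remove[OF A(1) i(1), of f] by (simp add: eq_neg_iff_add_eq_0)
    then have "v (f i) = v (\<Sum>j\<in>A - {i}. f j)"
      using v_minus[OF K_sum, of "A - {i}" f] A(2) by simp
    also have "\<dots> \<le> B" by (rule ultrametric_sum) (use A B in auto)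
    finally show False using B(3) by simp
  qed
  then obtain j where j: "j \<in> A" "j \<noteq> i" "v (f i) \<le> v (f j)" by blast
  then have "v (f i) = v (f j)" using i(2) by (simp add: antisym)
  moreover have "f i \<noteq> 0" using pos by auto
  ultimately show ?thesis using i j k by metis
qed

lemma rpoly_terms:
  assumes "x \<in> K"
  shows "of_rat (coeff f i) * x ^ i \<in> K" "v (of_rat (coeff f i) * x ^ i) = \<pi> (coeff f i) * v x ^ i"
  using assms K_closed(5,9,10) by (auto simp: v_mult v_power ext)

text \<open>Two terms of \<open>f(x)\<close> have equal maximal value, so some power of \<open>v x\<close> with positive exponent at most \<open>d\<close> is an integral
  power of \<open>p\<close>; being larger than \<open>1\<close> it is at least \<open>p\<close>. This turns a bound for the height into a bound for the primes
  in the denominator.\<close>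
lemma gt_1_gap:
  assumes x: "x \<in> K" "v x > 1" and f: "rpoly f x = 0" "f \<noteq> 0" "degree f \<le> d"
  shows "real p \<le> v x ^ d"
proof -
  have x0: "x \<noteq> 0" using x by auto
  have "\<exists>i\<in>{..degree f}. \<exists>j\<in>{..degree f}. i \<noteq> j \<and>
     v (of_rat (coeff f i) * x ^ i) = v (of_rat (coeff f j) * x ^ j) \<and> of_rat (coeff f i) * x ^ i \<noteq> 0 \<and>
     v (of_rat (coeff f (degree f)) * x ^ degree f) \<le> v (of_rat (coeff f i) * x ^ i)"
    by (rule zero_sum_two_maximal) (use x x0 f rpoly_terms rpoly_altdef[of f x] in auto)
  then obtain i j where "i \<le> degree f" "j \<le> degree f" "i \<noteq> j"
     "\<pi> (coeff f i) * v x ^ i = \<pi> (coeff f j) * v x ^ j" "coeff f i \<noteq> 0"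
    unfolding rpoly_terms(2)[OF x(1)] by auto
  then obtain i j where ij: "i < j" "j \<le> degree f" "\<pi> (coeff f i) * v x ^ i = \<pi> (coeff f j) * v x ^ j" 
     "coeff f i \<noteq> 0" "coeff f j \<noteq> 0"
    by (metis linorder_neqE_nat mult_eq_0_iff padic_eq_0_iff power_eq_0_iff not_one_less_zero x(2))
  obtain k l where kl: "\<pi> (coeff f i) = real p powi k" "\<pi> (coeff f j) = real p powi l"
    using padic_nz ij by metis
  have "v x ^ j = v x ^ i * v x ^ (j - i)" using ij(1) by (simp flip: power_add)
  then have "v x ^ (j - i) = real p powi (k - l)"
    using ij(3) kl x(2) p_gt_1 by (auto simp: power_int_diff field_simps)
  moreover have "v x ^ (j - i) > 1" using x(2) ij(1) by (simp add: one_less_power)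
  ultimately have "real p powi (k - l) > 1" by simp
  then have "k - l > 0" using p_gt_1 power_int_increasing[of "k - l" 0 "real p"] by (cases "k - l > 0") auto
  then have "real p powi 1 \<le> real p powi (k - l)" using p_gt_1 by (intro power_int_increasing) auto
  then have "real p \<le> v x ^ (j - i)" using \<open>v x ^ (j - i) = _\<close> by simp
  also have "\<dots> \<le> v x ^ d" using x(2) ij f(3) by (intro power_increasing) auto
  finally show ?thesis .
qed

text \<open>If the leading coefficient were a \<open>p\<close>-adic unit, the leading term alone would have the maximal value.\<close>
lemma gt_1_imp_dvd_lead_coeff:
  assumes x: "x \<in> K" "v x > 1" and f: "rpoly (rat_poly Q) x = 0" "Q \<noteq> 0"
  shows "int p dvd lead_coeff Q"
proof (rule ccontr)
  assume "\<not> ?thesis"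
  then have lc: "\<pi> (of_int (lead_coeff Q)) = 1" by (simp add: padic_int_1_iff)
  define t where "t i = of_rat (coeff (rat_poly Q) i) * x ^ i" for i
  have vt: "v (t i) = \<pi> (of_int (coeff Q i)) * v x ^ i" for i
    using rpoly_terms[OF x(1), of "rat_poly Q" i] by (simp add: t_def coeff_map_poly)
  have tK: "t i \<in> K" for i using rpoly_terms(1)[OF x(1)] by (simp add: t_def)
  have top: "v (t (degree Q)) = v x ^ degree Q" using lc by (simp add: vt)
  have "(\<Sum>i\<le>degree Q. t i) = 0" using f(1) unfolding rpoly_altdef t_def by (simp add: degree_map_poly)
  then have "\<exists>i\<in>{..degree Q}. \<exists>j\<in>{..degree Q}. i \<noteq> j \<and> v (t i) = v (t j) \<and> t i \<noteq> 0 \<and> v (t (degree Q)) \<le> v (t i)"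
    using top x(2) tK by (intro zero_sum_two_maximal) auto
  then obtain i where i: "i < degree Q" "v (t (degree Q)) \<le> v (t i)"
    by (metis atMost_iff le_neq_implies_less)
  have "v (t i) \<le> v x ^ i" using padic_int_le_1[of "coeff Q i"] x(2) by (simp add: vt mult_left_le_one_le)
  also have "\<dots> < v x ^ degree Q" using x(2) i(1) by (simp add: power_strict_increasing)
  finally show False using i(2) top by simp
qed

end

section \<open>Finiteness of the extensions of an absolute value\<close>

locale val_pair = v: abs_val K v + w: abs_val K w for K v w +
  fixes \<beta> :: "rat \<Rightarrow> real" and q0 :: rat
  assumes v_rat: "v (of_rat q) = \<beta> q" and w_rat: "w (of_rat q) = \<beta> q" and q0: "\<beta> q0 > 1"
begin

text \<open>For large \<open>n\<close> the ratio \<open>(v x / w x) ^ n\<close> exceeds \<open>\<beta> q0\<close>, so a power of \<open>\<beta> q0\<close> lies between \<open>w x ^ n\<close> and \<open>v x ^ n\<close>.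
  Division by the same power of \<open>q0\<close>, which both absolute values see equally, moves the threshold to \<open>1\<close>.\<close>
lemma separate_aux:
  assumes x: "x \<in> K" and lt: "w x < v x"
  shows "\<exists>y\<in>K. v y > 1 \<and> w y < 1"
proof -
  define b where "b = \<beta> q0"
  have b: "b > 1" using q0 by (simp add: b_def)
  have "x \<noteq> 0" using lt by auto
  then have s: "w x > 0" using w.v_pos x by blast
  have r: "v x / w x > 1" using s lt by simp
  then obtain n where n: "b < (v x / w x) ^ n" using real_arch_pow by blast
  define k where "k = \<lceil>log b (v x ^ n)\<rceil> - 1"
  have vp: "v x ^ n > 0" using s lt by simp
  have "of_int k < log b (v x ^ n)" "log b (v x ^ n) \<le> of_int k + 1"
    unfolding k_def by linarith+
  then have "b powr of_int k < b powr log b (v x ^ n)" "b powr log b (v x ^ n) \<le> b powr (of_int k + 1)"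
    using b by (simp_all add: powr_le_cancel_iff powr_less_cancel_iff)
  moreover have "b powr (of_int k + 1) = b powi k * b"
    using b by (simp add: powr_add powr_real_of_int')
  moreover have "b powr log b (v x ^ n) = v x ^ n" using b vp by simp
  ultimately have k: "b powi k < v x ^ n" "v x ^ n \<le> b powi k * b"
    using b by (simp_all add: powr_real_of_int')
  have bk: "b powi k > 0" using b by simp
  have "w x ^ n * b < v x ^ n" using n s by (simp add: power_divide field_simps)
  then have k2: "w x ^ n < b powi k" using k(2) b
    by (meson le_less_trans less_le_trans mult_less_cancel_right_pos not_less order_trans zero_less_one less_trans)
  define y where "y = x ^ n / of_rat q0 powi k"
  have qK: "of_rat q0 powi k \<in> K"
    by (cases k rule: int_cases2) (simp_all add: power_int_minus v.K_closed)
  have "v (of_rat q0 powi k) = b powi k"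
    by (cases k rule: int_cases2)
       (simp_all add: power_int_minus v.v_inverse v.v_power v.K_closed v_rat b_def)
  moreover have "w (of_rat q0 powi k) = b powi k"
    by (cases k rule: int_cases2)
       (simp_all add: power_int_minus w.v_inverse w.v_power w.K_closed w_rat b_def)
  ultimately have "v y = v x ^ n / b powi k" "w y = w x ^ n / b powi k"
    using qK x by (simp_all add: y_def v.v_divide w.v_divide v.v_power w.v_power v.K_closed)
  then show ?thesis using k k2 bk x qK v.K_closed(8,9) by (intro bexI[of _ y]) (simp_all add: y_def)
qed

lemma separate:
  assumes x: "x \<in> K" and neq: "v x \<noteq> w x"
  shows "\<exists>y\<in>K. v y > 1 \<and> w y < 1"
proof (cases "w x < v x")
  case True
  then show ?thesis using separate_aux x by blast
next
  case False
  then have lt: "v x < w x" using neq by simp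
  then have "x \<noteq> 0" by auto
  then have "v x > 0" using v.v_pos x by blast
  then have "w (inverse x) < v (inverse x)" using lt x by (simp add: v.v_inverse w.v_inverse)
  then show ?thesis using separate_aux v.K_closed(6) x by blast
qed

end

text \<open>Approximation in the manner of Artin and Whaples, by induction on \<open>W\<close>: the element \<open>x\<close> found for \<open>W\<close> is corrected by an element
  \<open>y\<close> that separates \<open>v\<close> from the new \<open>w\<close>.\<close>
lemma separate_from_finite:
  fixes \<beta> :: "rat \<Rightarrow> real"
  assumes K: "subfield K \<CC>" and q0: "\<beta> q0 > 1" and fin: "finite W"
    and v: "absolute_value_on K v" "\<And>q. v (of_rat q) = \<beta> q"
    and W: "\<And>w. w \<in> W \<Longrightarrow> absolute_value_on K w \<and> (\<forall>q. w (of_rat q) = \<beta> q) \<and> (\<exists>x\<in>K. v x \<noteq> w x)"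
  shows "\<exists>x\<in>K. v x > 1 \<and> (\<forall>w\<in>W. w x < 1)"
proof -
  interpret v: abs_val K v by (rule abs_val.intro[OF K v(1)])
  show ?thesis using fin W
  proof (induction W rule: finite_induct)
    case empty
    show ?case using q0 v(2)[of q0] v.K_closed(10)[of q0] by force
  next
    case (insert w W)
    then obtain x where x: "x \<in> K" "v x > 1" "\<And>u. u \<in> W \<Longrightarrow> u x < 1" by blast
    interpret w: abs_val K w using K insert.prems by (intro abs_val.intro) auto
    interpret val_pair K v w \<beta> q0
      using insert.prems v q0
      by (intro val_pair.intro val_pair_axioms.intro v.abs_val_axioms w.abs_val_axioms) auto
    obtain y where y: "y \<in> K" "v y > 1" "w y < 1"
      using separate insert.prems by blast
    have av: "abs_val K u" if "u \<in> W" for u using K insert.prems that by (intro abs_val.intro) auto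
    show ?case
    proof (cases "w x < 1")
      case True
      then show ?thesis using x by blast
    next
      case ge: False
      show ?thesis
      proof (cases "w x = 1")
        case True
        \<comment> \<open>A power of \<open>x\<close> kills the values in \<open>W\<close> and leaves the smallness of \<open>y\<close> at \<open>w\<close> alone.\<close>
        have "eventually (\<lambda>n. u (x ^ n * y) < 1) sequentially" if "u \<in> W" for u
        proof -
          interpret u: abs_val K u using av that .
          have "(\<lambda>n. u x ^ n * u y) \<longlonglongrightarrow> 0 * u y"
            by (intro tendsto_mult tendsto_const LIMSEQ_power_zero) (use x(3)[OF that] u.v_nonneg[OF x(1)] in auto)
          then have "eventually (\<lambda>n. u x ^ n * u y < 1) sequentially" by (intro order_tendstoD) auto
          then show ?thesis using x y by (simp add: u.v_mult u.v_power u.K_closed)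
        qed
        then have "eventually (\<lambda>n. \<forall>u\<in>W. u (x ^ n * y) < 1) sequentially"
          using insert.hyps(1) by (simp add: eventually_ball_finite)
        then obtain n where n: "\<forall>u\<in>W. u (x ^ n * y) < 1" by (auto simp: eventually_sequentially)
        have "v (x ^ n * y) = v x ^ n * v y" "w (x ^ n * y) = w y"
          using x y True by (simp_all add: v.v_mult v.v_power w.v_mult w.v_power v.K_closed)
        moreover have "v x ^ n * v y > 1"
          using x(2) y(2) by (metis less_le_trans mult_le_cancel_right1 one_le_power less_imp_le not_less zero_less_one order.strict_trans)
        ultimately show ?thesis using n y x v.K_closed(5,9)
          by (intro bexI[of _ "x ^ n * y"]) auto
      next
        case False
        then have wx: "w x > 1" using ge by simp
        \<comment> \<open>The factor tends to \<open>1\<close> where \<open>x\<close> is large, at \<open>v\<close> and \<open>w\<close>, and to \<open>0\<close> where \<open>x\<close> is small.\<close>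
        define z where "z n = x ^ n / (1 + x ^ n) * y" for n :: nat
        have xn: "x ^ n \<in> K" "1 + x ^ n \<in> K" for n using x v.K_closed by simp_all
        have zK: "z n \<in> K" for n unfolding z_def using xn y v.K_closed(5,8) by blast
        have uz: "u (z n) = u x ^ n / u (1 + x ^ n) * u y" if "abs_val K u" for u n
          unfolding z_def abs_val.v_mult[OF that v.K_closed(8)[OF xn] y(1)]
            abs_val.v_divide[OF that xn] abs_val.v_power[OF that x(1)] ..
        have large: "((\<lambda>n. u (z n)) \<longlongrightarrow> u y) sequentially" if "u x > 1" "abs_val K u" for u
        proof -
          interpret u: abs_val K u by fact
          have i: "(\<lambda>n. inverse (u x) ^ n) \<longlonglongrightarrow> 0"
            by (intro LIMSEQ_power_zero) (use that(1) in \<open>auto simp: inverse_less_1_iff\<close>)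
          have ex: "u (1 + inverse x ^ n) = u (1 + x ^ n) / u x ^ n" for n
          proof -
            have "x \<noteq> 0" using that(1) by auto
            then have "1 + inverse x ^ n = (1 + x ^ n) / x ^ n" by (simp add: field_simps power_inverse)
            then show ?thesis using xn x by (simp add: u.v_divide u.v_power)
          qed
          have "(\<lambda>n. u (1 + inverse x ^ n)) \<longlonglongrightarrow> 1"
          proof (rule LIMSEQ_I)
            fix e :: real assume "e > 0"
            then obtain N where N: "\<And>n. n \<ge> N \<Longrightarrow> norm (inverse (u x) ^ n - 0) < e" using LIMSEQ_D[OF i] by blast
            have "norm (u (1 + inverse x ^ n) - 1) \<le> inverse (u x) ^ n" for n
            proof -
              have xi: "inverse x ^ n \<in> K" using x v.K_closed by simp
              have "u (1 + inverse x ^ n) \<le> 1 + u (inverse x ^ n)"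
                using u.v_add[OF u.K_closed(2) xi] by simp
              moreover have "1 - u (- (inverse x ^ n)) \<le> u (1 - - (inverse x ^ n))"
                using u.v_diff_ge[OF u.K_closed(2) u.K_closed(4)[OF xi]] by simp
              ultimately show ?thesis using xi x(1) by (simp add: u.v_minus u.v_power u.v_inverse u.K_closed abs_le_iff)
            qed
            then show "\<exists>N. \<forall>n\<ge>N. norm (u (1 + inverse x ^ n) - 1) < e" using N
              by (intro exI[of _ N]) (metis abs_ge_self diff_zero le_less_trans order_trans real_norm_def)
          qed
          then have "(\<lambda>n. inverse (u (1 + inverse x ^ n)) * u y) \<longlonglongrightarrow> inverse 1 * u y"
            by (intro tendsto_intros) auto
          moreover have "inverse (u (1 + inverse x ^ n)) * u y = u (z n)" for n
            unfolding ex uz[OF u.abs_val_axioms] by simp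
          ultimately show ?thesis by simp
        qed
        have small: "((\<lambda>n. u (z n)) \<longlongrightarrow> 0) sequentially" if "u x < 1" "abs_val K u" for u
        proof -
          interpret u: abs_val K u by fact
          have ux: "0 \<le> u x" using u.v_nonneg x(1) .
          have l: "(\<lambda>n. u x ^ n / (1 - u x ^ n) * u y) \<longlonglongrightarrow> 0 / (1 - 0) * u y"
            by (intro tendsto_intros LIMSEQ_power_zero) (use that(1) ux in auto)
          have "eventually (\<lambda>n. norm (u (z n)) \<le> u x ^ n / (1 - u x ^ n) * u y) sequentially"
            using eventually_gt_at_top[of "0::nat"]
          proof eventually_elim
            case (elim n)
            then have lt: "u x ^ n < 1" using that(1) ux by (simp add: power_less_one_iff)
            have "1 - u (- (x ^ n)) \<le> u (1 - - (x ^ n))"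
              using u.v_diff_ge[OF u.K_closed(2) u.K_closed(4)[OF xn(1)]] by simp
            then have "1 - u x ^ n \<le> u (1 + x ^ n)" using x xn by (simp add: u.v_minus u.v_power)
            then have "u x ^ n / u (1 + x ^ n) * u y \<le> u x ^ n / (1 - u x ^ n) * u y"
              using lt ux u.v_nonneg[OF y(1)] by (intro mult_right_mono divide_left_mono mult_pos_pos) auto
            moreover have "u (z n) = u x ^ n / u (1 + x ^ n) * u y"
              using uz[OF u.abs_val_axioms] .
            ultimately have "u (z n) \<le> u x ^ n / (1 - u x ^ n) * u y" by (simp only:)
            then show ?case using u.v_nonneg[OF zK[of n]] by (simp only: real_norm_def abs_of_nonneg)
          qed
          moreover have "(\<lambda>n. u x ^ n / (1 - u x ^ n) * u y) \<longlonglongrightarrow> 0" using l by simp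
          ultimately show ?thesis by (rule Lim_null_comparison)
        qed
        have "eventually (\<lambda>n. \<forall>u\<in>W. u (z n) < 1) sequentially"
        proof (intro eventually_ball_finite insert.hyps(1) ballI)
          fix u assume u: "u \<in> W"
          show "eventually (\<lambda>n. u (z n) < 1) sequentially"
            by (rule order_tendstoD(2)[OF small[OF x(3)[OF u] av[OF u]]]) simp
        qed
        moreover have "eventually (\<lambda>n. v (z n) > 1) sequentially"
          by (rule order_tendstoD(1)[OF large[OF x(2) v.abs_val_axioms] y(2)])
        moreover have "eventually (\<lambda>n. w (z n) < 1) sequentially"
          by (rule order_tendstoD(2)[OF large[OF wx w.abs_val_axioms] y(3)])
        ultimately have "eventually (\<lambda>n. v (z n) > 1 \<and> w (z n) < 1 \<and> (\<forall>u\<in>W. u (z n) < 1)) sequentially"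
          by eventually_elim auto
        then obtain n where "v (z n) > 1 \<and> w (z n) < 1 \<and> (\<forall>u\<in>W. u (z n) < 1)"
          by (auto simp: eventually_sequentially)
        then show ?thesis using zK by blast
      qed
    qed
  qed
qed

text \<open>For finitely many extensions choose elements, one large at each and small at the others. High powers of these are
  linearly independent over \<open>\<rat>\<close>: in a relation the summand with the largest coefficient, measured by the common
  restriction \<open>\<beta>\<close>, would dominate at its own absolute value. So there are at most as many extensions as the degree.\<close>
lemma (in minimal_poly) finite_extensions:
  fixes \<beta> :: "rat \<Rightarrow> real"
  assumes q0: "\<beta> q0 > 1"
  defines "V \<equiv> {v \<in> extensional (adjoin a). absolute_value_on (adjoin a) v \<and> (\<forall>q. v (of_rat q) = \<beta> q)}"
  shows "finite V"
proof (rule conjunct1[OF finite_if_finite_subsets_card_bdd])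
  fix W assume "W \<subseteq> V" "finite W"
  define K where "K = adjoin a"
  have K: "subfield K \<CC>" unfolding K_def by (rule subfield_adjoin)
  have avW: "absolute_value_on K w" "w (of_rat q) = \<beta> q" "w \<in> extensional K" if "w \<in> W" for w q
    using \<open>W \<subseteq> V\<close> that unfolding V_def K_def by auto
  have "\<exists>x\<in>K. v x > 1 \<and> (\<forall>w\<in>W - {v}. w x < 1)" if "v \<in> W" for v
  proof (rule separate_from_finite[where \<beta> = \<beta>, OF K q0])
    show "finite (W - {v})" using \<open>finite W\<close> by simp
    fix w assume w: "w \<in> W - {v}"
    have "\<exists>x\<in>K. v x \<noteq> w x"
    proof (rule ccontr)
      assume "\<not> ?thesis"
      then have "v = w" using extensionalityI[OF avW(3) avW(3), of v w] that w by auto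
      then show False using w by simp
    qed
    then show "absolute_value_on K w \<and> (\<forall>q. w (of_rat q) = \<beta> q) \<and> (\<exists>x\<in>K. v x \<noteq> w x)"
      using avW w by auto
  qed (use avW that in auto)
  then obtain Z where Z: "\<And>v. v \<in> W \<Longrightarrow> Z v \<in> K" "\<And>v. v \<in> W \<Longrightarrow> v (Z v) > 1"
    "\<And>v w. v \<in> W \<Longrightarrow> w \<in> W \<Longrightarrow> w \<noteq> v \<Longrightarrow> w (Z v) < 1" by (metis DiffI singletonD)
  define r where "r = card W"
  have "\<forall>v\<in>W. eventually (\<lambda>m. v (Z v) ^ m > real r) sequentially"
  proof
    fix v assume v: "v \<in> W"
    show "eventually (\<lambda>m. v (Z v) ^ m > real r) sequentially"
    proof -
      obtain m0 where m0: "real r < v (Z v) ^ m0" using real_arch_pow Z(2)[OF v] by blast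
      have "v (Z v) ^ m > real r" if "m \<ge> m0" for m
        using m0 power_increasing[OF that, of "v (Z v)"] Z(2)[OF v] by linarith
      then show ?thesis unfolding eventually_sequentially by blast
    qed
  qed
  then have "eventually (\<lambda>m. \<forall>v\<in>W. v (Z v) ^ m > real r) sequentially"
    using \<open>finite W\<close> by (simp add: eventually_ball_finite)
  then obtain m where m: "\<And>v. v \<in> W \<Longrightarrow> v (Z v) ^ m > real r" by (auto simp: eventually_sequentially)
  obtain ws where ws: "set ws = W" "distinct ws" using \<open>finite W\<close> finite_distinct_list by blast
  have lws: "length ws = r" using ws by (simp add: r_def distinct_card[symmetric])
  define Us where "Us = map (\<lambda>v. Z v ^ m) ws"
  have "CC.independent \<rat> Us"
  proof (rule independent_RatsI)
    fix c i assume sum: "(\<Sum>i<length Us. of_rat (c i) * Us ! i) = 0" and i: "i < length Us"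
    have lU: "length Us = r" by (simp add: Us_def lws)
    obtain j where j: "j < r" "\<And>k. k < r \<Longrightarrow> \<beta> (c k) \<le> \<beta> (c j)"
      using Max_in[of "(\<lambda>k. \<beta> (c k)) ` {..<r}"] Max_ge[of "(\<lambda>k. \<beta> (c k)) ` {..<r}"] i lU by fastforce
    define v where "v = ws ! j"
    have v: "v \<in> W" using j(1) lws ws by (auto simp: v_def)
    interpret abs_val K v by (rule abs_val.intro[OF K avW(1)[OF v]])
    have UK: "Us ! k \<in> K" if "k < r" for k
      using K_closed(9)[OF Z(1)[of "ws ! k"]] that ws(1) lws nth_mem[of k ws] by (simp add: Us_def)
    have b0: "0 \<le> \<beta> q" for q using v_nonneg[OF K_closed(10)] avW(2)[OF v] by metis
    have off: "v (Us ! k) \<le> 1" if k: "k < r" "k \<noteq> j" for k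
    proof -
      have wk: "ws ! k \<in> W" "ws ! k \<noteq> v" using k j(1) ws lws by (auto simp: v_def nth_eq_iff_index_eq)
      then have "v (Z (ws ! k)) < 1" using Z(3) v by auto
      then show ?thesis using wk Z(1) v_nonneg k lws by (simp add: Us_def v_power power_le_one)
    qed
    have on: "v (Us ! j) > real r" using m[OF v] Z(1)[OF v] j(1) lws by (simp add: Us_def v_def[symmetric] v_power)
    have "\<beta> (c j) = 0"
    proof (rule ccontr)
      assume "\<beta> (c j) \<noteq> 0"
      then have bp: "\<beta> (c j) > 0" using b0[of "c j"] by simp
      define S where "S = (\<Sum>k\<in>{..<r} - {j}. of_rat (c k) * Us ! k)"
      have inK: "of_rat (c k) * Us ! k \<in> K" if "k < r" for k using UK[OF that] K_closed(5,10) by blast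
      have SK: "S \<in> K" unfolding S_def using inK by (intro K_sum) auto
      have "of_rat (c j) * Us ! j + S = 0"
        using sum j(1) sum.remove[of "{..<r}" j "\<lambda>k. of_rat (c k) * Us ! k"] by (simp add: S_def lU)
      then have "of_rat (c j) * Us ! j = - S" by (simp add: eq_neg_iff_add_eq_0)
      then have "\<beta> (c j) * v (Us ! j) = v S"
        using v_minus[OF SK] v_mult[OF K_closed(10) UK[OF j(1)], of "c j"] avW(2)[OF v] by simp
      also have "\<dots> \<le> (\<Sum>k\<in>{..<r} - {j}. v (of_rat (c k) * Us ! k))"
        unfolding S_def using inK by (intro v_sum) auto
      also have "\<dots> \<le> (\<Sum>k\<in>{..<r} - {j}. \<beta> (c j))"
      proof (rule sum_mono)
        fix k assume k: "k \<in> {..<r} - {j}"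
        then have "v (of_rat (c k) * Us ! k) = \<beta> (c k) * v (Us ! k)"
          using v_mult[OF K_closed(10) UK] avW(2)[OF v] by simp
        also have "\<dots> \<le> \<beta> (c j) * 1" using k j(2) off UK v_nonneg b0 by (intro mult_mono) auto
        finally show "v (of_rat (c k) * Us ! k) \<le> \<beta> (c j)" by simp
      qed
      also have "\<dots> \<le> real r * \<beta> (c j)" using bp by (simp add: mult_right_mono card_Diff_singleton_if)
      finally show False using on bp by (simp add: mult.commute)
    qed
    then have "\<beta> (c i) = 0" using j(2)[of i] b0[of "c i"] i lU by simp
    then show "c i = 0" using avW(2)[OF v, of "c i"] v_eq_0[OF K_closed(10)] by simp
  qed
  moreover have "set Us \<subseteq> adjoin a"
    using Z(1) ws(1) subfield_CC_D(9)[OF K] by (auto simp: Us_def K_def)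
  ultimately have "length Us \<le> n"
    by (rule CC.independent_length_le_dimension[OF subfield_Rats dimension_adjoin])
  then show "card W \<le> n" by (simp add: Us_def lws r_def)
qed

section \<open>Existence of p-adic places\<close>

lemma le_mult_eps:
  fixes A B c :: real
  assumes "0 \<le> A" "0 \<le> B" "\<And>s t. A < s \<Longrightarrow> B < t \<Longrightarrow> c \<le> s * t"
  shows "c \<le> A * B"
proof (rule LIMSEQ_le_const)
  show "(\<lambda>n. (A + inverse (real (Suc n))) * (B + inverse (real (Suc n)))) \<longlonglongrightarrow> A * B"
    using tendsto_mult[OF tendsto_add[OF tendsto_const[of A] LIMSEQ_inverse_real_of_nat]
       tendsto_add[OF tendsto_const[of B] LIMSEQ_inverse_real_of_nat]] by simp
  show "\<exists>N. \<forall>n\<ge>N. c \<le> (A + inverse (real (Suc n))) * (B + inverse (real (Suc n)))"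
    using assms(3) by simp
qed

text \<open>An extension of the \<open>p\<close>-adic absolute value is found without completing \<open>\<rat>\<close>: a submultiplicative seminorm bounded by the
  \<open>p\<close>-adic absolute value on \<open>\<rat>\<close> already restricts to it, and a minimal such seminorm on a field is multiplicative.
  Starting from a seminorm that is small at a given element keeps that element small.\<close>
locale padic_field = padic p for p + fixes K :: "complex set" assumes K: "subfield K \<CC>"
begin

lemmas K_closed = subfield_CC_D[OF K]

text \<open>Vanishing outside \<open>K\<close> makes the pointwise order antisymmetric, as the use of Zorn's lemma requires.\<close>
definition seminorm :: "(complex \<Rightarrow> real) \<Rightarrow> bool" where
  "seminorm N \<longleftrightarrow> (\<forall>x\<in>K. 0 \<le> N x) \<and> N 1 = 1 \<and> (\<forall>x\<in>K. \<forall>y\<in>K. N (x * y) \<le> N x * N y) \<and>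
     (\<forall>x\<in>K. \<forall>y\<in>K. N (x + y) \<le> max (N x) (N y)) \<and> (\<forall>q. N (of_rat q) \<le> \<pi> q) \<and> (\<forall>x. x \<notin> K \<longrightarrow> N x = 0)"

lemma seminormD:
  assumes "seminorm N"
  shows "x \<in> K \<Longrightarrow> 0 \<le> N x" "N 1 = 1" "x \<in> K \<Longrightarrow> y \<in> K \<Longrightarrow> N (x * y) \<le> N x * N y"
    "x \<in> K \<Longrightarrow> y \<in> K \<Longrightarrow> N (x + y) \<le> max (N x) (N y)" "N (of_rat q) \<le> \<pi> q" "x \<notin> K \<Longrightarrow> N x = 0"
  using assms by (auto simp: seminorm_def)

lemma seminorm_nonneg: "seminorm N \<Longrightarrow> 0 \<le> N x"
  by (metis order_refl seminormD(1,6))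

lemma seminorm_0: "seminorm N \<Longrightarrow> N 0 = 0"
  using seminormD(5)[of N 0] seminorm_nonneg[of N 0] by simp

lemma seminorm_nat: "seminorm N \<Longrightarrow> N (of_nat k) \<le> 1"
  using seminormD(5)[of N "of_nat k"] padic_int_le_1[of "int k"] by simp

lemma seminorm_pos:
  assumes "seminorm N" "x \<in> K" "x \<noteq> 0" shows "N x > 0"
proof -
  have "1 \<le> N x * N (inverse x)" using seminormD(2,3)[OF assms(1)] assms K_closed(6) by (metis right_inverse)
  then show ?thesis using seminorm_nonneg[OF assms(1), of x] by (cases "N x = 0") auto
qed

text \<open>The lower bound comes from \<open>1 \<le> N q * N (1/q)\<close>.\<close>
lemma seminorm_rat:
  assumes "seminorm N" shows "N (of_rat q) = \<pi> q"
proof (cases "q = 0")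
  case False
  have "of_rat q * of_rat (inverse q) = (1 :: complex)" using False by (simp flip: of_rat_mult)
  then have "1 \<le> N (of_rat q) * N (of_rat (inverse q))" 
    using seminormD(2)[OF assms] seminormD(3)[OF assms K_closed(10,10), of q "inverse q"] by simp
  also have "\<dots> \<le> N (of_rat q) * \<pi> (inverse q)"
    by (intro mult_left_mono seminormD(5)[OF assms] seminorm_nonneg[OF assms])
  finally have "1 \<le> N (of_rat q) * inverse (\<pi> q)" by (simp only: padic_inverse)
  then have "\<pi> q \<le> N (of_rat q)" using padic_pos[OF False] by (simp add: field_simps)
  then show ?thesis using seminormD(5)[OF assms, of q] by simp
qed (simp add: seminorm_0[OF assms])

lemma seminorm_sum:
  assumes "seminorm N" "\<And>i. i \<in> A \<Longrightarrow> f i \<in> K" "\<And>i. i \<in> A \<Longrightarrow> N (f i) \<le> B" "0 \<le> B"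
  shows "(\<Sum>i\<in>A. f i) \<in> K \<and> N (\<Sum>i\<in>A. f i) \<le> B"
  using assms(2-)
proof (induction A rule: infinite_finite_induct)
  case (insert x A)
  then have "N (f x + sum f A) \<le> max (N (f x)) (N (sum f A))" by (intro seminormD(4)[OF assms(1)]) auto
  then show ?case using insert K_closed(3) by force
qed (use K_closed(1) seminorm_0[OF assms(1)] in auto)

lemma seminorm_power: "seminorm N \<Longrightarrow> x \<in> K \<Longrightarrow> N (x ^ n) \<le> N x ^ n"
proof (induction n)
  case (Suc n)
  have "N (x ^ Suc n) \<le> N x * N (x ^ n)" using seminormD(3)[of N x "x ^ n"] Suc.prems K_closed(9) by simp
  also have "\<dots> \<le> N x * N x ^ n" using Suc by (intro mult_left_mono seminorm_nonneg) auto
  finally show ?case by simp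
qed (simp add: seminormD(2))

text \<open>All seminorms below are infima of admissible bounds.\<close>
lemma seminorm_Inf:
  fixes R :: "complex \<Rightarrow> real \<Rightarrow> bool"
  assumes ex: "\<And>x. x \<in> K \<Longrightarrow> \<exists>r. R x r" and nn: "\<And>x r. R x r \<Longrightarrow> 0 \<le> r"
    and mult: "\<And>x y r s. x \<in> K \<Longrightarrow> y \<in> K \<Longrightarrow> R x r \<Longrightarrow> R y s \<Longrightarrow> R (x * y) (r * s)"
    and add: "\<And>x y r s. x \<in> K \<Longrightarrow> y \<in> K \<Longrightarrow> R x r \<Longrightarrow> R y s \<Longrightarrow> R (x + y) (max r s)"
    and rat: "\<And>q s. \<pi> q < s \<Longrightarrow> R (of_rat q) s" and one: "\<And>r. R 1 r \<Longrightarrow> 1 \<le> r"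
  defines "N \<equiv> \<lambda>x. if x \<in> K then Inf {r. R x r} else 0"
  shows "seminorm N \<and> (\<forall>x r. x \<in> K \<longrightarrow> R x r \<longrightarrow> N x \<le> r)"
proof -
  have bdd: "bdd_below {r. R x r}" for x using nn by (auto intro!: bdd_belowI)
  have le: "N x \<le> r" if "x \<in> K" "R x r" for x r
    using that bdd by (auto simp: N_def intro: cInf_lower)
  have ge: "c \<le> N x" if "x \<in> K" "\<And>r. R x r \<Longrightarrow> c \<le> r" for x c
    using that ex[of x] by (auto simp: N_def intro!: cInf_greatest)
  have lt: "\<exists>r<s. R x r" if "x \<in> K" "N x < s" for x s
    using that ex[of x] cInf_lessD[of "{r. R x r}" s] by (auto simp: N_def)
  have nonneg: "0 \<le> N x" if "x \<in> K" for x using ge[OF that] nn by blast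
  have rat': "N (of_rat q) \<le> \<pi> q" for q
    by (rule dense_ge) (use le rat K_closed(10) in blast)
  have "seminorm N" unfolding seminorm_def
  proof (intro conjI ballI allI impI)
    fix x y assume xy: "x \<in> K" "y \<in> K"
    show "N (x * y) \<le> N x * N y"
    proof (rule le_mult_eps)
      fix s t assume "N x < s" "N y < t"
      then obtain r r' where r: "r < s" "R x r" "r' < t" "R y r'" using lt xy by metis
      have "N (x * y) \<le> r * r'" using le mult xy r K_closed(5) by blast
      also have "\<dots> \<le> s * t" using r nn by (intro mult_mono) (auto intro: order_trans[OF nn less_imp_le])
      finally show "N (x * y) \<le> s * t" .
    qed (use nonneg xy in auto)
    show "N (x + y) \<le> max (N x) (N y)"
    proof (rule dense_ge)
      fix s assume "max (N x) (N y) < s"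
      then have "N x < s" "N y < s" by auto
      then obtain r r' where r: "r < s" "R x r" "r' < s" "R y r'" using lt xy by metis
      have "N (x + y) \<le> max r r'" using le add xy r K_closed(3) by blast
      then show "N (x + y) \<le> s" using r by auto
    qed
  next
    show "N 1 = 1" using ge[OF K_closed(2), of 1] one rat'[of 1] by (simp add: antisym)
  qed (use nonneg rat' in \<open>auto simp: N_def\<close>)
  then show ?thesis using le by blast
qed

definition minimal_seminorm :: "(complex \<Rightarrow> real) \<Rightarrow> bool" where
  "minimal_seminorm N \<longleftrightarrow> seminorm N \<and> (\<forall>M. seminorm M \<longrightarrow> (\<forall>x\<in>K. M x \<le> N x) \<longrightarrow> M = N)"

text \<open>Zorn's lemma: the pointwise infimum of a chain of seminorms is a seminorm.\<close>
lemma ex_minimal_seminorm: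
  assumes "seminorm N0"
  obtains N where "minimal_seminorm N" "\<And>x. N x \<le> N0 x"
proof -
  define A where "A = {N. seminorm N \<and> (\<forall>x. N x \<le> N0 x)}"
  have le_iff: "M \<le> N \<longleftrightarrow> (\<forall>x\<in>K. M x \<le> N x)" if "seminorm M" "seminorm N" for M N
    using seminormD(6)[OF that(1)] seminormD(6)[OF that(2)] unfolding le_fun_def by force
  have "\<exists>m\<in>A. \<forall>a\<in>A. m \<ge> a \<longrightarrow> a = m"
  proof (rule predicate_Zorn)
    show "partial_order_on A (relation_of (\<lambda>x y. x \<ge> y) A)"
      by (rule partial_order_on_relation_ofI) auto
    fix C assume C: "C \<in> Chains (relation_of (\<lambda>x y. x \<ge> y) A)"
    then have CA: "C \<subseteq> A" and chain: "\<And>M N. M \<in> C \<Longrightarrow> N \<in> C \<Longrightarrow> M \<le> N \<or> N \<le> M"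
      by (auto simp: Chains_def relation_of_def)
    show "\<exists>u\<in>A. \<forall>a\<in>C. u \<le> a"
    proof (cases "C = {}")
      case True
      then show ?thesis using assms by (intro bexI[of _ N0]) (auto simp: A_def)
    next
      case False
      then obtain M0 where M0: "M0 \<in> C" by blast
      have sn: "seminorm M" if "M \<in> C" for M using that CA by (auto simp: A_def)
      define R where "R x r \<longleftrightarrow> (\<exists>M\<in>C. M x \<le> r)" for x r
      define N where "N = (\<lambda>x. if x \<in> K then Inf {r. R x r} else 0)"
      have two: "\<exists>M\<in>C. M x \<le> r \<and> M y \<le> s" if R: "R x r" "R y s" for x y r s
      proof -
        obtain M1 M2 where M: "M1 \<in> C" "M1 x \<le> r" "M2 \<in> C" "M2 y \<le> s" using R unfolding R_def by blast
        from chain[OF M(1,3)] show ?thesis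
        proof
          assume "M1 \<le> M2" then show ?thesis using M by (intro bexI[of _ M1]) (auto simp: le_fun_def intro: order_trans)
        next
          assume "M2 \<le> M1" then show ?thesis using M by (intro bexI[of _ M2]) (auto simp: le_fun_def intro: order_trans)
        qed
      qed
      have N: "seminorm N \<and> (\<forall>x r. x \<in> K \<longrightarrow> R x r \<longrightarrow> N x \<le> r)"
        unfolding N_def
      proof (rule seminorm_Inf)
        show "\<exists>r. R x r" for x using M0 by (auto simp: R_def)
        show nn: "0 \<le> r" if "R x r" for x r
          using that sn seminorm_nonneg unfolding R_def by (meson order_trans)
        show "R (x * y) (r * s)" if xy: "x \<in> K" "y \<in> K" and r: "R x r" "R y s" for x y r s
        proof -
          obtain M where M: "M \<in> C" "M x \<le> r" "M y \<le> s" using two r by blast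
          have "M (x * y) \<le> M x * M y" using seminormD(3) sn M(1) xy by blast
          also have "\<dots> \<le> r * s" using M nn r seminorm_nonneg sn by (intro mult_mono) auto
          finally show ?thesis using M by (auto simp: R_def)
        qed
        show "R (x + y) (max r s)" if xy: "x \<in> K" "y \<in> K" and r: "R x r" "R y s" for x y r s
        proof -
          obtain M where M: "M \<in> C" "M x \<le> r" "M y \<le> s" using two r by blast
          have "M (x + y) \<le> max (M x) (M y)" using seminormD(4) sn M(1) xy by blast
          then show ?thesis using M by (auto simp: R_def intro!: bexI[of _ M])
        qed
        show "R (of_rat q) s" if "\<pi> q < s" for q s
          using seminormD(5)[OF sn[OF M0], of q] M0 that by (auto simp: R_def intro!: bexI[of _ M0])
        show "1 \<le> r" if "R 1 r" for r using that unfolding R_def by (metis seminormD(2) sn)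
      qed
      have "N \<le> M" if "M \<in> C" for M
        using N that le_iff[OF _ sn[OF that]] by (auto simp: R_def)
      then show ?thesis using N CA M0 by (intro bexI[of _ N]) (auto simp: A_def le_fun_def intro: order_trans)
    qed
  qed
  then obtain N where N: "N \<in> A" "\<And>M. M \<in> A \<Longrightarrow> M \<le> N \<Longrightarrow> M = N" by blast
  have "M = N" if "seminorm M" "\<forall>x\<in>K. M x \<le> N x" for M
  proof (rule N(2))
    show "M \<le> N" using le_iff that N(1) by (auto simp: A_def)
    then show "M \<in> A" using that(1) N(1) by (auto simp: A_def le_fun_def intro: order_trans)
  qed
  then show ?thesis using that N(1) by (auto simp: A_def minimal_seminorm_def)
qed

text \<open>The spectral seminorm, the infimum of all \<open>r\<close> such that \<open>N (x ^ n)\<close> is \<open>O(r ^ n)\<close>, lies below \<open>N\<close> and so equals it. If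
  \<open>N (x ^ k)\<close> were smaller than \<open>N x ^ k\<close>, the powers of \<open>x\<close> would grow more slowly than those of \<open>N x\<close>.\<close>
lemma minimal_power_mult:
  assumes min: "minimal_seminorm N" and x: "x \<in> K"
  shows "N (x ^ k) = N x ^ k"
proof -
  have N: "seminorm N" using min by (simp add: minimal_seminorm_def)
  define R where "R x r \<longleftrightarrow> 0 < r \<and> (\<exists>A. \<forall>n. N (x ^ n) \<le> A * r ^ n)" for x r
  define S where "S = (\<lambda>x. if x \<in> K then Inf {r. R x r} else 0)"
  have R1: "R x r" if "x \<in> K" "N x \<le> r" "0 < r" for x r
  proof -
    have "N (x ^ n) \<le> 1 * r ^ n" for n
      using seminorm_power[OF N that(1), of n] power_mono[OF that(2) seminorm_nonneg[OF N]] by (simp add: order_trans)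
    then show ?thesis using that(3) unfolding R_def by blast
  qed
  have S: "seminorm S \<and> (\<forall>x r. x \<in> K \<longrightarrow> R x r \<longrightarrow> S x \<le> r)"
    unfolding S_def
  proof (rule seminorm_Inf)
    show "\<exists>r. R x r" if "x \<in> K" for x
      using R1[OF that, of "N x + 1"] seminorm_nonneg[OF N, of x] by auto
    show "0 \<le> r" if "R x r" for x r using that by (simp add: R_def)
    fix x y r s assume xy: "x \<in> K" "y \<in> K" and "R x r" "R y s"
    then obtain A B where r: "0 < r" "0 < s" and A: "\<And>n. N (x ^ n) \<le> A * r ^ n" and B: "\<And>n. N (y ^ n) \<le> B * s ^ n"
      unfolding R_def by blast
    have A0: "0 \<le> A" "0 \<le> B" using A[of 0] B[of 0] seminormD(2)[OF N] by auto
    show "R (x * y) (r * s)" unfolding R_def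
    proof (intro conjI exI allI)
      fix n
      have "N ((x * y) ^ n) \<le> N (x ^ n) * N (y ^ n)"
        unfolding power_mult_distrib using seminormD(3)[OF N] xy K_closed(9) by blast
      also have "\<dots> \<le> (A * r ^ n) * (B * s ^ n)"
        using A B A0 r seminorm_nonneg[OF N] by (intro mult_mono) auto
      finally show "N ((x * y) ^ n) \<le> (A * B) * (r * s) ^ n" by (simp add: power_mult_distrib algebra_simps)
    qed (use r in simp)
    show "R (x + y) (max r s)" unfolding R_def
    proof (intro conjI exI allI)
      fix n
      have "N (of_nat (n choose k) * x ^ k * y ^ (n - k)) \<le> (A * B) * max r s ^ n" if "k \<le> n" for k
      proof -
        have nk: "of_nat (n choose k) \<in> K" using K_closed(11)[of "int (n choose k)"] by simp
        have "N (of_nat (n choose k) * x ^ k * y ^ (n - k)) \<le> N (of_nat (n choose k) * x ^ k) * N (y ^ (n - k))"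
          using seminormD(3)[OF N] xy K_closed(5,9) nk by blast
        also have "\<dots> \<le> (N (of_nat (n choose k)) * N (x ^ k)) * N (y ^ (n - k))"
          using seminormD(3)[OF N nk K_closed(9)[OF xy(1)]] seminorm_nonneg[OF N] by (intro mult_right_mono) auto
        also have "\<dots> \<le> (1 * (A * max r s ^ k)) * (B * max r s ^ (n - k))"
        proof (intro mult_mono seminorm_nat[OF N] seminorm_nonneg[OF N] mult_nonneg_nonneg)
          show "N (x ^ k) \<le> A * max r s ^ k"
            using A[of k] r A0 by (auto intro!: order_trans[OF A] mult_left_mono power_mono)
          show "N (y ^ (n - k)) \<le> B * max r s ^ (n - k)"
            using A[of k] r A0 by (auto intro!: order_trans[OF B] mult_left_mono power_mono)
        qed (use A0 r in auto)
        also have "\<dots> = (A * B) * max r s ^ n" using that by (simp flip: power_add)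
        finally show ?thesis .
      qed
      then have "N (\<Sum>k\<le>n. of_nat (n choose k) * x ^ k * y ^ (n - k)) \<le> (A * B) * max r s ^ n"
        using xy K_closed(5,9) K_closed(11)[of "int _"] A0 r
        by (intro conjunct2[OF seminorm_sum[OF N]]) (auto simp: le_max_iff_disj)
      then show "N ((x + y) ^ n) \<le> (A * B) * max r s ^ n" by (simp add: binomial_ring)
    qed (use r in simp)
  next
    fix q s assume "\<pi> q < s"
    then show "R (of_rat q) s"
      using R1[OF K_closed(10), of q s] seminormD(5)[OF N, of q] padic_nonneg[of q] by linarith
  next
    fix r assume "R 1 r"
    then obtain A where r: "0 < r" and A: "\<And>n. N (1 ^ n) \<le> A * r ^ n" unfolding R_def by blast
    have A': "1 \<le> A * r ^ n" for n using A[of n] seminormD(2)[OF N] by simp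
    show "1 \<le> r"
    proof (rule ccontr)
      assume "\<not> 1 \<le> r"
      then have "(\<lambda>n. A * r ^ n) \<longlonglongrightarrow> A * 0" using r by (intro tendsto_mult tendsto_const LIMSEQ_power_zero) auto
      then have "1 \<le> A * 0" using A' by (intro LIMSEQ_le_const) auto
      then show False by simp
    qed
  qed
  have "S x \<le> N x" if "x \<in> K" for x
  proof (rule dense_ge)
    fix r assume "N x < r"
    then show "S x \<le> r" using S R1[OF that, of r] that seminorm_nonneg[OF N, of x] by auto
  qed
  then have SN: "S = N" using min S by (auto simp: minimal_seminorm_def)
  show ?thesis
  proof (rule ccontr)
    assume "\<not> ?thesis"
    then have lt: "N (x ^ k) < N x ^ k" using seminorm_power[OF N x, of k] by simp
    then have k: "k > 0" using seminormD(2)[OF N] by (cases k) auto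
    define t where "t = N x"
    have t: "t > 0" using lt seminorm_nonneg[OF N, of "x ^ k"] seminorm_nonneg[OF N, of x] k
      by (metis t_def less_le_trans not_less order.not_eq_order_implies_strict power_eq_0_iff)
    define r where "r = max (root k (N (x ^ k))) (t / 2)"
    have r0: "r > 0" using t by (simp add: r_def)
    have "root k (N (x ^ k)) < root k (t ^ k)" using lt k by (simp add: t_def)
    then have rt: "r < t" using k t by (simp add: r_def real_root_power_cancel)
    have rk: "N (x ^ k) \<le> r ^ k"
    proof -
      have "N (x ^ k) = root k (N (x ^ k)) ^ k" using k seminorm_nonneg[OF N] by simp
      also have "\<dots> \<le> r ^ k" using seminorm_nonneg[OF N] k by (intro power_mono) (auto simp: r_def)
      finally show ?thesis .
    qed
    \<comment> \<open>Splitting off multiples of \<open>k\<close> from the exponent leaves a remainder below \<open>k\<close>, absorbed in the constant \<open>(t / r) ^ k\<close>.\<close>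
    have "R x r" unfolding R_def
    proof (intro conjI r0 exI allI)
      fix m
      define q j where "q = m div k" and "j = m mod k"
      have m: "m = k * q + j" and j: "j < k" using k by (auto simp: q_def j_def)
      have "N (x ^ m) \<le> N ((x ^ k) ^ q) * N (x ^ j)"
        unfolding m power_add power_mult using seminormD(3)[OF N] K_closed(9) x by blast
      also have "\<dots> \<le> N (x ^ k) ^ q * N x ^ j"
        using x K_closed(9) by (intro mult_mono seminorm_power[OF N] zero_le_power seminorm_nonneg[OF N]) auto
      also have "\<dots> \<le> (r ^ k) ^ q * t ^ j"
        using rk t r0 seminorm_nonneg[OF N] by (intro mult_mono power_mono) (auto simp: t_def)
      also have "\<dots> = r ^ m * (t / r) ^ j" using r0 by (simp add: m power_add power_mult power_divide)
      also have "\<dots> \<le> r ^ m * (t / r) ^ k" using r0 rt j by (intro mult_left_mono power_increasing) auto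
      finally show "N (x ^ m) \<le> (t / r) ^ k * r ^ m" by (simp add: mult.commute)
    qed
    then have "S x \<le> r" using S x by blast
    then show False using SN rt by (simp add: t_def)
  qed
qed

text \<open>The smoothing of \<open>N\<close> at \<open>x\<close>, given by \<open>y \<mapsto> inf N (y * x ^ n) / N x ^ n\<close>, is again a seminorm; that it does not kill \<open>1\<close>
  is power multiplicativity. By minimality it equals \<open>N\<close>, and \<open>n = 1\<close> gives \<open>N y * N x \<le> N (y * x)\<close>.\<close>
lemma minimal_mult:
  assumes min: "minimal_seminorm N" and x: "x \<in> K" and y: "y \<in> K"
  shows "N (y * x) = N y * N x"
proof (cases "x = 0")
  case False
  have N: "seminorm N" using min by (simp add: minimal_seminorm_def)
  define t where "t = N x"
  have t: "t > 0" unfolding t_def by (rule seminorm_pos[OF N x False])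
  have pw: "N (x ^ n) = t ^ n" for n unfolding t_def by (rule minimal_power_mult[OF min x])
  have xn: "x ^ n \<in> K" for n using x K_closed(9) by blast
  define R where "R y r \<longleftrightarrow> (\<exists>n. N (y * x ^ n) / t ^ n \<le> r)" for y r
  define S where "S = (\<lambda>x. if x \<in> K then Inf {r. R x r} else 0)"
  have nnR: "0 \<le> r" if "R y r" for y r
    using that t seminorm_nonneg[OF N] unfolding R_def by (meson divide_nonneg_pos order_trans zero_less_power)
  have S: "seminorm S \<and> (\<forall>y r. y \<in> K \<longrightarrow> R y r \<longrightarrow> S y \<le> r)"
    unfolding S_def
  proof (rule seminorm_Inf)
    show "\<exists>r. R y r" for y by (auto simp: R_def)
    show "0 \<le> r" if "R y r" for y r using nnR[OF that] .
    fix y z r s assume yz: "y \<in> K" "z \<in> K" and Rr: "R y r" "R z s"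
    then obtain n m where n: "N (y * x ^ n) / t ^ n \<le> r" and m: "N (z * x ^ m) / t ^ m \<le> s"
      unfolding R_def by blast
    have yzK: "y * x ^ n \<in> K" "z * x ^ m \<in> K" using yz xn K_closed(5) by auto
    show "R (y * z) (r * s)" unfolding R_def
    proof
      have "N (y * z * x ^ (n + m)) \<le> N (y * x ^ n) * N (z * x ^ m)"
        using seminormD(3)[OF N yzK] by (simp add: power_add mult_ac)
      then have "N (y * z * x ^ (n + m)) / t ^ (n + m) \<le> (N (y * x ^ n) / t ^ n) * (N (z * x ^ m) / t ^ m)"
        using t by (simp add: power_add divide_right_mono)
      also have "\<dots> \<le> r * s" using n m t nnR[OF Rr(1)] seminorm_nonneg[OF N] by (intro mult_mono) auto
      finally show "N (y * z * x ^ (n + m)) / t ^ (n + m) \<le> r * s" .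
    qed
    show "R (y + z) (max r s)" unfolding R_def
    proof
      have "N ((y + z) * x ^ (n + m)) = N (y * x ^ n * x ^ m + z * x ^ m * x ^ n)"
        by (simp add: power_add algebra_simps)
      also have "\<dots> \<le> max (N (y * x ^ n * x ^ m)) (N (z * x ^ m * x ^ n))"
        using seminormD(4)[OF N] yzK xn K_closed(5) by blast
      also have "\<dots> \<le> max r s * t ^ (n + m)"
      proof (rule max.boundedI)
        have "N (y * x ^ n * x ^ m) \<le> N (y * x ^ n) * t ^ m" using seminormD(3)[OF N yzK(1) xn] pw by simp
        also have "\<dots> \<le> (r * t ^ n) * t ^ m" using n t by (intro mult_right_mono) (auto simp: field_simps)
        also have "\<dots> \<le> max r s * t ^ (n + m)" using t by (simp add: power_add mult_right_mono)
        finally show "N (y * x ^ n * x ^ m) \<le> max r s * t ^ (n + m)" .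
        have "N (z * x ^ m * x ^ n) \<le> N (z * x ^ m) * t ^ n" using seminormD(3)[OF N yzK(2) xn] pw by simp
        also have "\<dots> \<le> (s * t ^ m) * t ^ n" using m t by (intro mult_right_mono) (auto simp: field_simps)
        also have "\<dots> \<le> max r s * t ^ (n + m)" using t by (simp add: power_add mult_right_mono mult_ac)
        finally show "N (z * x ^ m * x ^ n) \<le> max r s * t ^ (n + m)" .
      qed
      finally show "N ((y + z) * x ^ (n + m)) / t ^ (n + m) \<le> max r s" using t by (simp add: divide_le_eq)
    qed
  next
    fix q s assume "\<pi> q < s"
    then show "R (of_rat q) s" using seminormD(5)[OF N, of q] unfolding R_def by (intro exI[of _ 0]) auto
  next
    fix r assume "R 1 r" then show "1 \<le> r" using t pw by (auto simp: R_def)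
  qed
  have R0: "R y (N y)" for y unfolding R_def by (rule exI[of _ 0]) simp
  then have SN: "S = N" using min S by (auto simp: minimal_seminorm_def)
  have "R y (N (y * x) / t)" unfolding R_def by (rule exI[of _ 1]) simp
  then have "N y \<le> N (y * x) / t" using S y SN by auto
  then have "N y * N x \<le> N (y * x)" using t by (simp add: t_def field_simps)
  then show ?thesis using seminormD(3)[OF N y x] by simp
qed (use seminorm_0 min in \<open>auto simp: minimal_seminorm_def\<close>)

end

context padic begin

abbreviation gauss_weight :: "real \<Rightarrow> rat poly \<Rightarrow> nat \<Rightarrow> real" where
  "gauss_weight \<rho> f i \<equiv> \<pi> (coeff f i) * \<rho> ^ i"

lemma last_maximal_weight:
  assumes "f \<noteq> 0" "\<rho> > 0"
  obtains i where "gauss_weight \<rho> f i > 0" "\<And>j. gauss_weight \<rho> f j \<le> gauss_weight \<rho> f i"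
    "\<And>j. j > i \<Longrightarrow> gauss_weight \<rho> f j < gauss_weight \<rho> f i"
proof -
  define W where "W = gauss_weight \<rho> f"
  define M where "M = Max (W ` {..degree f})"
  define i where "i = Max {j. j \<le> degree f \<and> W j = M}"
  have "M \<in> W ` {..degree f}" unfolding M_def by (rule Max_in) auto
  then have "i \<in> {j. j \<le> degree f \<and> W j = M}" unfolding i_def by (intro Max_in) auto
  then have i: "i \<le> degree f" "W i = M" by auto
  have le: "W j \<le> M" if "j \<le> degree f" for j unfolding M_def using that by (intro Max_ge) auto
  have "W (degree f) > 0" using assms by (auto simp: W_def intro!: mult_pos_pos padic_pos)
  then have M: "M > 0" using le[of "degree f"] by simp
  have big: "W j = 0" if "j > degree f" for j using that by (simp add: W_def coeff_eq_0)
  have le': "W j \<le> M" for j using le[of j] big[of j] M by (cases "j \<le> degree f") auto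
  have "W j < M" if "j > i" for j
  proof (cases "j \<le> degree f")
    case True
    have "W j \<noteq> M"
    proof
      assume "W j = M"
      then have "j \<le> i" unfolding i_def using True by (intro Max_ge) auto
      then show False using that by simp
    qed
    then show ?thesis using le'[of j] by (simp add: le_less)
  qed (use big M in simp)
  then show ?thesis using that[of i] M le' i(2) unfolding W_def by simp
qed

lemma padic_sum_less: "finite A \<Longrightarrow> (\<And>i. i \<in> A \<Longrightarrow> \<pi> (f i) < B) \<Longrightarrow> 0 < B \<Longrightarrow> \<pi> (\<Sum>i\<in>A. f i) < B"
proof (induction A rule: finite_induct)
  case (insert x F)
  then show ?case using padic_add[of "f x" "sum f F"] by (force intro: le_less_trans)
qed auto

lemma mult_le_less:
  assumes "0 \<le> x" "x \<le> B" "0 < B" "0 \<le> y" "y < (C::real)" shows "x * y < B * C"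
proof -
  have "x * y \<le> B * y" using assms by (intro mult_right_mono) auto
  also have "\<dots> < B * C" using assms by (intro mult_strict_left_mono) auto
  finally show ?thesis .
qed

text \<open>As in Gauss's lemma, in the coefficient of index \<open>i + j\<close> the product of the two last maximal terms dominates.\<close>
lemma gauss_weight_mult_last:
  assumes \<rho>: "\<rho> > 0"
    and i: "gauss_weight \<rho> f i > 0" "\<And>k. gauss_weight \<rho> f k \<le> gauss_weight \<rho> f i"
      "\<And>k. k > i \<Longrightarrow> gauss_weight \<rho> f k < gauss_weight \<rho> f i"
    and j: "gauss_weight \<rho> g j > 0" "\<And>k. gauss_weight \<rho> g k \<le> gauss_weight \<rho> g j"
      "\<And>k. k > j \<Longrightarrow> gauss_weight \<rho> g k < gauss_weight \<rho> g j"
  shows "gauss_weight \<rho> f i * gauss_weight \<rho> g j \<le> gauss_weight \<rho> (f * g) (i + j)"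
proof -
  define t where "t k = coeff f k * coeff g (i + j - k)" for k
  define S where "S = (\<Sum>k\<in>{..i + j} - {i}. t k)"
  have split: "\<pi> (t k) * \<rho> ^ (i + j) = gauss_weight \<rho> f k * gauss_weight \<rho> g (i + j - k)" if "k \<le> i + j" for k
    using that by (simp add: t_def padic_mult mult_ac flip: power_add)
  have main: "\<pi> (t i) * \<rho> ^ (i + j) = gauss_weight \<rho> f i * gauss_weight \<rho> g j" using split[of i] by simp
  have "\<pi> (t k) < \<pi> (t i)" if "k \<in> {..i + j} - {i}" for k
  proof -
    have nn: "0 \<le> gauss_weight \<rho> f k" "0 \<le> gauss_weight \<rho> g (i + j - k)" using \<rho> by auto
    have "gauss_weight \<rho> f k * gauss_weight \<rho> g (i + j - k) < gauss_weight \<rho> f i * gauss_weight \<rho> g j"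
    proof (cases "k < i")
      case True
      then have "gauss_weight \<rho> g (i + j - k) < gauss_weight \<rho> g j" by (intro j(3)) auto
      then show ?thesis by (rule mult_le_less[OF nn(1) i(2) i(1) nn(2)])
    next
      case False
      then have "gauss_weight \<rho> f k < gauss_weight \<rho> f i" using that by (intro i(3)) auto
      then show ?thesis using mult_le_less[OF nn(2) j(2) j(1) nn(1)] by (simp only: mult.commute)
    qed
    then have "\<pi> (t k) * \<rho> ^ (i + j) < \<pi> (t i) * \<rho> ^ (i + j)" using split main that by simp
    then show ?thesis using \<rho> by simp
  qed
  moreover have ti: "\<pi> (t i) > 0"
    using main i(1) j(1) \<rho> by (metis mult_pos_pos zero_less_mult_pos2 zero_less_power)
  ultimately have S: "\<pi> S < \<pi> (t i)" unfolding S_def by (intro padic_sum_less) auto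
  have c: "coeff (f * g) (i + j) = t i + S"
  proof -
    have "(\<Sum>k\<le>i + j. t k) = t i + S" unfolding S_def by (rule sum.remove) auto
    then show ?thesis by (simp add: coeff_mult t_def)
  qed
  have "\<pi> (t i) \<le> max (\<pi> (t i + S)) (\<pi> (- S))" using padic_add[of "t i + S" "- S"] by simp
  then have "\<pi> (t i) \<le> \<pi> (t i + S)" using S by (simp add: le_max_iff_disj)
  then have "\<pi> (t i) * \<rho> ^ (i + j) \<le> \<pi> (t i + S) * \<rho> ^ (i + j)" using \<rho> by (intro mult_right_mono) auto
  then show ?thesis using main c by simp
qed

end

text \<open>A prime dividing the constant coefficient should have a place at which the root is small.\<close>
locale small_root = minimal_poly a Q + padic p for a Q p +
  assumes p_dvd: "int p dvd coeff Q 0"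
begin

text \<open>The initial seminorm is the quotient of a Gauss norm of radius \<open>\<rho>\<close>. The radius is below \<open>1\<close>, to make \<open>a\<close> small, but so
  close to \<open>1\<close> that the constant coefficient of \<open>Q\<close>, of value at most \<open>1/p\<close>, does not outweigh a unit coefficient.\<close>
definition "\<rho> = root n (1 / real p)"

lemma rho: "0 < \<rho>" "\<rho> < 1" "\<rho> ^ n = 1 / real p"
  using degree_pos p_gt_1 by (auto simp: \<rho>_def)

text \<open>Write \<open>1 - f = P * g\<close>. The last maximal weight of \<open>P\<close> has positive index, hence so has that of the product. But if all
  weights of \<open>f\<close> are below \<open>1\<close>, then \<open>1 - f\<close> has its maximal weight at the index \<open>0\<close> only.\<close>
lemma no_small_one:
  assumes f: "rpoly f a = 1" "\<And>i. gauss_weight \<rho> f i \<le> r"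
  shows "1 \<le> r"
proof (rule ccontr)
  assume "\<not> 1 \<le> r"
  then have r: "r < 1" by simp
  have f0: "\<pi> (coeff f 0) < 1" using f(2)[of 0] r by simp
  have "P dvd 1 - f" using f(1) by (intro dvd) simp
  then obtain g where g: "1 - f = P * g" by (elim dvdE)
  have "1 - f \<noteq> 0"
  proof
    assume "1 - f = 0"
    then have "f = 1" by simp
    then show False using f0 by simp
  qed
  then have g0: "g \<noteq> 0" using g by auto
  obtain i where i: "gauss_weight \<rho> P i > 0" "\<And>k. gauss_weight \<rho> P k \<le> gauss_weight \<rho> P i"
      "\<And>k. k > i \<Longrightarrow> gauss_weight \<rho> P k < gauss_weight \<rho> P i"
    using last_maximal_weight[OF P_nz rho(1)] by blast
  obtain j where j: "gauss_weight \<rho> g j > 0" "\<And>k. gauss_weight \<rho> g k \<le> gauss_weight \<rho> g j"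
      "\<And>k. k > j \<Longrightarrow> gauss_weight \<rho> g k < gauss_weight \<rho> g j"
    using last_maximal_weight[OF g0 rho(1)] by blast
  have "i \<noteq> 0"
  proof
    assume "i = 0"
    obtain k where k: "\<not> int p dvd coeff Q k"
    proof (rule ccontr)
      assume "\<not> thesis"
      then have "\<And>k. int p dvd coeff Q k" using that by blast
      then have "[:int p:] dvd Q" by (simp add: const_poly_dvd_iff)
      then have "int p dvd content Q" by (simp add: const_poly_dvd_iff_dvd_content)
      then show False using content_1 p_gt_1 by simp
    qed
    then have kn: "k \<le> n" by (metis coeff_eq_0 dvd_0_right not_le)
    have "gauss_weight \<rho> P k = \<rho> ^ k" using k by (simp add: coeff_P padic_int_1_iff[THEN iffD2])
    moreover have "1 / real p \<le> \<rho> ^ k" using rho kn power_decreasing[of k n \<rho>] by simp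
    moreover have "gauss_weight \<rho> P 0 \<le> 1 / real p"
      using padic_le_power_dvd[of 1 "coeff Q 0"] p_dvd by (simp add: coeff_P)
    moreover have "k > 0" using k p_dvd by (cases k) auto
    ultimately show False using i(3)[of k] unfolding \<open>i = 0\<close> by linarith
  qed
  have "gauss_weight \<rho> P i * gauss_weight \<rho> g j \<le> gauss_weight \<rho> (1 - f) (i + j)"
    unfolding g by (rule gauss_weight_mult_last[OF rho(1) i j])
  also have "\<dots> = gauss_weight \<rho> f (i + j)" using \<open>i \<noteq> 0\<close> by simp
  finally have small: "gauss_weight \<rho> P i * gauss_weight \<rho> g j < 1" using f(2)[of "i + j"] r by simp
  have "1 \<le> max (\<pi> (1 - coeff f 0)) (\<pi> (coeff f 0))" using padic_add[of "1 - coeff f 0" "coeff f 0"] by simp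
  then have "1 \<le> \<pi> (coeff (1 - f) 0)" using f0 by (simp add: le_max_iff_disj)
  also have "\<dots> = gauss_weight \<rho> P 0 * gauss_weight \<rho> g 0" unfolding g by (simp add: coeff_mult padic_mult)
  also have "\<dots> \<le> gauss_weight \<rho> P i * gauss_weight \<rho> g j"
    by (rule mult_mono[OF i(2) j(2)]) (use i(1) rho(1) in auto)
  finally show False using small by simp
qed

sublocale padic_field p "adjoin a"
  by (intro padic_field.intro padic_field_axioms.intro subfield_adjoin padic_axioms)

lemma ex_initial_seminorm: "\<exists>N. seminorm N \<and> N a \<le> \<rho>"
proof -
  define R where "R x r \<longleftrightarrow> (\<exists>f. rpoly f a = x \<and> (\<forall>i. gauss_weight \<rho> f i \<le> r))" for x r
  define N where "N = (\<lambda>x. if x \<in> adjoin a then Inf {r. R x r} else 0)"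
  have nn: "0 \<le> r" if "R x r" for x r
    using that rho(1) unfolding R_def by (metis mult_nonneg_nonneg order_trans padic_nonneg zero_le_power less_imp_le)
  have "seminorm N \<and> (\<forall>x r. x \<in> adjoin a \<longrightarrow> R x r \<longrightarrow> N x \<le> r)"
    unfolding N_def
  proof (rule seminorm_Inf)
    fix x assume "x \<in> adjoin a"
    then obtain f where f: "degree f < n" "x = rpoly f a" by (rule adjoin_elem)
    have "gauss_weight \<rho> f i \<le> (\<Sum>j\<le>degree f. gauss_weight \<rho> f j)" for i
    proof (cases "i \<le> degree f")
      case True
      then show ?thesis using rho(1) by (intro member_le_sum) auto
    next
      case False
      then show ?thesis using rho(1) by (simp add: coeff_eq_0 sum_nonneg)
    qed
    then show "\<exists>r. R x r" using f unfolding R_def by blast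
  next
    show "0 \<le> r" if "R x r" for x r using nn[OF that] .
    fix x y r s assume Rr: "R x r" "R y s"
    then obtain f g where f: "rpoly f a = x" "\<And>i. gauss_weight \<rho> f i \<le> r"
      and g: "rpoly g a = y" "\<And>i. gauss_weight \<rho> g i \<le> s" unfolding R_def by blast
    have "gauss_weight \<rho> (f * g) k \<le> r * s" for k
    proof -
      have "\<pi> (coeff (f * g) k) \<le> r * s / \<rho> ^ k"
        unfolding coeff_mult
      proof (rule padic_sum_le)
        fix i assume i: "i \<in> {..k}"
        have "gauss_weight \<rho> f i * gauss_weight \<rho> g (k - i) \<le> r * s"
          using f g nn[OF Rr(1)] rho(1) by (intro mult_mono) auto
        also have "gauss_weight \<rho> f i * gauss_weight \<rho> g (k - i) = \<pi> (coeff f i * coeff g (k - i)) * \<rho> ^ k"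
          using i by (simp add: padic_mult mult_ac flip: power_add)
        finally show "\<pi> (coeff f i * coeff g (k - i)) \<le> r * s / \<rho> ^ k"
          using rho(1) by (simp add: le_divide_eq)
      qed (use nn[OF Rr(1)] nn[OF Rr(2)] rho(1) in auto)
      then show ?thesis using rho(1) by (simp add: le_divide_eq)
    qed
    then show "R (x * y) (r * s)" unfolding R_def using f g by (intro exI[of _ "f * g"]) auto
    have "gauss_weight \<rho> (f + g) k \<le> max r s" for k
    proof -
      have "gauss_weight \<rho> (f + g) k \<le> max (\<pi> (coeff f k)) (\<pi> (coeff g k)) * \<rho> ^ k"
        using padic_add rho(1) by (intro mult_right_mono) auto
      also have "\<dots> \<le> max r s" using f(2)[of k] g(2)[of k] by (auto simp: max_def)
      finally show ?thesis .
    qed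
    then show "R (x + y) (max r s)" unfolding R_def using f g by (intro exI[of _ "f + g"]) auto
  next
    fix q s assume "\<pi> q < s"
    moreover from this have "0 < s" using padic_nonneg[of q] by linarith
    ultimately show "R (of_rat q) s" unfolding R_def
      by (intro exI[of _ "[:q:]"]) (auto simp: coeff_pCons split: nat.split)
  next
    fix r assume "R 1 r" then show "1 \<le> r" unfolding R_def using no_small_one by blast
  qed
  moreover have "R a \<rho>" unfolding R_def
    using rho by (intro exI[of _ "[:0, 1:]"]) (auto simp: coeff_pCons split: nat.split)
  ultimately show ?thesis using adjoin_self by blast
qed

theorem ex_place_root_small:
  "\<exists>v. v \<in> extensional (adjoin a) \<and> absolute_value_on (adjoin a) v \<and> (\<forall>q. v (of_rat q) = \<pi> q) \<and> v a < 1"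
proof -
  obtain N0 where N0: "seminorm N0" "N0 a \<le> \<rho>" using ex_initial_seminorm by blast
  obtain N where N: "minimal_seminorm N" "\<And>x. N x \<le> N0 x" using ex_minimal_seminorm[OF N0(1)] by blast
  have sn: "seminorm N" using N(1) by (simp add: minimal_seminorm_def)
  define v where "v = restrict N (adjoin a)"
  have "absolute_value_on (adjoin a) v" unfolding absolute_value_on_def
  proof (intro conjI ballI)
    fix x y assume xy: "x \<in> adjoin a" "y \<in> adjoin a"
    show "0 \<le> v x" using xy seminorm_nonneg[OF sn] by (simp add: v_def)
    show "v x = 0 \<longleftrightarrow> x = 0" using xy seminorm_0[OF sn] seminorm_pos[OF sn xy(1)] by (cases "x = 0") (simp_all add: v_def)
    show "v (x * y) = v x * v y" using xy K_closed(5) minimal_mult[OF N(1)] by (simp add: v_def)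
    show "v (x + y) \<le> v x + v y"
      using xy K_closed(3) seminormD(4)[OF sn xy] seminorm_nonneg[OF sn, of x] seminorm_nonneg[OF sn, of y]
      by (simp add: v_def)
  qed
  moreover have "v (of_rat q) = \<pi> q" for q using K_closed(10) seminorm_rat[OF sn] by (simp add: v_def)
  moreover have "v a < 1" using adjoin_self N(2)[of a] N0(2) rho(2) by (simp add: v_def)
  ultimately show ?thesis by (intro exI[of _ v]) (auto simp: v_def)
qed

end

section \<open>Local degrees\<close>

context abs_val begin

abbreviation "CS \<equiv> cauchy_seqs K v"
abbreviation "NS \<equiv> null_seqs K v"
abbreviation "CR \<equiv> cauchy_ring K v"
abbreviation "KV \<equiv> completion K v"
abbreviation "QV \<equiv> rat_completion K v"

lemma CS_iff: "x \<in> cauchy_seqs F v \<longleftrightarrow> (\<forall>n. x n \<in> F) \<and> (\<forall>e>0. \<exists>N. \<forall>m\<ge>N. \<forall>n\<ge>N. v (x m - x n) < e)"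
  by (auto simp: cauchy_seqs_def)

lemma CSD: "x \<in> cauchy_seqs F v \<Longrightarrow> x n \<in> F"
  "x \<in> cauchy_seqs F v \<Longrightarrow> e > 0 \<Longrightarrow> \<exists>N. \<forall>m\<ge>N. \<forall>n\<ge>N. v (x m - x n) < e"
  by (auto simp: CS_iff)

lemma NS_iff: "x \<in> NS \<longleftrightarrow> (\<forall>n. x n \<in> K) \<and> (\<forall>e>0. \<exists>N. \<forall>n\<ge>N. v (x n) < e)"
proof -
  have "(\<lambda>n. v (x n)) \<longlonglongrightarrow> 0 \<longleftrightarrow> (\<forall>e>0. \<exists>N. \<forall>n\<ge>N. v (x n) < e)" if "\<forall>n. x n \<in> K"
    using that v_nonneg by (simp add: LIMSEQ_iff)
  then show ?thesis by (auto simp: null_seqs_def)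
qed

lemma NS_subset: "NS \<subseteq> CS"
proof
  fix x assume x: "x \<in> NS"
  show "x \<in> CS" unfolding CS_iff
  proof (intro conjI allI impI)
    fix e :: real assume "e > 0"
    then obtain N where N: "\<And>n. n \<ge> N \<Longrightarrow> v (x n) < e / 2" using x half_gt_zero unfolding NS_iff by meson
    have "v (x m - x n) < e" if "m \<ge> N" "n \<ge> N" for m n
      using v_diff[of "x m" "x n"] N[OF that(1)] N[OF that(2)] x unfolding NS_iff by fastforce
    then show "\<exists>N. \<forall>m\<ge>N. \<forall>n\<ge>N. v (x m - x n) < e" by blast
  qed (use x in \<open>auto simp: NS_iff\<close>)
qed

lemma CS_mono: "F \<subseteq> K \<Longrightarrow> cauchy_seqs F v \<subseteq> CS"
  by (auto simp: cauchy_seqs_def)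

lemma CS_const: "c \<in> F \<Longrightarrow> (\<lambda>_. c) \<in> cauchy_seqs F v"
  by (auto simp: CS_iff)

lemma CS_bounded:
  assumes "F \<subseteq> K" "x \<in> cauchy_seqs F v"
  shows "\<exists>B>0. \<forall>n. v (x n) \<le> B"
proof -
  have xK: "x n \<in> K" for n using CSD(1)[OF assms(2)] assms(1) by blast
  obtain N where N: "\<And>n. n \<ge> N \<Longrightarrow> v (x n - x N) < 1" using CSD(2)[OF assms(2), of 1] by auto
  define B where "B = 1 + v (x N) + (\<Sum>n<N. v (x n))"
  have S: "(\<Sum>n<N. v (x n)) \<ge> 0" using xK v_nonneg by (intro sum_nonneg) auto
  have "v (x n) \<le> B" for n
  proof (cases "n < N")
    case True
    then have "v (x n) \<le> (\<Sum>n<N. v (x n))" using xK v_nonneg by (intro member_le_sum) auto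
    then show ?thesis using v_nonneg[OF xK] by (simp add: B_def add_increasing)
  next
    case False
    then show ?thesis using N[of n] v_diff_ge[OF xK xK, of n N] S by (simp add: B_def)
  qed
  moreover have "B > 0" using S v_nonneg[OF xK, of N] by (simp add: B_def)
  ultimately show ?thesis by blast
qed

lemma CS_add:
  assumes F: "subfield F \<CC>" "F \<subseteq> K" and x: "x \<in> cauchy_seqs F v" and y: "y \<in> cauchy_seqs F v"
  shows "(\<lambda>n. x n + y n) \<in> cauchy_seqs F v"
  unfolding CS_iff
proof (intro conjI allI impI)
  show "x n + y n \<in> F" for n using subfield_CC_D(3)[OF F(1)] CSD(1) x y by blast
  fix e :: real assume "e > 0"
  then obtain N M where N: "\<And>m n. n \<ge> N \<Longrightarrow> m \<ge> N \<Longrightarrow> v (x m - x n) < e / 2"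
    and M: "\<And>m n. n \<ge> M \<Longrightarrow> m \<ge> M \<Longrightarrow> v (y m - y n) < e / 2"
    using CSD(2)[OF x] CSD(2)[OF y] half_gt_zero by meson
  have K: "x n \<in> K" "y n \<in> K" for n using CSD(1)[OF x] CSD(1)[OF y] F(2) by auto
  have "v ((x m + y m) - (x n + y n)) < e" if "m \<ge> max N M" "n \<ge> max N M" for m n
  proof -
    have "(x m + y m) - (x n + y n) = (x m - x n) + (y m - y n)" by simp
    then have "v ((x m + y m) - (x n + y n)) \<le> v (x m - x n) + v (y m - y n)"
      using v_add K_closed(7)[OF K(1) K(1)] K_closed(7)[OF K(2) K(2)] by metis
    then show ?thesis using N[of n m] M[of n m] that by simp
  qed
  then show "\<exists>N. \<forall>m\<ge>N. \<forall>n\<ge>N. v ((x m + y m) - (x n + y n)) < e" by blast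
qed

lemma CS_mult:
  assumes F: "subfield F \<CC>" "F \<subseteq> K" and x: "x \<in> cauchy_seqs F v" and y: "y \<in> cauchy_seqs F v"
  shows "(\<lambda>n. x n * y n) \<in> cauchy_seqs F v"
  unfolding CS_iff
proof (intro conjI allI impI)
  show "x n * y n \<in> F" for n using subfield_CC_D(5)[OF F(1)] CSD(1) x y by blast
  obtain A B where A: "A > 0" "\<And>n. v (x n) \<le> A" and B: "B > 0" "\<And>n. v (y n) \<le> B"
    using CS_bounded[OF F(2)] x y by metis
  fix e :: real assume e: "e > 0"
  obtain N M where N: "\<And>m n. n \<ge> N \<Longrightarrow> m \<ge> N \<Longrightarrow> v (x m - x n) < e / (2 * B)"
    and M: "\<And>m n. n \<ge> M \<Longrightarrow> m \<ge> M \<Longrightarrow> v (y m - y n) < e / (2 * A)"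
    using CSD(2)[OF x, of "e / (2 * B)"] CSD(2)[OF y, of "e / (2 * A)"] e A(1) B(1) by (meson divide_pos_pos mult_pos_pos zero_less_numeral)
  have K: "x n \<in> K" "y n \<in> K" for n using CSD(1)[OF x] CSD(1)[OF y] F(2) by auto
  have "v (x m * y m - x n * y n) < e" if "m \<ge> max N M" "n \<ge> max N M" for m n
  proof -
    have d: "x m - x n \<in> K" "y m - y n \<in> K" using K K_closed(7) by auto
    have "x m * y m - x n * y n = x m * (y m - y n) + (x m - x n) * y n" by (simp add: algebra_simps)
    then have "v (x m * y m - x n * y n) \<le> v (x m) * v (y m - y n) + v (x m - x n) * v (y n)"
      using v_add[OF K_closed(5)[OF K(1) d(2)] K_closed(5)[OF d(1) K(2)]] v_mult d K by metis
    also have "\<dots> \<le> A * v (y m - y n) + v (x m - x n) * B"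
      using A B v_nonneg d by (intro add_mono mult_left_mono mult_right_mono) auto
    also have "\<dots> < A * (e / (2 * A)) + (e / (2 * B)) * B"
      using N[of n m] M[of n m] that A(1) B(1) by (intro add_strict_mono mult_strict_left_mono mult_strict_right_mono) auto
    also have "\<dots> = e" using A(1) B(1) by simp
    finally show ?thesis .
  qed
  then show "\<exists>N. \<forall>m\<ge>N. \<forall>n\<ge>N. v (x m * y m - x n * y n) < e" by blast
qed

text \<open>A Cauchy sequence that is not null stays away from \<open>0\<close> eventually. The statement is for a subfield \<open>F\<close> since it is needed
  for \<open>K\<close>, to see that the completion is a field, and for \<open>\<rat>\<close>, to see that the closure of \<open>\<rat>\<close> is one.\<close>
lemma CS_inverse:
  assumes F: "subfield F \<CC>" "F \<subseteq> K" and x: "x \<in> cauchy_seqs F v" and nn: "x \<notin> NS"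
  shows "\<exists>y \<in> cauchy_seqs F v. (\<lambda>n. x n * y n - 1) \<in> NS"
proof
  have xF: "x n \<in> F" for n using CSD(1) x by blast
  have xK: "x n \<in> K" for n using CSD(1)[OF x] F(2) by auto
  obtain e where e: "e > 0" "\<And>N. \<exists>n\<ge>N. v (x n) \<ge> e"
    using nn xK unfolding NS_iff by (meson not_less)
  obtain N where N: "\<And>m n. n \<ge> N \<Longrightarrow> m \<ge> N \<Longrightarrow> v (x m - x n) < e / 2" using CSD(2)[OF x, of "e / 2"] e(1) by auto
  obtain k where k: "k \<ge> N" "v (x k) \<ge> e" using e(2) by blast
  have big: "v (x n) \<ge> e / 2" if "n \<ge> N" for n
    using v_diff_ge[OF xK xK, of k n] N[OF that k(1)] k(2) by simp
  then have nz: "x n \<noteq> 0" if "n \<ge> N" for n using that e(1) by fastforce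
  define y where "y n = inverse (x n)" for n
  show "y \<in> cauchy_seqs F v" unfolding CS_iff
  proof (intro conjI allI impI)
    show "y n \<in> F" for n using subfield_CC_D(6)[OF F(1) xF] by (simp add: y_def)
    fix d :: real assume d: "d > 0"
    have "d * (e / 2)^2 > 0" using d e(1) by simp
    then obtain M where M: "\<And>m n. n \<ge> M \<Longrightarrow> m \<ge> M \<Longrightarrow> v (x m - x n) < d * (e / 2)^2" using CSD(2)[OF x] by blast
    have "v (y m - y n) < d" if mn: "m \<ge> max N M" "n \<ge> max N M" for m n
    proof -
      have "y m - y n = (x n - x m) / (x m * x n)" using nz mn by (simp add: y_def field_simps)
      then have "v (y m - y n) = v (x n - x m) / (v (x m) * v (x n))"
        using xK K_closed(5,7) by (simp add: v_divide v_mult)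
      also have "\<dots> \<le> v (x n - x m) / (e / 2)^2"
      proof (rule divide_left_mono)
        show "(e / 2)\<^sup>2 \<le> v (x m) * v (x n)"
          unfolding power2_eq_square using e(1) big mn v_nonneg[OF xK] by (intro mult_mono) auto
        moreover have "0 < (e / 2)\<^sup>2" using e(1) by simp
        ultimately show "0 < v (x m) * v (x n) * (e / 2)\<^sup>2"
          by (intro mult_pos_pos[of "v (x m) * v (x n)"]) linarith
      qed (use xK K_closed(7) v_nonneg in auto)
      also have "\<dots> < d" using M[of m n] mn e(1) by (simp add: divide_less_eq)
      finally show ?thesis .
    qed
    then show "\<exists>N. \<forall>m\<ge>N. \<forall>n\<ge>N. v (y m - y n) < d" by blast
  qed
  show "(\<lambda>n. x n * y n - 1) \<in> NS" unfolding NS_iff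
  proof (intro conjI allI impI)
    show "x n * y n - 1 \<in> K" for n using xK K_closed by (simp add: y_def)
    fix d :: real assume "d > 0"
    then have "\<forall>n\<ge>N. v (x n * y n - 1) < d" using nz by (simp add: y_def)
    then show "\<exists>N. \<forall>n\<ge>N. v (x n * y n - 1) < d" by blast
  qed
qed

lemma NS_add: assumes "x \<in> NS" "y \<in> NS" shows "(\<lambda>n. x n + y n) \<in> NS"
  unfolding NS_iff
proof (intro conjI allI impI)
  have K: "x n \<in> K" "y n \<in> K" for n using assms by (auto simp: NS_iff)
  then show "x n + y n \<in> K" for n using K_closed(3) by blast
  fix e :: real assume "e > 0"
  then obtain N M where N: "\<And>n. n \<ge> N \<Longrightarrow> v (x n) < e / 2" and M: "\<And>n. n \<ge> M \<Longrightarrow> v (y n) < e / 2"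
    using assms half_gt_zero unfolding NS_iff by meson
  have "v (x n + y n) < e" if "n \<ge> max N M" for n
    using v_add[OF K, of n n] N[of n] M[of n] that by simp
  then show "\<exists>N. \<forall>n\<ge>N. v (x n + y n) < e" by blast
qed

lemma NS_mult: assumes "x \<in> CS" "y \<in> NS" shows "(\<lambda>n. x n * y n) \<in> NS"
  unfolding NS_iff
proof (intro conjI allI impI)
  have K: "x n \<in> K" "y n \<in> K" for n using assms by (auto simp: NS_iff CS_iff)
  then show "x n * y n \<in> K" for n using K_closed(5) by blast
  obtain B where B: "B > 0" "\<And>n. v (x n) \<le> B" using CS_bounded[OF order_refl assms(1)] by blast
  fix e :: real assume "e > 0"
  then obtain N where N: "\<And>n. n \<ge> N \<Longrightarrow> v (y n) < e / B"
    using assms(2) B(1) unfolding NS_iff by (meson divide_pos_pos)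
  have "v (x n * y n) < e" if "n \<ge> N" for n
  proof -
    have "v (x n * y n) \<le> B * v (y n)" using B v_nonneg K by (simp add: v_mult mult_right_mono)
    also have "\<dots> < B * (e / B)" using N[OF that] B(1) by (intro mult_strict_left_mono)
    finally show ?thesis using B(1) by simp
  qed
  then show "\<exists>N. \<forall>n\<ge>N. v (x n * y n) < e" by blast
qed

lemma CR_simps [simp]: "carrier CR = CS" "mult CR = (\<lambda>x y n. x n * y n)" "one CR = (\<lambda>_. 1)"
  "zero CR = (\<lambda>_. 0)" "add CR = (\<lambda>x y n. x n + y n)"
  by (simp_all add: cauchy_ring_def)

lemma CS_minus:
  assumes F: "subfield F \<CC>" "F \<subseteq> K" and x: "x \<in> cauchy_seqs F v"
  shows "(\<lambda>n. - x n) \<in> cauchy_seqs F v"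
  using CS_mult[OF F CS_const[of "-1"] x] subfield_CC_D(2,4)[OF F(1)] by simp

lemma cring_CR: "cring CR"
proof (rule cringI)
  note CSK = CS_add[OF K order_refl] CS_mult[OF K order_refl] CS_minus[OF K order_refl] CS_const K_closed(1,2)
  show "abelian_group CR"
  proof (rule abelian_groupI)
    fix x assume "x \<in> carrier CR"
    then show "\<exists>y\<in>carrier CR. y \<oplus>\<^bsub>CR\<^esub> x = \<zero>\<^bsub>CR\<^esub>"
      by (intro bexI[of _ "\<lambda>n. - x n"]) (auto simp: CSK)
  qed (auto simp: CSK add_ac)
  show "comm_monoid CR" by (rule comm_monoidI) (auto simp: CSK mult_ac)
qed (auto simp: algebra_simps)

lemma CR_a_inv: "x \<in> CS \<Longrightarrow> a_inv CR x = (\<lambda>n. - x n)"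
proof -
  interpret cring CR by (rule cring_CR)
  assume x: "x \<in> CS"
  then show ?thesis using CS_minus[OF K order_refl x] by (intro minus_equality) auto
qed

lemma ideal_NS: "ideal NS CR"
proof (rule idealI)
  interpret cring CR by (rule cring_CR)
  show "ring CR" by (rule ring_axioms)
  show "subgroup NS (add_monoid CR)"
  proof (rule group.subgroupI)
    show "group (add_monoid CR)" by (rule a_group)
    show "NS \<subseteq> carrier (add_monoid CR)" using NS_subset by simp
    have "(\<lambda>_. 0) \<in> NS" using K_closed(1) by (simp add: NS_iff)
    then show "NS \<noteq> {}" by blast
    fix x y assume x: "x \<in> NS" and y: "y \<in> NS"
    have "(\<lambda>n. - x n) \<in> NS" using NS_mult[OF CS_const x, of "-1"] K_closed(2,4) by simp
    then show "inv\<^bsub>add_monoid CR\<^esub> x \<in> NS" using CR_a_inv[of x] NS_subset x by (auto simp: a_inv_def)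
    show "x \<otimes>\<^bsub>add_monoid CR\<^esub> y \<in> NS" using NS_add x y by simp
  qed
  fix x y assume "x \<in> NS" "y \<in> carrier CR"
  then have yx: "(\<lambda>n. y n * x n) \<in> NS" using NS_mult by simp
  have "(\<lambda>n. x n * y n) = (\<lambda>n. y n * x n)" by (rule ext) (rule mult.commute)
  then show "y \<otimes>\<^bsub>CR\<^esub> x \<in> NS" "x \<otimes>\<^bsub>CR\<^esub> y \<in> NS" using yx by simp_all
qed

definition cls :: "(nat \<Rightarrow> complex) \<Rightarrow> (nat \<Rightarrow> complex) set" where
  "cls x = NS +>\<^bsub>CR\<^esub> x"

lemma cls_hom: "ring_hom_ring CR (KV) cls"
  using ideal.rcos_ring_hom_ring[OF ideal_NS] unfolding completion_def cls_def .

lemma cring_completion: "cring (KV)"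
  using ideal.quotient_is_cring[OF ideal_NS cring_CR] unfolding completion_def .

lemma carrier_completion: "carrier (KV) = cls ` CS"
  unfolding completion_def FactRing_simps cls_def by auto

lemma rat_completion_eq: "QV = cls ` cauchy_seqs \<rat> v"
  unfolding rat_completion_def cls_def ..

lemma cls_eq_iff: "x \<in> CS \<Longrightarrow> y \<in> CS \<Longrightarrow> cls x = cls y \<longleftrightarrow> (\<lambda>n. x n - y n) \<in> NS"
proof -
  interpret cring CR by (rule cring_CR)
  assume xy: "x \<in> CS" "y \<in> CS"
  show ?thesis
    using quotient_eq_iff_same_a_r_cos[OF ideal_NS, of x y] xy CR_a_inv[OF xy(2)] by (simp add: cls_def a_minus_def)
qed

lemma cls_simps:
  "x \<in> CS \<Longrightarrow> y \<in> CS \<Longrightarrow> cls (\<lambda>n. x n + y n) = cls x \<oplus>\<^bsub>KV\<^esub> cls y"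
  "x \<in> CS \<Longrightarrow> y \<in> CS \<Longrightarrow> cls (\<lambda>n. x n * y n) = cls x \<otimes>\<^bsub>KV\<^esub> cls y"
  "cls (\<lambda>_. 1) = \<one>\<^bsub>KV\<^esub>" "cls (\<lambda>_. 0) = \<zero>\<^bsub>KV\<^esub>"
proof -
  interpret ring_hom_ring CR "KV" cls by (rule cls_hom)
  show "x \<in> CS \<Longrightarrow> y \<in> CS \<Longrightarrow> cls (\<lambda>n. x n + y n) = cls x \<oplus>\<^bsub>KV\<^esub> cls y"
    using hom_add[of x y] by simp
  show "x \<in> CS \<Longrightarrow> y \<in> CS \<Longrightarrow> cls (\<lambda>n. x n * y n) = cls x \<otimes>\<^bsub>KV\<^esub> cls y"
    using hom_mult[of x y] by simp
  show "cls (\<lambda>_. 1) = \<one>\<^bsub>KV\<^esub>" "cls (\<lambda>_. 0) = \<zero>\<^bsub>KV\<^esub>"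
    using hom_one hom_zero by simp_all
qed

lemma one_CS: "(\<lambda>_. 1) \<in> CS" "(\<lambda>_. 0) \<in> CS" using CS_const K_closed(1,2) by auto

lemma completion_inverse:
  assumes F: "subfield F \<CC>" "F \<subseteq> K" and x: "x \<in> cauchy_seqs F v" and nz: "cls x \<noteq> \<zero>\<^bsub>KV\<^esub>"
  shows "\<exists>y \<in> cauchy_seqs F v. cls x \<otimes>\<^bsub>KV\<^esub> cls y = \<one>\<^bsub>KV\<^esub>"
proof -
  have sub: "cauchy_seqs F v \<subseteq> CS" using F(2) by (rule CS_mono)
  have "x \<notin> NS" using nz cls_eq_iff[of x "\<lambda>_. 0"] x sub one_CS by (auto simp: cls_simps(4))
  then obtain y where y: "y \<in> cauchy_seqs F v" "(\<lambda>n. x n * y n - 1) \<in> NS"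
    using CS_inverse[OF F x] by blast
  have "cls (\<lambda>n. x n * y n) = cls (\<lambda>_. 1)"
    using y sub x one_CS CS_mult[OF F x y(1)] by (subst cls_eq_iff) auto
  then show ?thesis using y sub x cls_simps(2)[of x y] cls_simps(3) by (intro bexI[of _ y]) auto
qed

lemma completion_one_nz: "\<zero>\<^bsub>KV\<^esub> \<noteq> \<one>\<^bsub>KV\<^esub>"
proof
  assume "\<zero>\<^bsub>KV\<^esub> = \<one>\<^bsub>KV\<^esub>"
  then have "cls (\<lambda>_. 1) = cls (\<lambda>_. 0)" using cls_simps(3,4) by simp
  then have "(\<lambda>_. 1 - 0) \<in> NS" using cls_eq_iff[OF one_CS] by blast
  then show False by (auto simp: NS_iff dest!: spec[of _ 1])
qed

lemma field_completion: "Ring.field (KV)"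
proof (rule cring.cring_fieldI2[OF cring_completion completion_one_nz])
  fix x assume "x \<in> carrier (KV)" "x \<noteq> \<zero>\<^bsub>KV\<^esub>"
  then show "\<exists>b\<in>carrier (KV). x \<otimes>\<^bsub>KV\<^esub> b = \<one>\<^bsub>KV\<^esub>"
    using completion_inverse[OF K order_refl] by (auto simp: carrier_completion)
qed

lemma Rats_K: "\<rat> \<subseteq> K" using K_closed(10) by (auto simp: Rats_def)

lemma rat_CS: "cauchy_seqs \<rat> v \<subseteq> CS" using Rats_K by (rule CS_mono)

lemma subfield_rat_completion: "subfield (QV) (KV)"
proof (rule field.subfieldI'[OF field_completion])
  interpret F: field "KV" by (rule field_completion)
  interpret CR: cring CR by (rule cring_CR)
  interpret h: ring_hom_ring CR "KV" cls by (rule cls_hom)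
  note Q = CS_add[OF subfield_Rats Rats_K] CS_mult[OF subfield_Rats Rats_K] CS_minus[OF subfield_Rats Rats_K]
  have "subring (cauchy_seqs \<rat> v) CR"
    using rat_CS Q CS_const[of 1 \<rat>] by (intro CR.subringI) (auto simp: CR_a_inv subset_iff)
  then show sub: "subring (QV) (KV)"
    unfolding rat_completion_eq by (rule h.img_is_subring)
  fix k assume k: "k \<in> QV - {\<zero>\<^bsub>KV\<^esub>}"
  then obtain x where x: "x \<in> cauchy_seqs \<rat> v" "k = cls x" by (auto simp: rat_completion_eq)
  then obtain y where y: "y \<in> cauchy_seqs \<rat> v" "k \<otimes>\<^bsub>KV\<^esub> cls y = \<one>\<^bsub>KV\<^esub>"
    using completion_inverse[OF subfield_Rats Rats_K x(1)] k by auto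
  have "k \<in> carrier (KV)" "cls y \<in> carrier (KV)"
    using x y rat_CS by (auto simp: carrier_completion)
  then have "inv\<^bsub>KV\<^esub> k = cls y" using F.comm_inv_char[of k "cls y"] y(2) by simp
  then show "inv\<^bsub>KV\<^esub> k \<in> QV" using y(1) by (simp add: rat_completion_eq)
qed

lemma Span_Rats_subset: "set es \<subseteq> K \<Longrightarrow> x \<in> CC.Span \<rat> es \<Longrightarrow> x \<in> K"
proof (induction es arbitrary: x)
  case (Cons e es)
  then obtain q y where "q \<in> \<rat>" "y \<in> CC.Span \<rat> es" "x = q * e + y"
    using CC.line_extension_mem_iff by auto
  then show ?case using Cons Rats_K K_closed(3,5) by auto
qed (use K_closed(1) in auto)

text \<open>Either \<open>e\<close> is at positive distance from the span \<open>S\<close> of the remaining vectors, and then the coefficient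
  sequence of \<open>e\<close> is Cauchy, or \<open>e\<close> is approximated by \<open>S\<close>, and then the whole sequence can be moved into \<open>S\<close>.\<close>
lemma cls_in_Span:
  assumes "set es \<subseteq> K" "x \<in> CS" "\<And>n. x n \<in> CC.Span \<rat> es"
  shows "cls x \<in> ring.Span (KV) (QV) (map (\<lambda>e. cls (\<lambda>_. e)) es)"
proof -
  interpret F: field "KV" by (rule field_completion)
  define H where "H es = F.Span (QV) (map (\<lambda>e. cls (\<lambda>_. e)) es)" for es
  have "cls x \<in> H es" using assms
  proof (induction es arbitrary: x)
    case Nil
    then have "x = (\<lambda>_. 0)" by auto
    then show ?case by (simp add: H_def cls_simps(4))
  next
    case (Cons e es)
    have eK: "e \<in> K" and esK: "set es \<subseteq> K" using Cons.prems(1) by auto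
    define S where "S = CC.Span \<rat> es"
    have SK: "z \<in> K" if "z \<in> S" for z using Span_Rats_subset[OF esK] that unfolding S_def by blast
    have C: "set es \<subseteq> carrier \<CC>" by simp
    have S0: "0 \<in> S" and S_add: "\<And>y z. y \<in> S \<Longrightarrow> z \<in> S \<Longrightarrow> y + z \<in> S" and S_neg: "\<And>y. y \<in> S \<Longrightarrow> - y \<in> S"
      and S_mult: "\<And>q y. q \<in> \<rat> \<Longrightarrow> y \<in> S \<Longrightarrow> q * y \<in> S"
      using CC.Span_subgroup_props(2-4)[OF subfield_Rats C] CC.Span_smult_closed[OF subfield_Rats C] by (auto simp: S_def)
    have S_diff: "y - z \<in> S" if "y \<in> S" "z \<in> S" for y z using S_add[OF that(1) S_neg[OF that(2)]] by simp
    have H_Cons: "cls q \<otimes>\<^bsub>KV\<^esub> cls (\<lambda>_. e) \<oplus>\<^bsub>KV\<^esub> u \<in> H (e # es)"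
      if "q \<in> cauchy_seqs \<rat> v" "u \<in> H es" for q u
      using that F.line_extension_mem_iff by (auto simp: H_def rat_completion_eq)
    have carr: "cls (\<lambda>_. c) \<in> carrier (KV)" if "c \<in> K" for c
      using CS_const[OF that] by (auto simp: carrier_completion)
    have H_mono: "H es \<subseteq> H (e # es)"
      unfolding H_def using F.mono_Span[OF subfield_rat_completion, of "map (\<lambda>e. cls (\<lambda>_. e)) es" "cls (\<lambda>_. e)"]
        carr eK esK by auto
    have "\<exists>q y. q \<in> \<rat> \<and> y \<in> S \<and> x n = q * e + y" for n
      using Cons.prems(3)[of n] CC.line_extension_mem_iff by (auto simp: S_def)
    then obtain q y where q: "\<And>n. q n \<in> \<rat>" and y: "\<And>n. y n \<in> S" and xe: "\<And>n. x n = q n * e + y n"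
      by metis
    have qK: "q n \<in> K" for n using q Rats_K by blast
    show ?case
    proof (cases "\<exists>\<delta>>0. \<forall>z\<in>S. \<delta> \<le> v (e + z)")
      case True
      then obtain \<delta> where \<delta>: "\<delta> > 0" "\<And>z. z \<in> S \<Longrightarrow> \<delta> \<le> v (e + z)" by blast
      have le: "\<delta> * v (q m - q n) \<le> v (x m - x n)" for m n
      proof (cases "q m = q n")
        case True
        then show ?thesis using v_nonneg[of "x m - x n"] Cons.prems(2) K_closed(7) by (auto simp: CS_iff)
      next
        case False
        define z where "z = inverse (q m - q n) * (y m - y n)"
        have "z \<in> S" unfolding z_def using q y S_diff by (intro S_mult) auto
        then have "\<delta> * v (q m - q n) \<le> v (q m - q n) * v (e + z)"
          using mult_right_mono[OF \<delta>(2)[OF \<open>z \<in> S\<close>] v_nonneg[OF K_closed(7)[OF qK qK]]]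
          by (simp only: mult.commute)
        also have "\<dots> = v ((q m - q n) * (e + z))"
          using K_closed(3,7) qK eK SK[OF \<open>z \<in> S\<close>] by (simp add: v_mult)
        also have "(q m - q n) * (e + z) = x m - x n" using False by (simp add: z_def xe field_simps)
        finally show ?thesis .
      qed
      have qC: "q \<in> cauchy_seqs \<rat> v" unfolding CS_iff
      proof (intro conjI allI impI q)
        fix d :: real assume "d > 0"
        then obtain N where N: "\<And>m n. m \<ge> N \<Longrightarrow> n \<ge> N \<Longrightarrow> v (x m - x n) < \<delta> * d"
          using CSD(2)[OF Cons.prems(2), of "\<delta> * d"] \<delta>(1) by auto
        have "v (q m - q n) < d" if "m \<ge> N" "n \<ge> N" for m n
          using le[of m n] N[OF that] \<delta>(1) by (meson le_less_trans mult_less_cancel_left_pos)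
        then show "\<exists>N. \<forall>m\<ge>N. \<forall>n\<ge>N. v (q m - q n) < d" by blast
      qed
      have qCS: "q \<in> CS" using qC rat_CS by blast
      have qe: "(\<lambda>n. q n * e) \<in> CS" using CS_mult[OF K order_refl qCS CS_const[OF eK]] .
      have yC: "y \<in> CS"
        using CS_add[OF K order_refl Cons.prems(2) CS_minus[OF K order_refl qe]] by (simp add: xe)
      have "x = (\<lambda>n. q n * e + y n)" using xe by blast
      then have "cls x = cls q \<otimes>\<^bsub>KV\<^esub> cls (\<lambda>_. e) \<oplus>\<^bsub>KV\<^esub> cls y"
        using cls_simps(1)[OF qe yC] cls_simps(2)[OF qCS CS_const[OF eK]] by simp
      then show ?thesis using H_Cons[OF qC] Cons.IH[OF esK yC] y by (simp add: S_def)
    next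
      case False
      have "\<exists>z\<in>S. v (e + z) < inverse (real (Suc n)) / (1 + v (q n))" for n
      proof -
        have "inverse (real (Suc n)) / (1 + v (q n)) > 0" using v_nonneg[OF qK, of n] by (intro divide_pos_pos) auto
        then show ?thesis using False not_less by blast
      qed
      then have "\<forall>n. \<exists>z. z \<in> S \<and> v (e + z) < inverse (real (Suc n)) / (1 + v (q n))" by blast
      from choice[OF this] obtain z where z: "\<And>n. z n \<in> S"
        "\<And>n. v (e + z n) < inverse (real (Suc n)) / (1 + v (q n))" by blast
      define x' where "x' n = y n - q n * z n" for n
      have x'S: "x' n \<in> S" for n unfolding x'_def by (rule S_diff[OF y S_mult[OF q z(1)]])
      have small: "v (x n - x' n) < inverse (real (Suc n))" for n
      proof -
        have "x n - x' n = q n * (e + z n)" by (simp add: xe x'_def algebra_simps)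
        then have "v (x n - x' n) = v (q n) * v (e + z n)" using v_mult[OF qK K_closed(3)[OF eK SK[OF z(1)]]] by simp
        also have "\<dots> \<le> (1 + v (q n)) * v (e + z n)"
          using v_nonneg[OF K_closed(3)[OF eK SK[OF z(1)]]] by (intro mult_right_mono) auto
        also have "\<dots> < inverse (real (Suc n))"
          using z(2)[of n] v_nonneg[OF qK, of n] by (simp add: less_divide_eq mult.commute)
        finally show ?thesis .
      qed
      have xK: "x n \<in> K" for n using CSD(1)[OF Cons.prems(2)] .
      have dN: "(\<lambda>n. x n - x' n) \<in> NS" unfolding NS_iff
      proof (intro conjI allI impI)
        show "x n - x' n \<in> K" for n using K_closed(7)[OF xK SK[OF x'S]] .
        fix d :: real assume "d > 0"
        then obtain N where N: "inverse (real (Suc N)) < d" using reals_Archimedean by blast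
        have "v (x n - x' n) < d" if "n \<ge> N" for n
        proof -
          have "inverse (real (Suc n)) \<le> inverse (real (Suc N))" using that by (intro le_imp_inverse_le) auto
          then show ?thesis using small[of n] N by linarith
        qed
        then show "\<exists>N. \<forall>n\<ge>N. v (x n - x' n) < d" by blast
      qed
      then have "(\<lambda>n. x n - x' n) \<in> CS" using NS_subset by blast
      then have x'C: "x' \<in> CS"
        using CS_add[OF K order_refl Cons.prems(2) CS_minus[OF K order_refl]] by fastforce
      have "cls x = cls x'" using cls_eq_iff[OF Cons.prems(2) x'C] dN by simp
      then show ?thesis using Cons.IH[OF esK x'C] x'S H_mono by (auto simp: S_def)
    qed
  qed
  then show ?thesis by (simp add: H_def)
qed

text \<open>The completion is spanned by the classes of the constant sequences over a basis of \<open>K\<close>. Finite dimension is the point here: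
  the dimension of a space without a finite basis is an unspecified number, possibly \<open>0\<close>.\<close>
theorem local_degree_pos:
  assumes "CC.finite_dimension \<rat> K"
  shows "local_degree K v > 0"
proof -
  interpret F: field "KV" by (rule field_completion)
  obtain d where "CC.dimension d \<rat> K" using assms by (rule CC.finite_dimensionE')
  then obtain es where es: "set es \<subseteq> carrier \<CC>" "CC.Span \<rat> es = K"
    using CC.exists_base[OF subfield_Rats] by blast
  have esK: "set es \<subseteq> K" using CC.Span_base_incl[OF subfield_Rats es(1)] es(2) by simp
  define us where "us = map (\<lambda>e. cls (\<lambda>_. e)) es"
  have us: "set us \<subseteq> carrier (KV)"
    using esK CS_const by (auto simp: us_def carrier_completion)
  have "F.Span (QV) us = carrier (KV)"
  proof
    show "F.Span (QV) us \<subseteq> carrier (KV)"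
      by (rule F.Span_subgroup_props(1)[OF subfield_rat_completion us])
    show "carrier (KV) \<subseteq> F.Span (QV) us"
      unfolding carrier_completion us_def
      using cls_in_Span[OF esK] es(2) by (auto simp: CS_iff)
  qed
  then have "F.finite_dimension (QV) (carrier (KV))"
    using F.Span_finite_dimension[OF subfield_rat_completion us] by simp
  then have dim: "F.dimension (local_degree K v) (QV) (carrier (KV))"
    using F.finite_dimensionE[OF subfield_rat_completion] by (simp add: over_def local_degree_def)
  show ?thesis
  proof (rule ccontr)
    assume "\<not> ?thesis"
    then have "carrier (KV) = {\<zero>\<^bsub>KV\<^esub>}" using F.dimension_zero[OF subfield_rat_completion] dim by simp
    then show False using F.one_closed completion_one_nz by auto
  qed
qed

end

section \<open>Places of a number field and the Weil height\<close>

definition archimedean :: "(complex \<Rightarrow> real) \<Rightarrow> bool" where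
  "archimedean v \<longleftrightarrow> (\<forall>q::rat. v (of_rat q) = of_rat \<bar>q\<bar>)"

lemma norm_of_rat_complex: "cmod (of_rat q) = of_rat \<bar>q\<bar>"
proof -
  obtain x y where "quotient_of q = (x, y)" by (cases "quotient_of q")
  then have q: "q = of_int x / of_int y" by (rule quotient_of_div)
  show ?thesis unfolding q by (simp add: of_rat_divide norm_divide abs_divide flip: of_int_abs)
qed

lemma placesD:
  assumes "v \<in> places K" "subfield K \<CC>"
  shows "abs_val K v" "archimedean v \<or> (\<exists>p. padic_val K v p)"
proof -
  show av: "abs_val K v" using assms by (intro abs_val.intro) (simp_all add: places_def)
  show "archimedean v \<or> (\<exists>p. padic_val K v p)"
    using assms(1) av unfolding places_def archimedean_def
    by (auto intro!: padic_val.intro padic_val_axioms.intro padic.intro)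
qed

lemma place_nat_le:
  assumes "v \<in> places K" "subfield K \<CC>"
  shows "v (of_nat k) \<le> real k"
proof -
  interpret abs_val K v using placesD[OF assms] by blast
  show ?thesis
  proof (induction k)
    case (Suc k)
    have "v (of_nat k + 1) \<le> v (of_nat k) + v 1"
      using K_closed(2) K_closed(11)[of "int k"] by (intro v_add) auto
    then show ?case using Suc by (simp add: add.commute)
  qed simp
qed

context minimal_poly begin

abbreviation "K \<equiv> adjoin a"

lemma finite_archimedean: "finite {v \<in> places K. archimedean v}"
proof (rule finite_subset)
  show "finite {v \<in> extensional K. absolute_value_on K v \<and> (\<forall>q. v (of_rat q) = of_rat \<bar>q\<bar>)}"
    by (rule finite_extensions[of _ 2]) simp
qed (auto simp: places_def archimedean_def)

lemma finite_padic: "finite {v \<in> places K. padic_val K v p}"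
proof (cases "prime p")
  case True
  interpret padic p by unfold_locales (rule True)
  show ?thesis
  proof (rule finite_subset)
    show "finite {v \<in> extensional K. absolute_value_on K v \<and> (\<forall>q. v (of_rat q) = \<pi> q)}"
      by (rule finite_extensions[of _ "inverse (of_nat p)"]) (use p_gt_1 in \<open>simp add: padic_inverse padic_p\<close>)
  qed (auto simp: places_def padic_val_def padic_val_axioms_def)
next
  case False
  then have empty: "{v \<in> places K. padic_val K v p} = {}" by (auto simp: padic_val_def padic_def)
  show ?thesis unfolding empty by simp
qed

text \<open>A place with \<open>v a > 1\<close> is archimedean or lies over one of the finitely many primes dividing the leading coefficient.\<close>
lemma finite_places_gt_1: "finite {v \<in> places K. v a > 1}"
proof (rule finite_subset)
  define D where "D = {p. prime p \<and> int p dvd lead_coeff Q}"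
  have "finite {d. d dvd lead_coeff Q}" using Q_nz by (intro finite_divisors_int) auto
  then have "finite (int ` D)" by (rule finite_subset[rotated]) (auto simp: D_def)
  then have "finite D" by (rule finite_imageD) (auto simp: inj_on_def)
  then show "finite ({v \<in> places K. archimedean v} \<union> (\<Union>p\<in>D. {v \<in> places K. padic_val K v p}))" (is "finite ?U")
    using finite_archimedean finite_padic by blast
  have "v \<in> ?U" if v: "v \<in> places K" "v a > 1" for v
    using placesD(2)[OF v(1) subfield_adjoin]
  proof
    assume "\<exists>p. padic_val K v p"
    then obtain p where p: "padic_val K v p" ..
    then interpret padic_val K v p .
    have "p \<in> D" using gt_1_imp_dvd_lead_coeff[OF adjoin_self v(2) root Q_nz] prime_p by (simp add: D_def)
    then show ?thesis using v(1) p by blast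
  qed (use v(1) in simp)
  then show "{v \<in> places K. v a > 1} \<subseteq> ?U" by blast
qed

lemma weil_height_nonneg: "weil_height a \<ge> 0"
  unfolding weil_height_def height_over_def by (intro infsum_nonneg mult_nonneg_nonneg) auto

text \<open>By the finiteness of the places with \<open>v a > 1\<close>, the infinite sum is a finite sum of non-negative terms and dominates each of
  them; the local degree in such a term is at least \<open>1\<close>.\<close>
lemma place_le_height:
  assumes v: "v \<in> places K"
  shows "v a \<le> exp (n * weil_height a)"
proof (cases "v a \<le> 1")
  case True
  then show ?thesis using weil_height_nonneg by (simp add: order_trans[of _ 1])
next
  case False
  define f where "f v = real (local_degree K v) / real n * ln (max 1 (v a))" for v
  define V where "V = {v \<in> places K. v a > 1}"
  have fV: "finite V" unfolding V_def by (rule finite_places_gt_1)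
  have f0: "0 \<le> f u" for u unfolding f_def by (intro mult_nonneg_nonneg) auto
  have "weil_height a = infsum f (places K)"
    unfolding weil_height_def height_over_def f_def using alg_degree_eq by (simp add: alg_degree_def)
  also have "\<dots> = infsum f V"
    by (rule infsum_cong_neutral) (auto simp: V_def f_def max_def)
  also have "\<dots> = sum f V" using fV by simp
  finally have h: "weil_height a = sum f V" .
  have vV: "v \<in> V" using v False by (simp add: V_def)
  have "f v \<le> weil_height a" unfolding h using fV vV f0 by (intro member_le_sum) auto
  moreover have "ln (v a) \<le> n * f v"
  proof -
    have "local_degree K v > 0"
      using abs_val.local_degree_pos[OF placesD(1)[OF v subfield_adjoin]] dimension_adjoin CC.finite_dimensionI by blast
    then have "1 * ln (v a) \<le> real (local_degree K v) * ln (v a)" using False by (intro mult_right_mono) auto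
    then show ?thesis using False degree_pos by (simp add: f_def max_def)
  qed
  ultimately have "ln (v a) \<le> n * weil_height a" using degree_pos by (meson mult_left_mono of_nat_0_le_iff order_trans)
  then show ?thesis using False by (metis exp_le_cancel_iff exp_ln not_le zero_less_one order.strict_trans)
qed

text \<open>The place is the usual absolute value after the embedding \<open>f(a) \<mapsto> f(z)\<close>, which is well defined because \<open>z\<close> is a conjugate
  of \<open>a\<close>.\<close>
lemma conjugate_place:
  assumes z: "rpoly P z = 0"
  shows "\<exists>v\<in>places K. v a = cmod z"
proof -
  define \<sigma> where "\<sigma> x = rpoly (SOME f. rpoly f a = x) z" for x
  have \<sigma>: "\<sigma> (rpoly f a) = rpoly f z" for f
  proof -
    define g where "g = (SOME g. rpoly g a = rpoly f a)"
    have "rpoly g a = rpoly f a" unfolding g_def by (rule someI) (rule refl)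
    then have "rpoly (g - f) a = 0" by simp
    then have "rpoly (g - f) z = 0" using z by (rule conjugate_root)
    then show ?thesis unfolding \<sigma>_def g_def[symmetric] by simp
  qed
  have hom: "\<sigma> (x * y) = \<sigma> x * \<sigma> y" "\<sigma> (x + y) = \<sigma> x + \<sigma> y" if "x \<in> K" "y \<in> K" for x y
  proof -
    obtain f g where "x = rpoly f a" "y = rpoly g a" using \<open>x \<in> K\<close> \<open>y \<in> K\<close> adjoin_eq by auto
    then show "\<sigma> (x * y) = \<sigma> x * \<sigma> y" "\<sigma> (x + y) = \<sigma> x + \<sigma> y"
      using \<sigma>[of "f * g"] \<sigma>[of "f + g"] \<sigma>[of f] \<sigma>[of g] by simp_all
  qed
  have rat: "\<sigma> (of_rat q) = of_rat q" for q using \<sigma>[of "[:q:]"] by simp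
  have inj: "x = 0" if "x \<in> K" "\<sigma> x = 0" for x
  proof (rule ccontr)
    assume "x \<noteq> 0"
    then have "\<sigma> x * \<sigma> (inverse x) = 1"
      using hom(1)[OF that(1) subfield_CC_D(6)[OF subfield_adjoin that(1)]] rat[of 1] by simp
    then show False using that(2) by simp
  qed
  define v where "v = restrict (\<lambda>x. cmod (\<sigma> x)) K"
  have "absolute_value_on K v" unfolding absolute_value_on_def
  proof (intro conjI ballI)
    fix x y assume xy: "x \<in> K" "y \<in> K"
    show "0 \<le> v x" using xy by (simp add: v_def)
    show "v x = 0 \<longleftrightarrow> x = 0" using xy inj rat[of 0] by (auto simp: v_def)
    show "v (x * y) = v x * v y" using xy hom subfield_CC_D(5)[OF subfield_adjoin] by (simp add: v_def norm_mult)
    show "v (x + y) \<le> v x + v y"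
      using xy hom subfield_CC_D(3)[OF subfield_adjoin] by (simp add: v_def norm_triangle_ineq)
  qed
  moreover have "v (of_rat q) = of_rat \<bar>q\<bar>" for q
    using subfield_CC_D(10)[OF subfield_adjoin] by (simp add: v_def rat norm_of_rat_complex)
  ultimately have "v \<in> places K" by (simp add: places_def v_def)
  moreover have "v a = cmod z" using \<sigma>[of "[:0,1:]"] adjoin_self by (simp add: v_def)
  ultimately show ?thesis by blast
qed

end

lemma adjoin_inverse: "adjoin (inverse b) = adjoin b"
proof
  show "adjoin (inverse b) \<subseteq> adjoin b"
    by (rule adjoin_min[OF subfield_adjoin subfield_CC_D(6)[OF subfield_adjoin adjoin_self]])
  show "adjoin b \<subseteq> adjoin (inverse b)"
    using adjoin_min[OF subfield_adjoin subfield_CC_D(6)[OF subfield_adjoin adjoin_self], of "inverse b"] by simp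
qed

lemma adjoin_nat_mult: "N \<noteq> 0 \<Longrightarrow> adjoin (of_nat N * b) = adjoin b"
proof
  have N: "of_nat N \<in> adjoin c" for c using subfield_CC_D(11)[OF subfield_adjoin, of "int N"] by simp
  show "adjoin (of_nat N * b) \<subseteq> adjoin b"
    by (rule adjoin_min[OF subfield_adjoin subfield_CC_D(5)[OF subfield_adjoin N adjoin_self]])
  assume "N \<noteq> 0"
  then have "b = (of_nat N * b) / of_nat N" by simp
  then have "b \<in> adjoin (of_nat N * b)"
    using subfield_CC_D(8)[OF subfield_adjoin adjoin_self N] by metis
  then show "adjoin b \<subseteq> adjoin (of_nat N * b)" by (rule adjoin_min[OF subfield_adjoin])
qed

lemma algebraic_if_in_adjoin:
  assumes "minimal_poly a A" "b \<in> adjoin a" shows "algebraic b"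
proof -
  interpret minimal_poly a A by fact
  show ?thesis
  proof (rule ccontr)
    assume na: "\<not> algebraic b"
    define Us where "Us = map (\<lambda>i. b ^ i) [0..<Suc n]"
    have "CC.independent \<rat> Us"
    proof (rule independent_RatsI)
      fix c i assume "(\<Sum>i<length Us. of_rat (c i) * Us ! i) = 0" and i: "i < length Us"
      then have "rpoly (\<Sum>i<Suc n. monom (c i) i) b = 0" by (simp add: Us_def nth_append)
      then have "poly (map_poly of_rat (\<Sum>i<Suc n. monom (c i) i)) b = 0" by (simp only: rpoly_def)
      then have "map_poly of_rat (\<Sum>i<Suc n. monom (c i) i) = (0 :: complex poly)"
        using na unfolding algebraic_altdef by (metis (no_types, lifting) Rats_of_rat coeff_map_poly of_rat_0)
      then have "(\<Sum>i<Suc n. monom (c i) i) = 0" by (simp add: map_poly_eq_0_iff)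
      then have "coeff (\<Sum>i<Suc n. monom (c i) i) i = 0" by simp
      then have "(if i < Suc n then c i else 0) = 0" by (simp add: coeff_sum del: sum.lessThan_Suc)
      then show "c i = 0" using i by (simp add: Us_def)
    qed
    moreover have "set Us \<subseteq> adjoin a"
      using subfield_CC_D(9)[OF subfield_adjoin assms(2)] by (auto simp: Us_def)
    ultimately have "length Us \<le> n"
      by (rule CC.independent_length_le_dimension[OF subfield_Rats dimension_adjoin])
    then show False by (simp add: Us_def)
  qed
qed

lemma rpoly_reflect: "z \<noteq> 0 \<Longrightarrow> rpoly (rat_poly (reflect_poly Q)) z = z ^ degree Q * rpoly (rat_poly Q) (inverse z)"
proof -
  have "map_poly of_rat (rat_poly (reflect_poly Q)) = reflect_poly (map_poly of_rat (rat_poly Q) :: complex poly)"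
    by (rule poly_eqI) (simp add: coeff_map_poly coeff_reflect_poly degree_map_poly)
  moreover assume "z \<noteq> 0"
  ultimately show ?thesis by (simp add: rpoly_def poly_reflect_poly_nz degree_map_poly)
qed

text \<open>Apply the existence of places to \<open>c = 1/b\<close>: a prime dividing the constant coefficient of its minimal polynomial would give
  a \<open>p\<close>-adic place with \<open>v c < 1\<close>, that is \<open>v b > 1\<close>. So this coefficient is \<open>1\<close> or \<open>-1\<close>, and the reversed polynomial is, up
  to sign, a monic integer polynomial of \<open>b\<close>, whose roots are bounded through the archimedean places.\<close>
lemma integral_poly:
  assumes alg: "algebraic b" and b: "b \<noteq> 0"
    and int: "\<And>v p. v \<in> places (adjoin b) \<Longrightarrow> padic_val (adjoin b) v p \<Longrightarrow> v b \<le> 1"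
    and bound: "\<And>v. v \<in> places (adjoin b) \<Longrightarrow> v b \<le> E"
  obtains R :: "int poly" where "\<bar>lead_coeff R\<bar> = 1" "degree R = alg_degree b" "rpoly (rat_poly R) b = 0"
    "\<And>z. rpoly (rat_poly R) z = 0 \<Longrightarrow> cmod z \<le> E"
proof -
  define c where "c = inverse b"
  obtain B where "minimal_poly b B" using minimal_poly_exists[OF alg] .
  then have "algebraic c"
    unfolding c_def by (rule algebraic_if_in_adjoin) (rule subfield_CC_D(6)[OF subfield_adjoin adjoin_self])
  then obtain Q where "minimal_poly c Q" using minimal_poly_exists by blast
  then interpret minimal_poly c Q .
  have adj: "adjoin c = adjoin b" by (simp add: c_def adjoin_inverse)
  have vc: "v c = inverse (v b)" if "v \<in> places K" for v
    using abs_val.v_inverse[OF placesD(1)[OF that subfield_adjoin]] adjoin_self[of b] by (simp add: c_def adj[unfolded c_def])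
  have vb: "v b > 0" if "v \<in> places K" for v
    using abs_val.v_pos[OF placesD(1)[OF that subfield_adjoin]] adjoin_self[of b] b adj by simp
  have no_prime: "\<not> int p dvd coeff Q 0" if "prime p" for p
  proof
    assume "int p dvd coeff Q 0"
    then interpret small_root c Q p using that by unfold_locales auto
    obtain v where v: "v \<in> extensional K" "absolute_value_on K v" "\<And>q. v (of_rat q) = \<pi> q" "v c < 1"
      using ex_place_root_small by blast
    have vP: "v \<in> places K" using v that by (auto simp: places_def)
    have "padic_val K v p" using placesD(1)[OF vP subfield_adjoin] v(3) padic_axioms
      by (intro padic_val.intro padic_val_axioms.intro) auto
    then have "v b \<le> 1" using int vP adj by simp
    then have "1 \<le> inverse (v b)" by (rule one_le_inverse[OF vb[OF vP]])
    then show False using vc[OF vP] v(4) by simp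
  qed
  have c0: "\<bar>coeff Q 0\<bar> = 1"
  proof (rule ccontr)
    assume "\<bar>coeff Q 0\<bar> \<noteq> 1"
    then have "nat \<bar>coeff Q 0\<bar> \<noteq> 1" by simp
    then obtain p where "prime p" "p dvd nat \<bar>coeff Q 0\<bar>" using prime_factor_nat by blast
    then show False using no_prime[of p] by (simp add: int_dvd_int_iff[symmetric])
  qed
  then have c0': "coeff Q 0 \<noteq> 0" by auto
  define R where "R = reflect_poly Q"
  have dR: "degree R = degree Q" using c0' by (simp add: R_def)
  show ?thesis
  proof
    show "\<bar>lead_coeff R\<bar> = 1" using c0 c0' dR by (simp add: R_def coeff_reflect_poly)
    show "degree R = alg_degree b" using alg_degree_eq dR by (simp add: alg_degree_def adj)
    show "rpoly (rat_poly R) b = 0" using root b by (simp add: R_def rpoly_reflect c_def)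
    fix z assume z: "rpoly (rat_poly R) z = 0"
    show "cmod z \<le> E"
    proof (cases "z = 0")
      case True
      have "\<exists>v. v \<in> places K" using conjugate_place[OF root] by blast
      then show ?thesis using bound vb adj True by (metis less_imp_le norm_zero order_trans)
    next
      case False
      then have "rpoly P (inverse z) = 0" using z by (simp add: R_def rpoly_reflect)
      then obtain v where v: "v \<in> places K" "v c = cmod (inverse z)" using conjugate_place by blast
      then have "v b = cmod z" using vc[OF v(1)] by (simp add: norm_inverse)
      then show ?thesis using bound v(1) adj by metis
    qed
  qed
qed

section \<open>Northcott's theorem\<close>

lemma coeff_prod_linear_bound:
  assumes "0 \<le> E" "\<And>z. z \<in># M \<Longrightarrow> cmod z \<le> E"
  shows "cmod (coeff (\<Prod>x\<in>#M. [:- x, 1:]) i) \<le> (1 + E) ^ size M"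
  using assms(2)
proof (induction M arbitrary: i)
  case (add x M)
  define p where "p = (\<Prod>x\<in>#M. [:- x, 1:])"
  have IH: "cmod (coeff p i) \<le> (1 + E) ^ size M" for i using add by (simp add: p_def)
  have "cmod (coeff ([:- x, 1:] * p) i) \<le> cmod x * cmod (coeff p i) + (1 + E) ^ size M"
  proof (cases i)
    case 0
    then show ?thesis using assms(1) by (simp add: norm_mult)
  next
    case (Suc j)
    then have "coeff ([:- x, 1:] * p) i = - (x * coeff p i) + coeff p j" by simp
    then have "cmod (coeff ([:- x, 1:] * p) i) \<le> cmod (- (x * coeff p i)) + cmod (coeff p j)"
      by (simp only: norm_triangle_ineq)
    then show ?thesis using IH[of j] by (simp add: norm_mult)
  qed
  also have "\<dots> \<le> E * (1 + E) ^ size M + (1 + E) ^ size M"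
    using add.prems assms(1) IH by (intro add_mono mult_mono) auto
  also have "\<dots> = (1 + E) ^ size (add_mset x M)" by (simp add: algebra_simps)
  finally show ?case by (simp add: p_def)
qed (auto simp: coeff_1)

lemma coeff_bound_of_root_bound:
  assumes "\<bar>lead_coeff R\<bar> = 1" "\<And>z. rpoly (rat_poly R) z = 0 \<Longrightarrow> cmod z \<le> E" "0 \<le> E"
  shows "real_of_int \<bar>coeff R i\<bar> \<le> (1 + E) ^ degree R"
proof -
  define p where "p = (map_poly of_rat (rat_poly R) :: complex poly)"
  have R0: "R \<noteq> 0" using assms(1) by auto
  have cp: "coeff p i = of_int (coeff R i)" for i by (simp add: p_def coeff_map_poly)
  have p0: "p \<noteq> 0" using R0 by (simp add: p_def map_poly_eq_0_iff)
  have dp: "degree p = degree R" by (simp add: p_def degree_map_poly)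
  have lc: "cmod (lead_coeff p) = 1" using assms(1) by (simp add: cp dp)
  define q where "q = (\<Prod>x\<in>#proots p. [:- x, 1:])"
  have pq: "p = smult (lead_coeff p) q" using complex_poly_decompose_multiset[of p] by (simp add: q_def)
  have "coeff p i = lead_coeff p * coeff q i" by (subst pq) simp
  then have "real_of_int \<bar>coeff R i\<bar> = cmod (coeff q i)" using lc cp[of i] by (metis mult_1 norm_mult norm_of_int of_int_abs)
  also have "\<dots> \<le> (1 + E) ^ size (proots p)"
    unfolding q_def using assms(2,3) p0 by (intro coeff_prod_linear_bound) (auto simp: rpoly_def p_def)
  finally show ?thesis by (simp add: size_proots_complex dp)
qed

lemma finite_int_polys: "finite {R :: int poly. degree R \<le> d \<and> (\<forall>i. \<bar>coeff R i\<bar> \<le> B)}"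
proof (rule finite_subset)
  show "finite (Poly ` {xs :: int list. set xs \<subseteq> {- B..B} \<and> length xs = Suc d})"
    by (intro finite_imageI finite_lists_length_eq) simp
  show "{R :: int poly. degree R \<le> d \<and> (\<forall>i. \<bar>coeff R i\<bar> \<le> B)} \<subseteq> Poly ` {xs :: int list. set xs \<subseteq> {- B..B} \<and> length xs = Suc d}"
  proof
    fix R :: "int poly" assume R: "R \<in> {R. degree R \<le> d \<and> (\<forall>i. \<bar>coeff R i\<bar> \<le> B)}"
    have "R = Poly (map (coeff R) [0..<Suc d])"
      using R by (intro poly_eqI) (auto simp: nth_default_def coeff_eq_0 simp del: upt_Suc)
    moreover have "set (map (coeff R) [0..<Suc d]) \<subseteq> {- B..B}"
      using R by (auto simp: abs_le_iff minus_le_iff simp del: upt_Suc)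
    ultimately show "R \<in> Poly ` {xs :: int list. set xs \<subseteq> {- B..B} \<and> length xs = Suc d}"
      by (intro image_eqI[of _ _ "map (coeff R) [0..<Suc d]"]) (simp_all del: upt_Suc)
  qed
qed

text \<open>If \<open>v a > 1\<close> at a place over \<open>p\<close>, then \<open>p\<close> is at most \<open>T\<close> and divides \<open>fact T\<close>, while \<open>v a\<close> is at most \<open>2 ^ M\<close>. So one
  integer depending only on degree and height bound clears all denominators.\<close>
lemma denominator_bound:
  assumes alg: "algebraic a" and h: "weil_height a \<le> B" and v: "v \<in> places (adjoin a)"
    and p: "padic_val (adjoin a) v p"
    and T: "exp (real (alg_degree a) * B) ^ alg_degree a \<le> real T" and M: "exp (real (alg_degree a) * B) \<le> 2 ^ M"
  shows "v (of_nat (fact T ^ M) * a) \<le> 1"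
proof -
  obtain Q where "minimal_poly a Q" using minimal_poly_exists[OF alg] .
  then interpret minimal_poly a Q .
  interpret padic_val K v p by fact
  define E where "E = exp (real n * B)"
  have "n * weil_height a \<le> n * B" using h by (intro mult_left_mono) auto
  then have vE: "v a \<le> E" using place_le_height[OF v] by (auto simp: E_def intro: order_trans)
  have NK: "of_nat k \<in> K" for k using K_closed(11)[of "int k"] by simp
  have vN: "v (of_nat k) \<le> 1" for k using v_int[of "int k"] by simp
  have vNa: "v (of_nat (fact T ^ M) * a) = v (of_nat (fact T)) ^ M * v a"
    using v_mult[OF K_closed(9)[OF NK] adjoin_self, of "fact T" M] v_power[OF NK, of "fact T"] by simp
  have nn: "0 \<le> v (of_nat (fact T))" "0 \<le> v a" using v_nonneg NK adjoin_self by blast+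
  show ?thesis
  proof (cases "v a \<le> 1")
    case True
    then show ?thesis unfolding vNa using vN[of "fact T"] nn
      by (intro mult_le_one power_le_one) auto
  next
    case False
    then have "real p \<le> v a ^ n" using gt_1_gap[OF adjoin_self _ root P_nz] by simp
    also have "\<dots> \<le> E ^ n" using vE False by (intro power_mono) auto
    also have "\<dots> \<le> real T" using T by (simp add: E_def alg_degree_eq)
    finally have "p \<le> T" by simp
    then have "p dvd fact T" using p_gt_1 by (intro dvd_fact) auto
    then have "int p ^ 1 dvd int (fact T)" by (simp only: int_dvd_int_iff power_one_right)
    then have "\<pi> (of_int (int (fact T))) \<le> 1 / real p ^ 1" by (rule padic_le_power_dvd)
    moreover have "v (of_nat k) = \<pi> (of_int (int k))" for k using ext[of "of_nat k"] by simp
    ultimately have "v (of_nat (fact T)) \<le> 1 / real p" by (simp only: power_one_right)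
    also have "\<dots> \<le> 1 / 2" using p_gt_1 by (intro divide_left_mono) auto
    finally have "v (of_nat (fact T)) ^ M \<le> (1 / 2) ^ M" using nn by (intro power_mono) auto
    then have "v (of_nat (fact T)) ^ M * v a \<le> (1 / 2) ^ M * 2 ^ M"
      using vE M nn by (intro mult_mono) (auto simp: E_def alg_degree_eq)
    then show ?thesis unfolding vNa by (simp add: power_one_over)
  qed
qed

text \<open>After clearing denominators by a fixed integer, the elements are roots of integer polynomials of bounded degree with leading
  coefficient \<open>1\<close> or \<open>-1\<close> and bounded roots. Such polynomials have bounded coefficients.\<close>
theorem northcott: "finite {a. algebraic a \<and> alg_degree a = d \<and> weil_height a \<le> B}"
proof -
  define E where "E = exp (real d * B)"
  define T where "T = nat \<lceil>E ^ d\<rceil>"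
  obtain M where M: "E < 2 ^ M" using real_arch_pow[of 2 E] by auto
  have T: "E ^ d \<le> real T" unfolding T_def by linarith
  define N where "N = (fact T ^ M :: nat)"
  have N0: "N > 0" by (simp add: N_def)
  have E0: "E > 0" by (simp add: E_def)
  define C where "C = \<lfloor>(1 + real N * E) ^ d\<rfloor>"
  define Rs where "Rs = {R :: int poly. degree R \<le> d \<and> (\<forall>i. \<bar>coeff R i\<bar> \<le> C)}"
  define bs where "bs = (\<Union>R\<in>Rs - {0}. {z. rpoly (rat_poly R) z = 0})"
  have "finite {z. rpoly (rat_poly R) z = 0}" if "R \<noteq> 0" for R
    unfolding rpoly_def using that by (intro poly_roots_finite) (simp add: map_poly_eq_0_iff)
  then have "finite bs" unfolding bs_def Rs_def using finite_int_polys by (intro finite_UN_I) auto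
  then have fin: "finite (insert 0 ((\<lambda>b. b / of_nat N) ` bs))" by simp
  have "a \<in> insert 0 ((\<lambda>b. b / of_nat N) ` bs)"
    if a: "algebraic a" "alg_degree a = d" "weil_height a \<le> B" for a
  proof (cases "a = 0")
    case False
    obtain Q where "minimal_poly a Q" using minimal_poly_exists[OF a(1)] .
    then interpret minimal_poly a Q .
    define b where "b = of_nat N * a"
    have adj: "adjoin b = K" unfolding b_def using N0 by (intro adjoin_nat_mult) auto
    have algb: "algebraic b" using algebraic_if_in_adjoin[OF minimal_poly_axioms, of b] adjoin_self[of b] adj by simp
    obtain R where R: "\<bar>lead_coeff R\<bar> = 1" "degree R = alg_degree b" "rpoly (rat_poly R) b = 0"
      "\<And>z. rpoly (rat_poly R) z = 0 \<Longrightarrow> cmod z \<le> real N * E"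
    proof (rule integral_poly[OF algb])
      show "b \<noteq> 0" using False N0 by (simp add: b_def)
      show "v b \<le> 1" if "v \<in> places (adjoin b)" "padic_val (adjoin b) v p" for v p
        unfolding b_def N_def using that denominator_bound[OF a(1,3)] T M a(2) by (simp add: adj E_def)
      show "v b \<le> real N * E" if "v \<in> places (adjoin b)" for v
      proof -
        have v: "v \<in> places K" using that adj by simp
        interpret abs_val K v using placesD(1)[OF v subfield_adjoin] .
        have "v b = v (of_nat N) * v a" unfolding b_def using K_closed(11)[of "int N"] adjoin_self by (intro v_mult) auto
        also have "\<dots> \<le> real N * E"
        proof (intro mult_mono place_nat_le[OF v subfield_adjoin])
          have "real n * weil_height a \<le> real d * B" using a alg_degree_eq by (simp add: mult_left_mono)
          then show "v a \<le> E" using place_le_height[OF v] by (auto simp: E_def intro: order_trans)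
        qed (use v_nonneg adjoin_self in auto)
        finally show ?thesis .
      qed
    qed blast
    have dR: "degree R = d" using R(2) a(2) by (simp add: alg_degree_def adj)
    have "real_of_int \<bar>coeff R i\<bar> \<le> (1 + real N * E) ^ d" for i
      using coeff_bound_of_root_bound[OF R(1,4), of i] E0 dR by simp
    then have "R \<in> Rs" using dR by (simp add: Rs_def C_def le_floor_iff)
    moreover have "R \<noteq> 0" using R(1) by auto
    ultimately have "b \<in> bs" using R(3) by (auto simp: bs_def)
    moreover have "a = b / of_nat N" using N0 by (simp add: b_def)
    ultimately show ?thesis by blast
  qed simp
  then show ?thesis by (intro finite_subset[OF _ fin]) blast
qed

section \<open>Kronecker's theorem\<close>

text \<open>Division by an integer polynomial with leading coefficient \<open>1\<close> or \<open>-1\<close> does not leave the integers.\<close>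
lemma power_int_combination:
  assumes R: "\<bar>lead_coeff R\<bar> = 1" "degree R = n" "rpoly (rat_poly R) a = 0" "n > 0"
  shows "\<exists>C :: int poly. degree C < n \<and> rpoly (rat_poly C) a = a ^ m"
proof (induction m)
  case 0
  show ?case using R(4) by (intro exI[of _ 1]) simp
next
  case (Suc m)
  then obtain C :: "int poly" where C: "degree C < n" "rpoly (rat_poly C) a = a ^ m" by blast
  define t where "t = coeff C (n - 1) * lead_coeff R"
  define D where "D = pCons 0 C - smult t R"
  have "lead_coeff R * lead_coeff R = 1" using R(1) by (metis abs_mult_self_eq mult_1)
  then have "coeff D n = 0" using R(2,4) by (cases n) (auto simp: D_def t_def)
  moreover have "degree D \<le> n" unfolding D_def using C(1) R(2)
    by (intro degree_diff_le order_trans[OF degree_pCons_le] order_trans[OF degree_smult_le]) auto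
  ultimately have "degree D < n" using R(4) by (metis coeff_0_degree_minus_1 eq_zero_or_degree_less leading_coeff_0_iff le_neq_implies_less degree_0)
  moreover have "rpoly (rat_poly D) a = a ^ Suc m"
  proof -
    have "rat_poly D = pCons 0 (rat_poly C) - smult (of_int t) (rat_poly R)"
      by (rule poly_eqI) (simp add: D_def coeff_map_poly coeff_pCons split: nat.split)
    then show ?thesis using C(2) R(3) by simp
  qed
  ultimately show ?case by blast
qed

text \<open>Lagrange interpolation.\<close>
lemma coeff_bound_of_values:
  fixes Z :: "complex set"
  assumes "finite Z"
  shows "\<exists>B. \<forall>p :: complex poly. degree p < card Z \<longrightarrow> (\<forall>z\<in>Z. cmod (poly p z) \<le> 1) \<longrightarrow> (\<forall>i. cmod (coeff p i) \<le> B)"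
proof -
  define l where "l z = smult (inverse (\<Prod>w\<in>Z - {z}. z - w)) (\<Prod>w\<in>Z - {z}. [:- w, 1:])" for z
  define B where "B i = (\<Sum>z\<in>Z. cmod (coeff (l z) i))" for i
  define BB where "BB = (\<Sum>i<card Z. B i)"
  have B0: "0 \<le> B i" for i unfolding B_def by (intro sum_nonneg) auto
  have deg_l: "degree (l z) < card Z" if "z \<in> Z" for z
  proof -
    have "degree (\<Prod>w\<in>Z - {z}. [:- w, 1:]) = card (Z - {z})"
      by (subst degree_prod_eq_sum_degree) auto
    moreover have "card (Z - {z}) < card Z" using assms that by (intro card_Diff1_less)
    ultimately show ?thesis unfolding l_def using degree_smult_le le_less_trans by metis
  qed
  have val_l: "poly (l z) w = (if w = z then 1 else 0)" if "z \<in> Z" "w \<in> Z" for z w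
  proof (cases "w = z")
    case True
    then show ?thesis using assms by (simp add: l_def poly_prod)
  next
    case False
    then have "(\<Prod>u\<in>Z - {z}. poly [:- u, 1:] w) = 0" using assms that by (intro prod_zero) auto
    then show ?thesis using False by (simp add: l_def poly_prod)
  qed
  have "cmod (coeff p i) \<le> BB" if p: "degree p < card Z" "\<forall>z\<in>Z. cmod (poly p z) \<le> 1" for p :: "complex poly" and i
  proof -
    define q where "q = (\<Sum>z\<in>Z. smult (poly p z) (l z))"
    have "poly q w = poly p w" if "w \<in> Z" for w
    proof -
      have "poly q w = (\<Sum>z\<in>Z. poly p z * (if w = z then 1 else 0))"
        unfolding q_def poly_sum using val_l that by (intro sum.cong) auto
      then show ?thesis using assms that by (simp add: if_distrib cong: if_cong)
    qed
    moreover have "degree q < card Z"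
      unfolding q_def using deg_l p(1) by (intro degree_sum_less) (auto intro: le_less_trans[OF degree_smult_le])
    ultimately have "p = q"
    proof -
      assume val: "\<And>w. w \<in> Z \<Longrightarrow> poly q w = poly p w" and dq: "degree q < card Z"
      show ?thesis
      proof (rule ccontr)
        assume "p \<noteq> q"
        then have nz: "p - q \<noteq> 0" by simp
        have "card Z \<le> card {x. poly (p - q) x = 0}"
          using val poly_roots_finite[OF nz] by (intro card_mono) auto
        also have "\<dots> \<le> degree (p - q)" using nz by (rule card_poly_roots_bound)
        also have "\<dots> < card Z" using p(1) dq by (intro degree_diff_less)
        finally show False by simp
      qed
    qed
    show ?thesis
    proof (cases "i < card Z")
      case True
      have "coeff p i = (\<Sum>z\<in>Z. poly p z * coeff (l z) i)" by (subst \<open>p = q\<close>) (simp add: q_def coeff_sum)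
      also have "cmod \<dots> \<le> (\<Sum>z\<in>Z. cmod (poly p z * coeff (l z) i))" by (rule norm_sum)
      also have "\<dots> \<le> B i" unfolding B_def norm_mult using p(2) by (intro sum_mono mult_left_le_one_le) auto
      also have "\<dots> \<le> BB" unfolding BB_def using True B0 by (intro member_le_sum) auto
      finally show ?thesis .
    next
      case False
      then show ?thesis using p(1) B0 by (simp add: coeff_eq_0 BB_def sum_nonneg)
    qed
  qed
  then show ?thesis by blast
qed

text \<open>All places have \<open>v a \<le> 1\<close>, so \<open>a\<close> is an algebraic integer with all conjugates in the closed unit disc. The powers of \<open>a\<close>
  are integer combinations of \<open>1, a, ..., a ^ (n - 1)\<close>; the same combinations represent the powers of the \<open>n\<close> distinct
  conjugates, which stay bounded, so that only finitely many combinations occur and two powers of \<open>a\<close> coincide.\<close>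
theorem kronecker:
  assumes alg: "algebraic a" and a0: "a \<noteq> 0" and h: "weil_height a \<le> 0"
  shows "a \<in> roots_of_unity"
proof -
  obtain Q where "minimal_poly a Q" using minimal_poly_exists[OF alg] .
  then interpret minimal_poly a Q .
  have le1: "v a \<le> 1" if "v \<in> places K" for v
  proof -
    have "real n * weil_height a \<le> 0" using h by (simp add: mult_nonneg_nonpos)
    then show ?thesis using place_le_height[OF that] by (auto intro: order_trans)
  qed
  obtain R where R: "\<bar>lead_coeff R\<bar> = 1" "degree R = alg_degree a" "rpoly (rat_poly R) a = 0"
    using integral_poly[OF alg a0, of 1] le1 by blast
  define Z where "Z = {z. rpoly P z = 0}"
  have cZ: "card Z = n" using card_roots by (simp add: Z_def)
  then have fZ: "finite Z" using degree_pos by (intro card_ge_0_finite) simp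
  have Z1: "cmod z \<le> 1" if z: "z \<in> Z" for z
  proof -
    obtain v where "v \<in> places K" "v a = cmod z" using conjugate_place[of z] z by (auto simp: Z_def)
    then show ?thesis using le1[of v] by simp
  qed
  obtain B where B: "\<And>p i. degree p < card Z \<Longrightarrow> \<forall>z\<in>Z. cmod (poly p z) \<le> 1 \<Longrightarrow> cmod (coeff p i) \<le> B"
    using coeff_bound_of_values[OF fZ] by blast
  have "\<exists>C :: int poly. degree C < n \<and> rpoly (rat_poly C) a = a ^ m" for m
    using power_int_combination[OF R(1) _ R(3)] R(2) alg_degree_eq degree_pos by simp
  then obtain C :: "nat \<Rightarrow> int poly" where C: "\<And>m. degree (C m) < n" "\<And>m. rpoly (rat_poly (C m)) a = a ^ m" by metis
  have "C m \<in> {R. degree R \<le> n \<and> (\<forall>i. \<bar>coeff R i\<bar> \<le> \<lfloor>B\<rfloor>)}" for m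
  proof -
    have "real_of_int \<bar>coeff (C m) i\<bar> \<le> B" for i
    proof -
      define p where "p = (map_poly of_rat (rat_poly (C m)) :: complex poly)"
      have "degree p < card Z" using C(1) cZ by (simp add: p_def degree_map_poly)
      moreover have "cmod (poly p z) \<le> 1" if z: "z \<in> Z" for z
      proof -
        have "rpoly (rat_poly (C m) - monom 1 m) a = 0" using C(2) by simp
        then have "rpoly (rat_poly (C m) - monom 1 m) z = 0"
          by (rule conjugate_root) (use z in \<open>simp add: Z_def\<close>)
        then have "poly p z = z ^ m" by (simp add: p_def rpoly_def[symmetric])
        then show ?thesis using Z1[OF z] by (simp add: norm_power power_le_one)
      qed
      ultimately have "cmod (coeff p i) \<le> B" using B by blast
      then show ?thesis by (simp add: p_def coeff_map_poly)
    qed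
    then show ?thesis using C(1)[of m] by (simp add: le_floor_iff)
  qed
  then have "range C \<subseteq> {R. degree R \<le> n \<and> (\<forall>i. \<bar>coeff R i\<bar> \<le> \<lfloor>B\<rfloor>)}" by blast
  then have "finite (range C)" using finite_int_polys finite_subset by blast
  then have "\<not> inj C" using finite_imageD infinite_UNIV_nat by blast
  then obtain i j where ij: "i < j" "C i = C j" by (metis injI linorder_neqE_nat)
  then have "a ^ i = a ^ j" using C(2) by metis
  also have "\<dots> = a ^ i * a ^ (j - i)" using ij(1) by (simp flip: power_add)
  finally have "a ^ (j - i) = 1" using a0 by simp
  then show ?thesis using ij(1) unfolding roots_of_unity_def by (intro CollectI exI[of _ "j - i"]) simp
qed

section \<open>Weights and Northcott numbers\<close>

lemma exists_min_on_finite_sublevels: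
  fixes f :: "'a \<Rightarrow> real"
  assumes "A \<noteq> {}" "\<And>B. finite {x \<in> A. f x \<le> B}"
  shows "\<exists>x\<in>A. \<forall>y\<in>A. f x \<le> f y"
proof -
  obtain x0 where x0: "x0 \<in> A" using assms(1) by blast
  define F where "F = {x \<in> A. f x \<le> f x0}"
  have F: "finite F" "x0 \<in> F" using assms(2) x0 by (auto simp: F_def)
  define x where "x = arg_min_on f F"
  have x: "x \<in> F" "\<And>y. y \<in> F \<Longrightarrow> f x \<le> f y"
    using arg_min_if_finite(1)[OF F(1), of f] arg_min_least[OF F(1), of _ f] F(2) by (auto simp: x_def)
  have "f x \<le> f y" if "y \<in> A" for y
    using x(2)[of y] x(2)[OF F(2)] that by (cases "y \<in> F") (auto simp: F_def)
  then show ?thesis using x(1) by (auto simp: F_def)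
qed

lemma Nor_positive_realI:
  assumes c: "0 < c" "finite {s \<in> S. h s < c}" and C: "infinite {s \<in> S. h s < C}"
  shows "\<exists>r>0. Nor S h = ereal r"
proof -
  define A where "A = {C. 0 < C \<and> infinite {s \<in> S. h s < C}}"
  have lb: "c \<le> x" if "x \<in> A" for x
  proof (rule ccontr)
    assume "\<not> c \<le> x"
    then have "{s \<in> S. h s < x} \<subseteq> {s \<in> S. h s < c}" by auto
    then show False using finite_subset[OF _ c(2)] that by (auto simp: A_def)
  qed
  have "C > c"
  proof (rule ccontr)
    assume "\<not> C > c"
    then have "{s \<in> S. h s < C} \<subseteq> {s \<in> S. h s < c}" by auto
    then show False using finite_subset[OF _ c(2)] C by blast
  qed
  then have CA: "C \<in> A" using c C by (simp add: A_def)
  have "Nor S h = Inf (ereal ` A)" by (simp add: Nor_def A_def)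
  also have "\<dots> = ereal (Inf A)"
    using CA lb by (intro ereal_Inf'[symmetric] bdd_belowI[of A c]) auto
  finally have "Nor S h = ereal (Inf A)" .
  moreover have "c \<le> Inf A" using CA lb by (intro cInf_greatest) auto
  ultimately show ?thesis using c(1) by (intro exI[of _ "Inf A"]) auto
qed

lemma infinite_of_unbounded_degree:
  fixes deg :: "'a \<Rightarrow> nat"
  assumes "\<And>N. \<exists>s\<in>A. N < deg s" shows "infinite A"
proof
  assume "finite A"
  then have "finite (deg ` A)" by simp
  then obtain N where "\<forall>d\<in>deg ` A. d \<le> N" using finite_nat_set_iff_bounded_le by blast
  then show False using assms[of N] by fastforce
qed

text \<open>The minimal heights \<open>m d\<close> of the individual degrees either accumulate at \<open>0\<close>, or tend to infinity,
  or neither. In the first case the reciprocal of the running minimum is a non-decreasing weight, in the second the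
  reciprocal of the minimum over the tail is a non-increasing one, in the third a constant weight works.\<close>
theorem ex_weight_positive_Nor:
  fixes deg :: "'a \<Rightarrow> nat" and h :: "'a \<Rightarrow> real"
  assumes northcott: "\<And>d B. finite {s \<in> S. deg s = d \<and> h s \<le> B}"
    and unbounded: "\<And>N. \<exists>s\<in>S. N < deg s"
    and pos: "finite {s \<in> S. h s \<le> 0}" and deg_pos: "\<And>s. s \<in> S \<Longrightarrow> 0 < deg s"
  shows "\<exists>w. weight w \<and> (\<exists>r>0. Nor S (\<lambda>s. w (deg s) * h s) = ereal r)"
proof -
  define S' where "S' = {s \<in> S. h s > 0}"
  have unb: "\<exists>s\<in>S'. N < deg s" for N
  proof -
    have "finite (deg ` {s \<in> S. h s \<le> 0})" using pos by simp
    then obtain M where M: "\<forall>d\<in>deg ` {s \<in> S. h s \<le> 0}. d \<le> M" using finite_nat_set_iff_bounded_le by blast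
    obtain s where "s \<in> S" "max N M < deg s" using unbounded by blast
    then show ?thesis using M by (intro bexI[of _ s]) (auto simp: S'_def not_le[symmetric])
  qed
  define D where "D = deg ` S'"
  have Dinf: "\<exists>d\<in>D. N < d" for N using unb[of N] by (auto simp: D_def)
  have "\<exists>s. s \<in> S' \<and> deg s = d \<and> (\<forall>t\<in>S'. deg t = d \<longrightarrow> h s \<le> h t)" if "d \<in> D" for d
  proof -
    have "\<exists>x\<in>{s \<in> S'. deg s = d}. \<forall>y\<in>{s \<in> S'. deg s = d}. h x \<le> h y"
    proof (rule exists_min_on_finite_sublevels)
      show "{s \<in> S'. deg s = d} \<noteq> {}" using that by (auto simp: D_def)
      show "finite {x \<in> {s \<in> S'. deg s = d}. h x \<le> B}" for B
        by (rule finite_subset[OF _ northcott[of d B]]) (auto simp: S'_def)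
    qed
    then show ?thesis by blast
  qed
  then obtain f where f: "\<And>d. d \<in> D \<Longrightarrow> f d \<in> S'" "\<And>d. d \<in> D \<Longrightarrow> deg (f d) = d"
    "\<And>d t. d \<in> D \<Longrightarrow> t \<in> S' \<Longrightarrow> deg t = d \<Longrightarrow> h (f d) \<le> h t" by metis
  define m where "m d = h (f d)" for d
  have m_pos: "m d > 0" if "d \<in> D" for d using f(1)[OF that] by (simp add: m_def S'_def)
  \<comment> \<open>It suffices to bound \<open>w d * m d\<close> from below, and from above for infinitely many \<open>d\<close>.\<close>
  have main: ?thesis if w: "weight w" and c: "0 < c" "\<And>d. d \<in> D \<Longrightarrow> c \<le> w d * m d"
    and C: "\<And>N. \<exists>d\<in>D. N < d \<and> w d * m d < C" for w c C
  proof -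
    have "\<exists>r>0. Nor S (\<lambda>s. w (deg s) * h s) = ereal r"
    proof (rule Nor_positive_realI[OF c(1)])
      have "c \<le> w (deg s) * h s" if s: "s \<in> S'" for s
      proof -
        have d: "deg s \<in> D" using s by (simp add: D_def)
        have "w (deg s) > 0" using w s deg_pos by (simp add: weight_def S'_def)
        then have "w (deg s) * m (deg s) \<le> w (deg s) * h s"
          using f(3)[OF d s] by (simp add: m_def)
        then show ?thesis using c(2)[OF d] by simp
      qed
      then have "{s \<in> S. w (deg s) * h s < c} \<subseteq> {s \<in> S. h s \<le> 0}"
        by (force simp: S'_def)
      then show "finite {s \<in> S. w (deg s) * h s < c}" using pos by (rule finite_subset)
      show "infinite {s \<in> S. w (deg s) * h s < C}"
      proof (rule infinite_of_unbounded_degree)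
        fix N
        obtain d where "d \<in> D" "N < d" "w d * m d < C" using C by blast
        then show "\<exists>s\<in>{s \<in> S. w (deg s) * h s < C}. N < deg s"
          using f(1,2)[of d] by (intro bexI[of _ "f d"]) (auto simp: S'_def m_def)
      qed
    qed
    then show ?thesis using w by blast
  qed
  obtain d0 where d0: "d0 \<in> D" "\<And>d. d \<in> D \<Longrightarrow> d0 \<le> d"
    using Dinf ex_has_least_nat[of "\<lambda>d. d \<in> D" _ "\<lambda>d. d"] by blast
  consider (zero) "\<And>e. 0 < e \<Longrightarrow> \<exists>d\<in>D. m d < e" | (infinity) "\<And>B. finite {d \<in> D. m d \<le> B}"
    | (between) e B where "0 < e" "\<And>d. d \<in> D \<Longrightarrow> e \<le> m d" "infinite {d \<in> D. m d \<le> B}"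
    by (meson not_le)
  then show ?thesis
  proof cases
    case zero
    have "\<exists>e. d0 \<le> n \<longrightarrow> e \<in> D \<and> e \<le> n \<and> (\<forall>d\<in>D. d \<le> n \<longrightarrow> m e \<le> m d)" for n
    proof (cases "d0 \<le> n")
      case True
      have "\<exists>x\<in>{d \<in> D. d \<le> n}. \<forall>y\<in>{d \<in> D. d \<le> n}. m x \<le> m y"
        by (rule exists_min_on_finite_sublevels) (use True d0 in auto)
      then show ?thesis by blast
    qed blast
    then obtain g where g: "\<And>n. d0 \<le> n \<Longrightarrow> g n \<in> D" "\<And>n. d0 \<le> n \<Longrightarrow> g n \<le> n"
      "\<And>n d. d0 \<le> n \<Longrightarrow> d \<in> D \<Longrightarrow> d \<le> n \<Longrightarrow> m (g n) \<le> m d" by metis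
    \<comment> \<open>Below \<open>d0\<close>, the least element of \<open>D\<close>, there is no minimum to take, and the value only has to be positive.\<close>
    define w where "w n = (if d0 \<le> n then 1 / m (g n) else 1 / m d0)" for n
    show ?thesis
    proof (rule main[of w 1 2])
      have "mono_on {d0..} w"
      proof (rule mono_onI)
        fix n k assume "n \<in> {d0..}" "k \<in> {d0..}" "n \<le> k"
        then have "m (g k) \<le> m (g n)" using g(1,2)[of n] by (intro g(3)) auto
        then show "w n \<le> w k" using \<open>n \<in> _\<close> \<open>k \<in> _\<close> m_pos g(1) by (simp add: w_def frac_le)
      qed
      then show "weight w" using m_pos g(1) d0 by (auto simp: weight_def w_def)
      show "1 \<le> w d * m d" if d: "d \<in> D" for d
        using g(3)[OF d0(2)[OF d] d] m_pos[OF g(1)[OF d0(2)[OF d]]] d0(2)[OF d] by (simp add: w_def)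
      fix N
      \<comment> \<open>A new record after \<open>k\<close>: the minimum up to \<open>d1\<close> is attained at some \<open>e\<close> beyond \<open>k\<close>, where \<open>w e * m e = 1\<close>.\<close>
      define k where "k = max N d0"
      obtain d1 where d1: "d1 \<in> D" "m d1 < m (g k)" using zero m_pos g(1)[of k] by (auto simp: k_def)
      have d1k: "k < d1" using g(3)[of k d1] d1 by (force simp: k_def)
      define e where "e = g d1"
      have e: "e \<in> D" "e \<le> d1" "m e \<le> m d1" using g[of d1] d1 d1k by (auto simp: e_def k_def)
      have ek: "k < e" using g(3)[of k e] e d1 by (force simp: k_def)
      then have "m (g e) \<le> m e" "m e \<le> m (g e)"
        using g(3)[of e e] e g(1,2)[of e] g(3)[of d1 "g e"] d1k by (auto simp: k_def e_def)
      then have "w e * m e = 1" using ek m_pos[OF e(1)] by (simp add: w_def k_def)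
      then show "\<exists>d\<in>D. N < d \<and> w d * m d < 2" using e(1) ek by (intro bexI[of _ e]) (auto simp: k_def)
    qed simp
  next
    case infinity
    have "\<exists>e. e \<in> D \<and> n \<le> e \<and> (\<forall>d\<in>D. n \<le> d \<longrightarrow> m e \<le> m d)" for n
    proof -
      have "\<exists>x\<in>{d \<in> D. n \<le> d}. \<forall>y\<in>{d \<in> D. n \<le> d}. m x \<le> m y"
      proof (rule exists_min_on_finite_sublevels)
        show "{d \<in> D. n \<le> d} \<noteq> {}" using Dinf[of n] less_imp_le by blast
        show "finite {x \<in> {d \<in> D. n \<le> d}. m x \<le> B}" for B
          by (rule finite_subset[OF _ infinity[of B]]) auto
      qed
      then show ?thesis by blast
    qed
    then obtain g where g: "\<And>n. g n \<in> D" "\<And>n. n \<le> g n"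
      "\<And>n d. d \<in> D \<Longrightarrow> n \<le> d \<Longrightarrow> m (g n) \<le> m d" by metis
    define w where "w n = 1 / m (g n)" for n
    show ?thesis
    proof (rule main[of w 1 2])
      have "antimono_on {0..} w"
      proof (rule monotone_onI)
        fix n k :: nat assume "n \<le> k"
        then have "m (g n) \<le> m (g k)" using g(1,2)[of k] by (intro g(3)) auto
        then show "w k \<le> w n" using m_pos g(1) by (simp add: w_def frac_le)
      qed
      then have "\<exists>N. antimono_on {N..} w \<or> mono_on {N..} w" by blast
      moreover have "\<forall>n>0. 0 < w n" using m_pos g(1) by (simp add: w_def)
      ultimately show "weight w" by (simp add: weight_def)
      show "1 \<le> w d * m d" if d: "d \<in> D" for d
        using g(3)[OF d order_refl] m_pos[OF g(1)] by (simp add: w_def)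
      fix N
      define e where "e = g (Suc N)"
      have e: "e \<in> D" "N < e" using g(1) g(2)[of "Suc N"] by (auto simp: e_def)
      have "m (g e) \<le> m e" "m e \<le> m (g e)"
        using g(3)[of e e] e g(1,2)[of e] g(3)[of "g e" "Suc N"] by (auto simp: e_def)
      then have "w e * m e = 1" using m_pos[OF e(1)] by (simp add: w_def)
      then show "\<exists>d\<in>D. N < d \<and> w d * m d < 2" using e by (intro bexI[of _ e]) auto
    qed simp
  next
    case between
    show ?thesis
    proof (rule main[of "\<lambda>_. 1" e "B + 1"])
      show "weight (\<lambda>_. 1)" by (auto simp: weight_def monotone_on_def)
      fix N
      obtain d where "d > N" "d \<in> D" "m d \<le> B" using between(3) unfolding infinite_nat_iff_unbounded by blast
      then show "\<exists>d\<in>D. N < d \<and> 1 * m d < B + 1" by (intro bexI[of _ d]) auto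
    qed (use between in auto)
  qed
qed

theorem corollary3p5:
  fixes L :: "complex set"
  assumes "subfield L \<CC>"
    and "L \<subseteq> Qbar"
    and "\<not> ring.finite_dimension \<CC> \<rat> L"
  shows "\<exists>w. weight w \<and>
           (\<exists>r::real. 0 < r \<and> Nor (L - roots_of_unity) (weighted_height w) = ereal r)"
proof -
  define S where "S = L - roots_of_unity"
  have alg: "algebraic a" if "a \<in> S" for a using that assms(2) by (auto simp: S_def Qbar_def)
  have "\<exists>w. weight w \<and> (\<exists>r>0. Nor S (\<lambda>a. w (alg_degree a) * weil_height a) = ereal r)"
  proof (rule ex_weight_positive_Nor)
    show "finite {s \<in> S. alg_degree s = d \<and> weil_height s \<le> B}" for d B
      by (rule finite_subset[OF _ northcott[of d B]]) (use alg in auto)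
    show "0 < alg_degree s" if "s \<in> S" for s
      using minimal_poly_exists[OF alg[OF that]] minimal_poly.alg_degree_eq minimal_poly.degree_pos by metis
    have "{s \<in> S. weil_height s \<le> 0} \<subseteq> {0}" using kronecker alg by (auto simp: S_def)
    then show "finite {s \<in> S. weil_height s \<le> 0}" by (rule finite_subset) simp
    fix N
    obtain a where a: "a \<in> L" "N < alg_degree a" using unbounded_degrees[OF assms] by blast
    show "\<exists>s\<in>S. N < alg_degree s"
    proof (cases "a \<in> roots_of_unity")
      case False
      then show ?thesis using a by (auto simp: S_def)
    next
      case True
      \<comment> \<open>Doubling changes neither the field nor the degree, but the result has modulus \<open>2\<close>.\<close>
      then obtain k where k: "k > 0" "a ^ k = 1" by (auto simp: roots_of_unity_def)
      have "2 * a \<notin> roots_of_unity"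
      proof
        assume "2 * a \<in> roots_of_unity"
        then obtain j where j: "j > 0" "(2 * a) ^ j = 1" by (auto simp: roots_of_unity_def)
        have "cmod a ^ k = 1" using k(2) by (metis norm_one norm_power)
        then have "cmod a = 1" using k(1) by (metis norm_ge_zero power_eq_1_iff gr0_implies_Suc neq0_conv power_eq_imp_eq_base power_one zero_le_one)
        then have "(2 :: real) ^ j = cmod ((2 * a) ^ j)" by (simp add: norm_power norm_mult)
        then have "(2 :: real) ^ j = 1" using j(2) by simp
        then show False using j(1) one_less_power[of "2::real" j] by simp
      qed
      moreover have "2 * a \<in> L" using subfield_CC_D(5,11)[OF assms(1)] a(1) by (metis of_int_numeral)
      moreover have "alg_degree (2 * a) = alg_degree a"
        using adjoin_nat_mult[of 2 a] by (simp add: alg_degree_def)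
      ultimately show ?thesis using a(2) by (intro bexI[of _ "2 * a"]) (auto simp: S_def)
    qed
  qed
  then show ?thesis by (simp only: S_def weighted_height_def[abs_def])
qed

end
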